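(* Let $L$ be the logic MSO or GSO. For every $\tau$-formula $\Phi\in L_{k,q}[\tau]$ and every width $w$, there is a first-order $\tau^{L}_{k,q}$-formula $\alpha_{\Phi,w}$ without free variables such that the following holds: For every rooted partition $F=(\mathcal{S}_i)_{i\in I}$ of a width-$w$ rooted $\tau$-structure $\mathcal{S}$ and every guarded variable assignment $a$ we have $$\mathcal{I}^{L}_{k,q}(F,a)\models\alpha_{\Phi,w}\quad\text{if, and only if,}\quad(\mathcal{S},a)\models\Phi .$$
   Context: **Structures.** $\tau$ is an arbitrary vocabulary; all vocabularies are finite and purely relational. A structure $\mathcal{S}$ over $\tau$ has universe $S$ and a relation $R^{\mathcal{S}}\subseteq S^r$ for each $r$-ary $R\in\tau$. $\mathcal{S}$ is an induced substructure of $\mathcal{S}'$ if $S\subseteq S'$ and $R^{\mathcal{S}}=R^{\mathcal{S}'}\cap S^r$ for all $r$-ary $R\in\tau$. The union of structures is formed by taking the union of the universes and of each relation. The Gaifman graph of a relation $R\subseteq S^r$ is the undirected graph on $S$ in which two distinct elements are adjacent iff they occur in a common tuple of $R$; the Gaifman graph of $\mathcal{S}$ is the union of those of its relations; a relation $R$ on $S$ is guarded in $\mathcal{S}$ if its Gaifman graph is a subgraph of that of $\mathcal{S}$. **Second-order formulas.** Second-order formulas are taken to contain no first-order variables. Each second-order variable $X$ has an arity $r(X)$. The atomic formulas are $\mathrm{empty}(X)$ for monadic (i.e. arity-1) $X$ (true iff $a(X)=\emptyset$) and $\mathrm{elem}(Y_1,\dots,Y_r,Z)$, where the $Y_i$ are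 monadic second-order variables and $Z$ is an $r$-ary relation symbol of $\tau$ or an $r$-ary second-order variable (true iff $|a(Y_i)|=1$ for all $i$ and $a(Y_1)\times\dots\times a(Y_r)$ is contained in $Z^{\mathcal{S}}$, respectively in $a(Z)$). In these atoms, monadic relation symbols of $\tau$ may also be used in place of the monadic variables, with the obvious meaning. Formulas are built from atoms with $\neg$, $\wedge$ and $\exists X$. In MSO (monadic second-order logic) all second-order variables are monadic; in GSO (guarded second-order logic) variables of any arity may occur, but bound and free variables may only be assigned relations guarded in the structure. A variable assignment is guarded if all its values are guarded relations. **Types.** $k$ and $q$ are arbitrary natural numbers. $L_{k,q}[\tau]$ is the set of $L$-formulas over $\tau$ whose free variables lie in $\{X_1,\dots,X_k\}$ and whose quantifier rank (nesting depth of quantifiers) is at most $q$; the assignments $a$ considered have domain $\{X_1,\dots,X_k\}$. The $k$-variable rank-$q$ $L$-type $\mathrm{type}^{L}_{k,q}(\mathcal{S},a)$ of a structure $\mathcal{S}$ with guarded assignment $a$ is the set of all $\Phi\in L_{k,q}[\tau]$ with $(\mathcal{S},a)\models\Phi$. $\Sigma^{L}_{k,q}$ is the set of all these types (over $\tau$). As a known fact, $L_{k,q}[\tau]$ contains only finitely many formulas up to logical equivalence, so $\Sigma^{L}_{k,q}$ is treated as a finite alphabet. $\tau^{L}_{k,q}$ is the vocabulary with one monadic relation symbol $T$ for each $T\in\Sigma^{L}_{k,q}$. **Type indicators.** For a family $F=(\mathcal{S}_i)_{i\in I}$ of $\tau$-structures (the index set $I$ is not necessarily finite) and a map $a$ assigning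 to each $X\in\{X_1,\dots,X_k\}$ a relation $a(X)\subseteq(\bigcup_{i\in I}S_i)^{r(X)}$, put $a_i(X)=a(X)\cap S_i^{r(X)}$. The $L$-type indicator $\mathcal{I}^{L}_{k,q}(F,a)$ is the $\tau^{L}_{k,q}$-structure with universe $I$ in which each $T\in\Sigma^{L}_{k,q}$ is interpreted as $\{i\in I\mid T=\mathrm{type}^{L}_{k,q}(\mathcal{S}_i,a_i)\}$. **Rooted structures and partitions.** For a width $w\ge 0$, a width-$w$ rooted structure is a structure $\mathcal{S}$ over a vocabulary $\tau$ containing special monadic relation symbols $B_1,\dots,B_w$ such that each $B_\ell^{\mathcal{S}}$ is a singleton; its bag is $B(\mathcal{S})=\bigcup_{\ell=1}^{w}B_\ell^{\mathcal{S}}$. A rooted partition of $\mathcal{S}$ is a family $(\mathcal{S}_i)_{i\in I}$ of $\tau$-structures such that (a) the union of all $\mathcal{S}_i$ is exactly $\mathcal{S}$; (b) each $\mathcal{S}_i$ is an induced substructure of $\mathcal{S}$; (c) $S_i\cap S_j=B(\mathcal{S})$ for all distinct $i,j\in I$.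
   Formalization: For GSO, types use only formulas whose quantified variables have arity at most m, for each m above a threshold depending on Φ, and types of unguarded assignments are also letters; if I is empty the X_j must have positive arity; α is obtained for each fixed carrier and index type. *)

theory Defs
  imports Main
begin

section \<open>Vocabularies and structures\<close>

record 'r vocab =
  syms :: "'r set"
  ar :: "'r \<Rightarrow> nat"

definition vocabulary :: "'r vocab \<Rightarrow> bool" where
  "vocabulary \<tau> \<longleftrightarrow> finite (syms \<tau>)"

definition tuples :: "'a set \<Rightarrow> nat \<Rightarrow> 'a list set" where
  "tuples A r = {t. set t \<subseteq> A \<and> length t = r}"

text \<open>The value of \<open>rel S R\<close> is irrelevant when \<open>R\<close> is not a symbol of the vocabulary at hand;
  all notions below only look at \<open>rel S R\<close> for \<open>R \<in> syms \<tau>\<close>. Universes may be empty.\<close>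

record ('r, 'a) struct =
  univ :: "'a set"
  rel :: "'r \<Rightarrow> 'a list set"

definition structure_over :: "'r vocab \<Rightarrow> ('r, 'a) struct \<Rightarrow> bool" where
  "structure_over \<tau> S \<longleftrightarrow> (\<forall>R\<in>syms \<tau>. rel S R \<subseteq> tuples (univ S) (ar \<tau> R))"

definition struct_eq :: "'r vocab \<Rightarrow> ('r, 'a) struct \<Rightarrow> ('r, 'a) struct \<Rightarrow> bool" where
  "struct_eq \<tau> S S' \<longleftrightarrow> univ S = univ S' \<and> (\<forall>R\<in>syms \<tau>. rel S R = rel S' R)"

definition induced_substructure :: "'r vocab \<Rightarrow> ('r, 'a) struct \<Rightarrow> ('r, 'a) struct \<Rightarrow> bool" where
  "induced_substructure \<tau> S S' \<longleftrightarrow> univ S \<subseteq> univ S' \<and>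
     (\<forall>R\<in>syms \<tau>. rel S R = rel S' R \<inter> tuples (univ S) (ar \<tau> R))"

definition struct_Union :: "'i set \<Rightarrow> ('i \<Rightarrow> ('r, 'a) struct) \<Rightarrow> ('r, 'a) struct" where
  "struct_Union I F = \<lparr>univ = (\<Union>i\<in>I. univ (F i)), rel = (\<lambda>R. \<Union>i\<in>I. rel (F i) R)\<rparr>"

definition gaifman_rel :: "'a list set \<Rightarrow> ('a \<times> 'a) set" where
  "gaifman_rel P = {(x, y). x \<noteq> y \<and> (\<exists>t\<in>P. x \<in> set t \<and> y \<in> set t)}"

definition gaifman :: "'r vocab \<Rightarrow> ('r, 'a) struct \<Rightarrow> ('a \<times> 'a) set" where
  "gaifman \<tau> S = (\<Union>R\<in>syms \<tau>. gaifman_rel (rel S R))"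

definition guarded :: "'r vocab \<Rightarrow> ('r, 'a) struct \<Rightarrow> 'a list set \<Rightarrow> bool" where
  "guarded \<tau> S P \<longleftrightarrow> gaifman_rel P \<subseteq> gaifman \<tau> S"


section \<open>Second-order formulas\<close>

datatype sovar = SOVar (sv_name: nat) (sv_arity: nat)

text \<open>A predicate is a relation symbol or a second-order variable; \<open>SEmpty\<close> and the argument list
  of \<open>SElem\<close> take monadic predicates.\<close>

datatype 'r pred = Sym 'r | Var sovar

datatype 'r so =
    SEmpty "'r pred"
  | SElem "'r pred list" "'r pred"
  | SNeg "'r so"
  | SConj "'r so" "'r so"
  | SEx sovar "'r so"

datatype logic = MSO | GSO

definition logic_var :: "logic \<Rightarrow> sovar \<Rightarrow> bool" where
  "logic_var L X \<longleftrightarrow> (L = MSO \<longrightarrow> sv_arity X = 1)"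

fun pred_arity :: "'r vocab \<Rightarrow> 'r pred \<Rightarrow> nat" where
  "pred_arity \<tau> (Sym R) = ar \<tau> R"
| "pred_arity \<tau> (Var X) = sv_arity X"

fun pred_wf :: "logic \<Rightarrow> 'r vocab \<Rightarrow> 'r pred \<Rightarrow> bool" where
  "pred_wf L \<tau> (Sym R) \<longleftrightarrow> R \<in> syms \<tau>"
| "pred_wf L \<tau> (Var X) \<longleftrightarrow> logic_var L X"

fun so_wf :: "logic \<Rightarrow> 'r vocab \<Rightarrow> 'r so \<Rightarrow> bool" where
  "so_wf L \<tau> (SEmpty Y) \<longleftrightarrow> pred_wf L \<tau> Y \<and> pred_arity \<tau> Y = 1"
| "so_wf L \<tau> (SElem Ys Z) \<longleftrightarrow> (\<forall>Y\<in>set Ys. pred_wf L \<tau> Y \<and> pred_arity \<tau> Y = 1) \<and>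
     pred_wf L \<tau> Z \<and> pred_arity \<tau> Z = length Ys"
| "so_wf L \<tau> (SNeg \<phi>) \<longleftrightarrow> so_wf L \<tau> \<phi>"
| "so_wf L \<tau> (SConj \<phi> \<psi>) \<longleftrightarrow> so_wf L \<tau> \<phi> \<and> so_wf L \<tau> \<psi>"
| "so_wf L \<tau> (SEx X \<phi>) \<longleftrightarrow> logic_var L X \<and> so_wf L \<tau> \<phi>"

fun pred_fv :: "'r pred \<Rightarrow> sovar set" where
  "pred_fv (Sym R) = {}"
| "pred_fv (Var X) = {X}"

fun so_fv :: "'r so \<Rightarrow> sovar set" where
  "so_fv (SEmpty Y) = pred_fv Y"
| "so_fv (SElem Ys Z) = (\<Union>Y\<in>set Ys. pred_fv Y) \<union> pred_fv Z"
| "so_fv (SNeg \<phi>) = so_fv \<phi>"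
| "so_fv (SConj \<phi> \<psi>) = so_fv \<phi> \<union> so_fv \<psi>"
| "so_fv (SEx X \<phi>) = so_fv \<phi> - {X}"

fun so_bv :: "'r so \<Rightarrow> sovar set" where
  "so_bv (SEmpty Y) = {}"
| "so_bv (SElem Ys Z) = {}"
| "so_bv (SNeg \<phi>) = so_bv \<phi>"
| "so_bv (SConj \<phi> \<psi>) = so_bv \<phi> \<union> so_bv \<psi>"
| "so_bv (SEx X \<phi>) = insert X (so_bv \<phi>)"

fun so_qr :: "'r so \<Rightarrow> nat" where
  "so_qr (SEmpty Y) = 0"
| "so_qr (SElem Ys Z) = 0"
| "so_qr (SNeg \<phi>) = so_qr \<phi>"
| "so_qr (SConj \<phi> \<psi>) = max (so_qr \<phi>) (so_qr \<psi>)"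
| "so_qr (SEx X \<phi>) = Suc (so_qr \<phi>)"

type_synonym 'a assignment = "sovar \<Rightarrow> 'a list set"

fun pred_val :: "('r, 'a) struct \<Rightarrow> 'a assignment \<Rightarrow> 'r pred \<Rightarrow> 'a list set" where
  "pred_val S a (Sym R) = rel S R"
| "pred_val S a (Var X) = a X"

text \<open>Monadic relations are sets of one-element lists, so the product of the values of the
  predicates \<open>Ys\<close> is the set of lists \<open>t\<close> with \<open>[t ! j]\<close> in the value of \<open>Ys ! j\<close>. Quantifiers
  range over guarded relations in both logics; for MSO this is no restriction, see
  \<open>monadic_guarded\<close> below.\<close>

fun so_sat :: "'r vocab \<Rightarrow> ('r, 'a) struct \<Rightarrow> 'a assignment \<Rightarrow> 'r so \<Rightarrow> bool" where
  "so_sat \<tau> S a (SEmpty Y) \<longleftrightarrow> pred_val S a Y = {}"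
| "so_sat \<tau> S a (SElem Ys Z) \<longleftrightarrow> (\<forall>Y\<in>set Ys. card (pred_val S a Y) = 1) \<and>
     {t. length t = length Ys \<and> (\<forall>j<length Ys. [t ! j] \<in> pred_val S a (Ys ! j))} \<subseteq> pred_val S a Z"
| "so_sat \<tau> S a (SNeg \<phi>) \<longleftrightarrow> \<not> so_sat \<tau> S a \<phi>"
| "so_sat \<tau> S a (SConj \<phi> \<psi>) \<longleftrightarrow> so_sat \<tau> S a \<phi> \<and> so_sat \<tau> S a \<psi>"
| "so_sat \<tau> S a (SEx X \<phi>) \<longleftrightarrow>
     (\<exists>P \<subseteq> tuples (univ S) (sv_arity X). guarded \<tau> S P \<and> so_sat \<tau> S (a(X := P)) \<phi>)"

lemma monadic_guarded: "P \<subseteq> tuples A 1 \<Longrightarrow> guarded \<tau> S P"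
  by (auto simp: guarded_def gaifman_rel_def tuples_def length_Suc_conv)


section \<open>Types\<close>

text \<open>The distinguished variables \<open>X\<^sub>1, \<dots>, X\<^sub>k\<close> are \<open>xvar \<rho> 1, \<dots>, xvar \<rho> k\<close>, where \<open>\<rho>\<close> gives
  their arities.\<close>

definition xvar :: "(nat \<Rightarrow> nat) \<Rightarrow> nat \<Rightarrow> sovar" where
  "xvar \<rho> j = SOVar j (\<rho> j)"

definition formulas :: "logic \<Rightarrow> 'r vocab \<Rightarrow> (nat \<Rightarrow> nat) \<Rightarrow> nat \<Rightarrow> nat \<Rightarrow> 'r so set" where
  "formulas L \<tau> \<rho> k q = {\<phi>. so_wf L \<tau> \<phi> \<and> so_fv \<phi> \<subseteq> xvar \<rho> ` {1..k} \<and> so_qr \<phi> \<le> q}"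

definition assignment_on :: "(nat \<Rightarrow> nat) \<Rightarrow> nat \<Rightarrow> ('r, 'a) struct \<Rightarrow> 'a assignment \<Rightarrow> bool" where
  "assignment_on \<rho> k S a \<longleftrightarrow> (\<forall>j\<in>{1..k}. a (xvar \<rho> j) \<subseteq> tuples (univ S) (\<rho> j))"

definition guarded_assignment ::
    "'r vocab \<Rightarrow> (nat \<Rightarrow> nat) \<Rightarrow> nat \<Rightarrow> ('r, 'a) struct \<Rightarrow> 'a assignment \<Rightarrow> bool" where
  "guarded_assignment \<tau> \<rho> k S a \<longleftrightarrow>
     assignment_on \<rho> k S a \<and> (\<forall>j\<in>{1..k}. guarded \<tau> S (a (xvar \<rho> j)))"

text \<open>There are only finitely many formulas up to equivalence once the arities of the quantified
  variables are bounded. Without a bound this fails for GSO: on structures in which all pairs are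
  guarded, one quantified relation of arity \<open>n\<close> encodes \<open>2 ^ n - 2\<close> binary relations through the
  pattern of entries \<open>x\<close> and \<open>y\<close> in a tuple, so that a fixed rank suffices to bound the size of
  the universe by arbitrarily large numbers. Types are therefore relative to a bound \<open>m\<close> on the
  arities of quantified variables. For MSO, every \<open>m \<ge> 1\<close> gives all formulas.\<close>

definition formulas_bd ::
    "nat \<Rightarrow> logic \<Rightarrow> 'r vocab \<Rightarrow> (nat \<Rightarrow> nat) \<Rightarrow> nat \<Rightarrow> nat \<Rightarrow> 'r so set" where
  "formulas_bd m L \<tau> \<rho> k q = {\<phi> \<in> formulas L \<tau> \<rho> k q. \<forall>X\<in>so_bv \<phi>. sv_arity X \<le> m}"

lemma formulas_bd_MSO:
  assumes "1 \<le> m"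
  shows "formulas_bd m MSO \<tau> \<rho> k q = formulas MSO \<tau> \<rho> k q"
proof -
  have "\<forall>X\<in>so_bv \<phi>. sv_arity X = 1" if "so_wf MSO \<tau> \<phi>" for \<phi>
    using that by (induction \<phi>) (auto simp: logic_var_def)
  then show ?thesis
    using assms by (auto simp: formulas_bd_def formulas_def)
qed

lemma formulas_eq_Union_formulas_bd: "formulas L \<tau> \<rho> k q = (\<Union>m. formulas_bd m L \<tau> \<rho> k q)"
proof -
  have "\<exists>m. \<forall>X\<in>so_bv \<phi>. sv_arity X \<le> m" for \<phi> :: "'a so"
  proof -
    have "finite (so_bv \<phi>)"
      by (induction \<phi>) auto
    then have "\<forall>X\<in>so_bv \<phi>. sv_arity X \<le> Max (sv_arity ` so_bv \<phi>)"
      by simp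
    then show ?thesis ..
  qed
  then show ?thesis
    by (auto simp: formulas_bd_def)
qed

definition so_type :: "nat \<Rightarrow> logic \<Rightarrow> 'r vocab \<Rightarrow> (nat \<Rightarrow> nat) \<Rightarrow> nat \<Rightarrow> nat \<Rightarrow>
    ('r, 'a) struct \<Rightarrow> 'a assignment \<Rightarrow> 'r so set" where
  "so_type m L \<tau> \<rho> k q S a = {\<phi> \<in> formulas_bd m L \<tau> \<rho> k q. so_sat \<tau> S a \<phi>}"

text \<open>The assignments here need not be guarded: if \<open>a\<close> is guarded in \<open>S\<close>, its restriction to a part
  \<open>S\<^sub>i\<close> of a rooted partition need not be guarded in \<open>S\<^sub>i\<close>, because two bag elements may be adjacent
  in \<open>S\<close> only through a tuple of another part. The types of all parts have to be letters of the
  alphabet. The type argument fixes the HOL type that universes are taken from.\<close>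

definition all_types :: "'a itself \<Rightarrow> nat \<Rightarrow> logic \<Rightarrow> 'r vocab \<Rightarrow> (nat \<Rightarrow> nat) \<Rightarrow> nat \<Rightarrow> nat \<Rightarrow>
    'r so set set" where
  "all_types _ m L \<tau> \<rho> k q =
     {so_type m L \<tau> \<rho> k q S a | (S :: ('r, 'a) struct) a. structure_over \<tau> S \<and> assignment_on \<rho> k S a}"

definition type_vocab :: "'a itself \<Rightarrow> nat \<Rightarrow> logic \<Rightarrow> 'r vocab \<Rightarrow> (nat \<Rightarrow> nat) \<Rightarrow> nat \<Rightarrow> nat \<Rightarrow>
    'r so set vocab" where
  "type_vocab ty m L \<tau> \<rho> k q = \<lparr>syms = all_types ty m L \<tau> \<rho> k q, ar = (\<lambda>_. 1)\<rparr>"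

definition restrict_assignment :: "'a assignment \<Rightarrow> 'a set \<Rightarrow> 'a assignment" where
  "restrict_assignment a A = (\<lambda>X. a X \<inter> tuples A (sv_arity X))"

definition type_indicator :: "nat \<Rightarrow> logic \<Rightarrow> 'r vocab \<Rightarrow> (nat \<Rightarrow> nat) \<Rightarrow> nat \<Rightarrow> nat \<Rightarrow>
    'i set \<Rightarrow> ('i \<Rightarrow> ('r, 'a) struct) \<Rightarrow> 'a assignment \<Rightarrow> ('r so set, 'i) struct" where
  "type_indicator m L \<tau> \<rho> k q I F a =
     \<lparr>univ = I,
      rel = (\<lambda>T. {[i] | i. i \<in> I \<and>
        T = so_type m L \<tau> \<rho> k q (F i) (restrict_assignment a (univ (F i)))})\<rparr>"


section \<open>First-order logic\<close>

datatype 's fo =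
    FEq nat nat
  | FRel 's "nat list"
  | FNeg "'s fo"
  | FConj "'s fo" "'s fo"
  | FEx nat "'s fo"

fun fo_wf :: "'s vocab \<Rightarrow> 's fo \<Rightarrow> bool" where
  "fo_wf \<sigma> (FEq x y) \<longleftrightarrow> True"
| "fo_wf \<sigma> (FRel R xs) \<longleftrightarrow> R \<in> syms \<sigma> \<and> length xs = ar \<sigma> R"
| "fo_wf \<sigma> (FNeg \<alpha>) \<longleftrightarrow> fo_wf \<sigma> \<alpha>"
| "fo_wf \<sigma> (FConj \<alpha> \<beta>) \<longleftrightarrow> fo_wf \<sigma> \<alpha> \<and> fo_wf \<sigma> \<beta>"
| "fo_wf \<sigma> (FEx x \<alpha>) \<longleftrightarrow> fo_wf \<sigma> \<alpha>"

fun fo_fv :: "'s fo \<Rightarrow> nat set" where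
  "fo_fv (FEq x y) = {x, y}"
| "fo_fv (FRel R xs) = set xs"
| "fo_fv (FNeg \<alpha>) = fo_fv \<alpha>"
| "fo_fv (FConj \<alpha> \<beta>) = fo_fv \<alpha> \<union> fo_fv \<beta>"
| "fo_fv (FEx x \<alpha>) = fo_fv \<alpha> - {x}"

definition fo_sentences :: "'s vocab \<Rightarrow> 's fo set" where
  "fo_sentences \<sigma> = {\<alpha>. fo_wf \<sigma> \<alpha> \<and> fo_fv \<alpha> = {}}"

fun fo_sat :: "('s, 'i) struct \<Rightarrow> (nat \<Rightarrow> 'i) \<Rightarrow> 's fo \<Rightarrow> bool" where
  "fo_sat A e (FEq x y) \<longleftrightarrow> e x = e y"
| "fo_sat A e (FRel R xs) \<longleftrightarrow> map e xs \<in> rel A R"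
| "fo_sat A e (FNeg \<alpha>) \<longleftrightarrow> \<not> fo_sat A e \<alpha>"
| "fo_sat A e (FConj \<alpha> \<beta>) \<longleftrightarrow> fo_sat A e \<alpha> \<and> fo_sat A e \<beta>"
| "fo_sat A e (FEx x \<alpha>) \<longleftrightarrow> (\<exists>i\<in>univ A. fo_sat A (e(x := i)) \<alpha>)"

text \<open>For sentences the choice of \<open>e\<close> is irrelevant. Quantifying over \<open>e\<close> avoids picking an element of
  a possibly empty universe.\<close>

definition fo_models :: "('s, 'i) struct \<Rightarrow> 's fo \<Rightarrow> bool" where
  "fo_models A \<alpha> \<longleftrightarrow> (\<forall>e. fo_sat A e \<alpha>)"

lemma fo_sat_cong: "(\<And>x. x \<in> fo_fv \<alpha> \<Longrightarrow> e x = e' x) \<Longrightarrow> fo_sat A e \<alpha> = fo_sat A e' \<alpha>"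
proof (induction \<alpha> arbitrary: e e')
  case (FRel R xs)
  then have "map e xs = map e' xs" by (auto intro: map_cong)
  then show ?case by (simp del: map_eq_conv)
next
  case (FNeg \<alpha>)
  then have "fo_sat A e \<alpha> = fo_sat A e' \<alpha>" by (metis fo_fv.simps(3))
  then show ?case by simp
next
  case (FConj \<alpha> \<beta>)
  then have "fo_sat A e \<alpha> = fo_sat A e' \<alpha>" "fo_sat A e \<beta> = fo_sat A e' \<beta>"
    by (metis UnI1 fo_fv.simps(4), metis UnI2 FConj fo_fv.simps(4))
  then show ?case by simp
next
  case (FEx x \<alpha>)
  have "fo_sat A (e(x := i)) \<alpha> = fo_sat A (e'(x := i)) \<alpha>" for i
    by (rule FEx.IH) (use FEx.prems in auto)
  then show ?case by simp
qed simp

lemma fo_models_sentence: "\<alpha> \<in> fo_sentences \<sigma> \<Longrightarrow> fo_models A \<alpha> \<longleftrightarrow> fo_sat A e \<alpha>"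
  unfolding fo_models_def fo_sentences_def using fo_sat_cong[of \<alpha>] by blast


section \<open>Rooted structures and partitions\<close>

definition root_symbols :: "'r vocab \<Rightarrow> nat \<Rightarrow> (nat \<Rightarrow> 'r) \<Rightarrow> bool" where
  "root_symbols \<tau> w B \<longleftrightarrow> inj_on B {1..w} \<and> (\<forall>l\<in>{1..w}. B l \<in> syms \<tau> \<and> ar \<tau> (B l) = 1)"

definition rooted_structure :: "'r vocab \<Rightarrow> nat \<Rightarrow> (nat \<Rightarrow> 'r) \<Rightarrow> ('r, 'a) struct \<Rightarrow> bool" where
  "rooted_structure \<tau> w B S \<longleftrightarrow> structure_over \<tau> S \<and> (\<forall>l\<in>{1..w}. \<exists>b. rel S (B l) = {[b]})"

definition bag :: "nat \<Rightarrow> (nat \<Rightarrow> 'r) \<Rightarrow> ('r, 'a) struct \<Rightarrow> 'a set" where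
  "bag w B S = {b. \<exists>l\<in>{1..w}. [b] \<in> rel S (B l)}"

definition rooted_partition :: "'r vocab \<Rightarrow> nat \<Rightarrow> (nat \<Rightarrow> 'r) \<Rightarrow> ('r, 'a) struct \<Rightarrow>
    'i set \<Rightarrow> ('i \<Rightarrow> ('r, 'a) struct) \<Rightarrow> bool" where
  "rooted_partition \<tau> w B S I F \<longleftrightarrow>
     (\<forall>i\<in>I. structure_over \<tau> (F i)) \<and>
     struct_eq \<tau> (struct_Union I F) S \<and>
     (\<forall>i\<in>I. induced_substructure \<tau> (F i) S) \<and>
     (\<forall>i\<in>I. \<forall>j\<in>I. i \<noteq> j \<longrightarrow> univ (F i) \<inter> univ (F j) = bag w B S)"

lemma structure_over_type_indicator:
  fixes F :: "'i \<Rightarrow> ('r, 'a) struct"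
  shows "structure_over (type_vocab TYPE('a) m L \<tau> \<rho> k q) (type_indicator m L \<tau> \<rho> k q I F a)"
  by (auto simp: structure_over_def type_vocab_def type_indicator_def tuples_def)

lemma so_type_part_in_all_types:
  fixes F :: "'i \<Rightarrow> ('r, 'a) struct"
  assumes "rooted_partition \<tau> w B S I F" "i \<in> I"
  shows "so_type m L \<tau> \<rho> k q (F i) (restrict_assignment a (univ (F i)))
    \<in> all_types TYPE('a) m L \<tau> \<rho> k q"
proof -
  have "structure_over \<tau> (F i)"
    using assms by (simp add: rooted_partition_def)
  moreover have "assignment_on \<rho> k (F i) (restrict_assignment a (univ (F i)))"
    by (auto simp: assignment_on_def restrict_assignment_def xvar_def)
  ultimately show ?thesis
    unfolding all_types_def by blast
qed

end

theory Submission
  imports Defs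
begin

text \<open>Colour each part by the truth values, in that part, of finitely many formulas whose rank is at
  most that of \<open>\<Phi>\<close>. By induction on \<open>\<Phi>\<close>, these can be chosen so that the truth of \<open>\<Phi>\<close> in the
  whole structure only depends on how often each colour occurs, counted up to a threshold; such
  counts of types are expressible by a first-order sentence because there are only finitely many types.
  For \<open>\<exists>X \<phi>\<close>, the parts must agree on the tuples of \<open>X\<close> that consist of roots only, and a choice of
  colours in one partition is copied to another one with the same counts, colour class by colour
  class. A relation guarded in the whole structure need not be guarded in the parts, since roots can be
  adjacent through another part only; therefore each part codes its piece of \<open>X\<close> by a single guarded
  relation of larger arity, which costs no quantifier rank but is the reason for the bound \<open>m\<^sub>0\<close>.\<close>

section \<open>Counting up to a threshold\<close>

text \<open>The rank budget shapes everything: a quantifier of the formula may be answered in each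
  part by one quantifier only, so nothing about the other parts can be quantified there. What a part
  cannot see is guessed and becomes an index of the colours in \<open>ex_colours\<close>: a set
  \<open>D\<close> of name patterns for the tuples of \<open>X\<close> that consist of roots only,
  and a set \<open>G\<close> of pairs of root names that are to coincide or be adjacent in the whole
  structure. A part respects \<open>G\<close>, but only the \<open>edge\<close> colours of all parts
  together tell whether \<open>G\<close> is right. The thresholds: an elem atom may ask whether
  exactly one part has a nonempty value, hence 2; a quantifier multiplies the threshold by
  \<open>card (Pow \<Lambda>)\<close>, a bound on the number of new colours into which a class of
  equally coloured parts can split. The sentence is not built along the formula. Two partitions with
  the same counts are compared as in an Ehrenfeucht-Fraisse game, which makes truth a function of a
  finite profile of counts; the sentence then lists the accepted profiles.\<close>

definition cap :: "nat \<Rightarrow> 'a set \<Rightarrow> nat" where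
  "cap N A = (if finite A then min N (card A) else N)"

lemma cap_empty [simp]: "cap N {} = 0"
  by (simp add: cap_def)

lemma cap_le: "cap N A \<le> N"
  by (simp add: cap_def)

lemma cap_pos_iff: "1 \<le> N \<Longrightarrow> 1 \<le> cap N A \<longleftrightarrow> A \<noteq> {}"
  by (auto simp: cap_def Suc_le_eq card_gt_0_iff)

lemma cap_cap: "M \<le> N \<Longrightarrow> cap M A = min M (cap N A)"
  by (auto simp: cap_def)

lemma cap_Un: "A \<inter> B = {} \<Longrightarrow> cap N (A \<union> B) = min N (cap N A + cap N B)"
  by (auto simp: cap_def card_Un_disjoint)

lemma cap_sum: "finite U \<Longrightarrow> cap N {i\<in>I. c i \<in> U} = min N (\<Sum>u\<in>U. cap N {i\<in>I. c i = u})"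
proof (induction U rule: finite_induct)
  case (insert u U)
  have eq: "{i\<in>I. c i \<in> insert u U} = {i\<in>I. c i = u} \<union> {i\<in>I. c i \<in> U}" by auto
  have "cap N {i\<in>I. c i \<in> insert u U} = min N (cap N {i\<in>I. c i = u} + cap N {i\<in>I. c i \<in> U})"
    unfolding eq by (rule cap_Un) (use insert.hyps in auto)
  then show ?case
    using insert by auto
qed simp

lemma cap_eq_1_iff: "2 \<le> N \<Longrightarrow> cap N A = 1 \<longleftrightarrow> (\<exists>x. A = {x})"
  by (auto simp: cap_def min_def card_1_singleton_iff)

text \<open>Subsets of size \<open>n\<close> treat finite and infinite sets alike, although
  \<open>card\<close> is 0 on infinite ones, and their existence is what a first-order sentence can
  express.\<close>

lemma le_cap_iff: "n \<le> N \<Longrightarrow> n \<le> cap N A \<longleftrightarrow> (\<exists>X\<subseteq>A. finite X \<and> card X = n)"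
proof
  assume "n \<le> N" "n \<le> cap N A"
  then show "\<exists>X\<subseteq>A. finite X \<and> card X = n"
    by (metis cap_def infinite_arbitrarily_large min.bounded_iff obtain_subset_with_card_n)
next
  assume "n \<le> N" "\<exists>X\<subseteq>A. finite X \<and> card X = n"
  then show "n \<le> cap N A"
    by (auto simp: cap_def intro: card_mono)
qed

text \<open>If one of \<open>A\<close>, \<open>B\<close> does not exceed its threshold, its exact
  size can be cut out of \<open>C\<close>, and the rest of \<open>C\<close> agrees with the other
  set up to the other threshold. Otherwise both sets are saturated, \<open>C\<close> has at least
  \<open>M + N\<close> elements, and any \<open>M\<close> of them may form
  \<open>A'\<close>.\<close>

lemma cap_split:
  assumes "cap (M + N) (A \<union> B) = cap (M + N) C" "A \<inter> B = {}"
  shows "\<exists>A' B'. C = A' \<union> B' \<and> A' \<inter> B' = {} \<and> cap M A' = cap M A \<and> cap N B' = cap N B"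
proof -
  have one_small: "\<exists>A' B'. C = A' \<union> B' \<and> A' \<inter> B' = {} \<and> cap M A' = cap M A \<and> cap N B' = cap N B"
    if small: "finite A" "card A \<le> M" and eq: "cap (M + N) (A \<union> B) = cap (M + N) C"
      and dj: "A \<inter> B = {}" for A B :: "'a set" and M N
  proof -
    have "card A \<le> cap (M + N) (A \<union> B)"
      using small dj by (auto simp: cap_def card_Un_disjoint)
    then obtain A' where A': "A' \<subseteq> C" "finite A'" "card A' = card A"
      using le_cap_iff[of "card A" "M + N" C] small eq by auto
    have "cap N (C - A') = cap N B"
    proof (cases "finite C")
      case True
      then have "card (C - A') = card C - card A"
        using A' by (simp add: card_Diff_subset)
      moreover have "card A \<le> card C"
        using A' True by (metis card_mono)
      ultimately show ?thesis
        using True eq small dj by (auto simp: cap_def card_Un_disjoint split: if_splits)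
    next
      case False
      then show ?thesis
        using A' eq small dj by (auto simp: cap_def card_Un_disjoint split: if_splits)
    qed
    then show ?thesis
      using A' small by (intro exI[of _ A'] exI[of _ "C - A'"]) (auto simp: cap_def)
  qed
  have "finite D \<and> card D \<le> K \<or> cap K D = K" for K and D :: "'a set"
    by (auto simp: cap_def)
  then consider "finite A" "card A \<le> M" | "finite B" "card B \<le> N" | "cap M A = M" "cap N B = N"
    by blast
  then show ?thesis
  proof cases
    case 1
    then show ?thesis using one_small assms by simp
  next
    case 2
    moreover have "cap (N + M) (B \<union> A) = cap (N + M) C" "B \<inter> A = {}"
      using assms by (simp_all add: Un_commute Int_commute add.commute)
    ultimately obtain B' A' where "C = B' \<union> A'" "B' \<inter> A' = {}" "cap N B' = cap N B" "cap M A' = cap M A"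
      using one_small[of B N M A] by auto
    then show ?thesis
      by (intro exI[of _ A'] exI[of _ B']) auto
  next
    case 3
    then have "M + N \<le> cap (M + N) C"
      using assms by (auto simp: cap_def card_Un_disjoint split: if_splits)
    then have big: "infinite C \<or> M + N \<le> card C"
      by (auto simp: cap_def)
    then obtain A' where A': "A' \<subseteq> C" "finite A'" "card A' = M"
      using le_cap_iff[of M "M + N" C] \<open>M + N \<le> cap (M + N) C\<close> by auto
    have "cap N (C - A') = N"
      using A' big by (auto simp: cap_def card_Diff_subset)
    then show ?thesis
      using A' 3 by (intro exI[of _ A'] exI[of _ "C - A'"]) (auto simp: cap_def)
  qed
qed

text \<open>One colour is split off at a time by \<open>cap_split\<close>; each colour uses up a
  share \<open>N\<close> of the threshold, which explains the factor \<open>card W\<close>. With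
  \<open>W\<close> empty the threshold would be 0 and a nonempty \<open>A'\<close> could not be
  coloured.\<close>

lemma cap_colouring:
  assumes "finite W" "W \<noteq> {}" "c ` A \<subseteq> W" "cap (N * card W) A = cap (N * card W) A'"
  shows "\<exists>c'. c' ` A' \<subseteq> W \<and> (\<forall>v. cap N {i\<in>A. c i = v} = cap N {i\<in>A'. c' i = v})"
  using assms
proof (induction W arbitrary: A A' rule: finite_ne_induct)
  case (singleton w)
  have "{i\<in>A. c i = v} = (if v = w then A else {})" for v
    using singleton.prems by auto
  moreover have "{i\<in>A'. w = v} = (if v = w then A' else {})" for v
    by auto
  ultimately show ?case
    using singleton.prems by (intro exI[of _ "\<lambda>_. w"]) auto
next
  case (insert w W)
  let ?A = "{i\<in>A. c i = w}" and ?B = "{i\<in>A. c i \<in> W}"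
  have "?A \<union> ?B = A" "?A \<inter> ?B = {}"
    using insert by auto
  then obtain A1 B1 where A': "A' = A1 \<union> B1" "A1 \<inter> B1 = {}"
    and caps: "cap N A1 = cap N ?A" "cap (N * card W) B1 = cap (N * card W) ?B"
    using insert.prems insert.hyps cap_split[of N "N * card W" ?A ?B A'] by auto
  obtain c' where c': "c' ` B1 \<subseteq> W" "\<forall>v. cap N {i\<in>?B. c i = v} = cap N {i\<in>B1. c' i = v}"
    using insert.IH[of ?B B1] caps by auto
  define d where "d i = (if i \<in> A1 then w else c' i)" for i
  have "cap N {i\<in>A. c i = v} = cap N {i\<in>A'. d i = v}" for v
  proof (cases "v = w")
    case True
    then have "{i\<in>A'. d i = v} = A1"
      using A' c'(1) insert.hyps by (auto simp: d_def)
    then show ?thesis using caps True by simp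
  next
    case False
    then have "{i\<in>A. c i = v} = {i\<in>?B. c i = v}" "{i\<in>A'. d i = v} = {i\<in>B1. c' i = v}"
      using A' insert.prems by (auto simp: d_def)
    then show ?thesis using c'(2) by simp
  qed
  moreover have "d ` A' \<subseteq> insert w W"
    using A' c'(1) by (auto simp: d_def)
  ultimately show ?case by blast
qed

section \<open>Colourings with equal truncated counts\<close>

definition same_counts :: "nat \<Rightarrow> 'i set \<Rightarrow> ('i \<Rightarrow> 'c) \<Rightarrow> 'j set \<Rightarrow> ('j \<Rightarrow> 'c) \<Rightarrow> bool" where
  "same_counts N I c I' c' \<longleftrightarrow> (\<forall>v. cap N {i\<in>I. c i = v} = cap N {i\<in>I'. c' i = v})"

lemma same_counts_sym: "same_counts N I c I' c' \<Longrightarrow> same_counts N I' c' I c"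
  by (simp add: same_counts_def)

lemma same_counts_mono:
  assumes "same_counts N I c I' c'" "M \<le> N"
  shows "same_counts M I c I' c'"
  using assms by (simp add: same_counts_def cap_cap[OF assms(2)])

text \<open>With finitely many colours, a property of colours selects finitely many classes, whose
  truncated counts add up by \<open>cap_sum\<close>.\<close>

lemma same_counts_Collect:
  assumes "same_counts N I c I' c'" "finite (c ` I)" "finite (c' ` I')"
  shows "cap N {i\<in>I. Q (c i)} = cap N {i\<in>I'. Q (c' i)}"
proof -
  define U where "U = {u \<in> c ` I \<union> c' ` I'. Q u}"
  have "finite U" using assms by (simp add: U_def)
  moreover have "{i\<in>I. Q (c i)} = {i\<in>I. c i \<in> U}" "{i\<in>I'. Q (c' i)} = {i\<in>I'. c' i \<in> U}"
    by (auto simp: U_def)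
  ultimately show ?thesis
    using assms(1) by (simp add: cap_sum same_counts_def)
qed

lemma same_counts_coarsen:
  assumes "same_counts N I c I' c'" "finite (c ` I)" "finite (c' ` I')"
    and "\<And>i. i \<in> I \<Longrightarrow> d i = g (c i)" "\<And>i. i \<in> I' \<Longrightarrow> d' i = g (c' i)"
  shows "same_counts N I d I' d'"
proof -
  have "{i\<in>I. d i = v} = {i\<in>I. g (c i) = v}" "{i\<in>I'. d' i = v} = {i\<in>I'. g (c' i) = v}" for v
    using assms(4,5) by auto
  then show ?thesis
    using same_counts_Collect[OF assms(1-3), of "\<lambda>u. g u = v" for v] by (simp add: same_counts_def)
qed

lemma same_counts_ex:
  assumes "same_counts N I c I' c'" "1 \<le> N" "i \<in> I"
  shows "\<exists>i'\<in>I'. c' i' = c i"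
proof -
  have "1 \<le> cap N {j\<in>I. c j = c i}"
    using assms(2,3) by (subst cap_pos_iff) auto
  then have "1 \<le> cap N {j\<in>I'. c' j = c i}"
    using assms(1) by (simp add: same_counts_def)
  then show ?thesis
    using assms(2) by (subst (asm) cap_pos_iff) auto
qed

lemma same_counts_all:
  assumes "same_counts N I c I' c'" "1 \<le> N" "\<forall>i\<in>I. Q (c i)"
  shows "\<forall>i\<in>I'. Q (c' i)"
  using same_counts_ex[OF same_counts_sym[OF assms(1)] assms(2)] assms(3) by metis

text \<open>Within each fibre of \<open>d\<close> the colouring \<open>c\<close> is copied by
  \<open>cap_colouring\<close>, and the copies are glued along \<open>d'\<close>. This is the answer
  to the choice of a relation in one of two partitions, with \<open>W\<close> the set of colours
  that the choice may produce.\<close>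

lemma same_counts_extend:
  assumes "same_counts (N * card W) I d I' d'" "finite W" "W \<noteq> {}" "c ` I \<subseteq> W"
  shows "\<exists>c'. c' ` I' \<subseteq> W \<and> same_counts N I (\<lambda>i. (d i, c i)) I' (\<lambda>i. (d' i, c' i))"
proof -
  have "\<exists>c'. c' ` {i\<in>I'. d' i = u} \<subseteq> W \<and>
      (\<forall>v. cap N {i\<in>{i\<in>I. d i = u}. c i = v} = cap N {i\<in>{i\<in>I'. d' i = u}. c' i = v})" for u
    by (rule cap_colouring) (use assms in \<open>auto simp: same_counts_def\<close>)
  then have "\<forall>u. \<exists>c'. c' ` {i\<in>I'. d' i = u} \<subseteq> W \<and>
      (\<forall>v. cap N {i\<in>{i\<in>I. d i = u}. c i = v} = cap N {i\<in>{i\<in>I'. d' i = u}. c' i = v})"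
    by blast
  from choice[OF this] obtain c' where "\<forall>u. c' u ` {i\<in>I'. d' i = u} \<subseteq> W \<and>
      (\<forall>v. cap N {i\<in>{i\<in>I. d i = u}. c i = v} = cap N {i\<in>{i\<in>I'. d' i = u}. c' u i = v})" ..
  then have c': "c' u ` {i\<in>I'. d' i = u} \<subseteq> W"
    "cap N {i\<in>{i\<in>I. d i = u}. c i = v} = cap N {i\<in>{i\<in>I'. d' i = u}. c' u i = v}" for u v
    by simp_all
  have fibres: "{i\<in>I. (d i, c i) = uv} = {i\<in>{i\<in>I. d i = fst uv}. c i = snd uv}"
    "{i\<in>I'. (d' i, c' (d' i) i) = uv} = {i\<in>{i\<in>I'. d' i = fst uv}. c' (fst uv) i = snd uv}" for uv
    by (cases uv; auto)+
  have "same_counts N I (\<lambda>i. (d i, c i)) I' (\<lambda>i. (d' i, c' (d' i) i))"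
    unfolding same_counts_def fibres c'(2) by simp
  moreover have "(\<lambda>i. c' (d' i) i) ` I' \<subseteq> W"
    using c'(1) by blast
  ultimately show ?thesis by blast
qed

section \<open>Finitely many types\<close>

lemma so_sat_cong:
  assumes "univ S = univ S'" "\<And>R. R \<in> syms \<tau> \<Longrightarrow> rel S R = rel S' R"
    and "so_wf L \<tau> \<phi>" "\<And>X. X \<in> so_fv \<phi> \<Longrightarrow> a X = a' X"
  shows "so_sat \<tau> S a \<phi> = so_sat \<tau> S' a' \<phi>"
  using assms(3,4)
proof (induction \<phi> arbitrary: a a')
  have val: "pred_val S a Y = pred_val S' a' Y"
    if "pred_wf L \<tau> Y" "\<And>X. X \<in> pred_fv Y \<Longrightarrow> a X = a' X" for Y a a'
    using that assms(2) by (cases Y) auto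
  {
    case (SEmpty Y)
    then show ?case using val[of Y a a'] by auto
  next
    case (SElem Ys Z)
    have "pred_val S a Z = pred_val S' a' Z"
      by (rule val) (use SElem in auto)
    moreover have "pred_val S a Y = pred_val S' a' Y" if "Y \<in> set Ys" for Y
      by (rule val) (use SElem that in auto)
    ultimately show ?case by simp
  next
    case (SNeg \<phi>)
    then have "so_sat \<tau> S a \<phi> = so_sat \<tau> S' a' \<phi>" by simp
    then show ?case by simp
  next
    case (SConj \<phi> \<psi>)
    have "so_sat \<tau> S a \<phi> = so_sat \<tau> S' a' \<phi>"
      by (rule SConj.IH) (use SConj.prems in auto)
    moreover have "so_sat \<tau> S a \<psi> = so_sat \<tau> S' a' \<psi>"
      by (rule SConj.IH) (use SConj.prems in auto)
    ultimately show ?case by simp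
  next
    case (SEx X \<phi>)
    have "gaifman \<tau> S = gaifman \<tau> S'"
      using assms(2) by (auto simp: gaifman_def)
    moreover have "so_sat \<tau> S (a(X := P)) \<phi> = so_sat \<tau> S' (a'(X := P)) \<phi>" for P
      by (rule SEx.IH) (use SEx.prems in auto)
    ultimately show ?case
      by (simp add: guarded_def assms(1))
  }
qed

text \<open>A Boolean combination is given by its truth table: \<open>Q\<close> collects the subsets
  of \<open>G\<close> that may be exactly the true ones. Finiteness is then immediate, without
  normal forms.\<close>

definition boolean_combinations :: "('x \<Rightarrow> bool) set \<Rightarrow> ('x \<Rightarrow> bool) set" where
  "boolean_combinations G = (\<lambda>Q x. {g\<in>G. g x} \<in> Q) ` Pow (Pow G)"

lemma finite_boolean_combinations: "finite G \<Longrightarrow> finite (boolean_combinations G)"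
  by (simp add: boolean_combinations_def)

lemma boolean_combinations_base: "g \<in> G \<Longrightarrow> g \<in> boolean_combinations G"
  unfolding boolean_combinations_def by (rule image_eqI[of _ _ "{X\<in>Pow G. g \<in> X}"]) auto

lemma boolean_combinations_Not:
  assumes "p \<in> boolean_combinations G"
  shows "(\<lambda>x. \<not> p x) \<in> boolean_combinations G"
proof -
  obtain Q where "Q \<subseteq> Pow G" "p = (\<lambda>x. {g\<in>G. g x} \<in> Q)"
    using assms by (auto simp: boolean_combinations_def)
  then show ?thesis
    unfolding boolean_combinations_def by (intro image_eqI[of _ _ "Pow G - Q"]) auto
qed

lemma boolean_combinations_conj:
  assumes "p \<in> boolean_combinations G" "p' \<in> boolean_combinations G"
  shows "(\<lambda>x. p x \<and> p' x) \<in> boolean_combinations G"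
proof -
  obtain Q Q' where "Q \<subseteq> Pow G" "p = (\<lambda>x. {g\<in>G. g x} \<in> Q)"
      "Q' \<subseteq> Pow G" "p' = (\<lambda>x. {g\<in>G. g x} \<in> Q')"
    using assms by (auto simp: boolean_combinations_def)
  then show ?thesis
    unfolding boolean_combinations_def by (intro image_eqI[of _ _ "Q \<inter> Q'"]) auto
qed

section \<open>Renaming of variables\<close>

fun rename_pred :: "(sovar \<Rightarrow> sovar) \<Rightarrow> 'r pred \<Rightarrow> 'r pred" where
  "rename_pred \<pi> (Sym R) = Sym R"
| "rename_pred \<pi> (Var X) = Var (\<pi> X)"

text \<open>Bound variables are renamed along with free ones, so for an injective
  \<open>\<pi>\<close> no capture can occur.\<close>

fun rename :: "(sovar \<Rightarrow> sovar) \<Rightarrow> 'r so \<Rightarrow> 'r so" where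
  "rename \<pi> (SEmpty Y) = SEmpty (rename_pred \<pi> Y)"
| "rename \<pi> (SElem Ys Z) = SElem (map (rename_pred \<pi>) Ys) (rename_pred \<pi> Z)"
| "rename \<pi> (SNeg \<phi>) = SNeg (rename \<pi> \<phi>)"
| "rename \<pi> (SConj \<phi> \<psi>) = SConj (rename \<pi> \<phi>) (rename \<pi> \<psi>)"
| "rename \<pi> (SEx X \<phi>) = SEx (\<pi> X) (rename \<pi> \<phi>)"

context
  fixes \<pi> :: "sovar \<Rightarrow> sovar"
  assumes inj: "inj \<pi>" and arity: "\<And>X. sv_arity (\<pi> X) = sv_arity X"
begin

lemma pred_wf_rename: "pred_wf L \<tau> (rename_pred \<pi> Y) = pred_wf L \<tau> Y"
  by (cases Y) (auto simp: logic_var_def arity)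

lemma pred_arity_rename: "pred_arity \<tau> (rename_pred \<pi> Y) = pred_arity \<tau> Y"
  by (cases Y) (auto simp: arity)

lemma pred_val_rename: "pred_val S a (rename_pred \<pi> Y) = pred_val S (a \<circ> \<pi>) Y"
  by (cases Y) auto

lemma pred_fv_rename: "pred_fv (rename_pred \<pi> Y) = \<pi> ` pred_fv Y"
  by (cases Y) auto

lemma so_wf_rename: "so_wf L \<tau> (rename \<pi> \<phi>) = so_wf L \<tau> \<phi>"
  by (induction \<phi>) (auto simp: pred_wf_rename pred_arity_rename logic_var_def arity)

lemma so_qr_rename: "so_qr (rename \<pi> \<phi>) = so_qr \<phi>"
  by (induction \<phi>) auto

lemma so_fv_rename: "so_fv (rename \<pi> \<phi>) = \<pi> ` so_fv \<phi>"
  by (induction \<phi>) (auto simp: pred_fv_rename image_Un image_UN image_set_diff[OF inj])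

lemma so_bv_rename: "so_bv (rename \<pi> \<phi>) = \<pi> ` so_bv \<phi>"
  by (induction \<phi>) (auto simp: image_Un)

lemma so_sat_rename: "so_sat \<tau> S a (rename \<pi> \<phi>) = so_sat \<tau> S (a \<circ> \<pi>) \<phi>"
proof (induction \<phi> arbitrary: a)
  case (SEx X \<phi>)
  have "a(\<pi> X := P) \<circ> \<pi> = (a \<circ> \<pi>)(X := P)" for P
    using inj by (auto simp: fun_eq_iff dest: injD)
  then show ?case using SEx by (simp add: arity del: fun_upd_apply comp_apply)
qed (auto simp: pred_val_rename)

end

section \<open>Finitely many formulas up to equivalence\<close>

definition rank_formulas :: "nat \<Rightarrow> logic \<Rightarrow> 'r vocab \<Rightarrow> nat \<Rightarrow> sovar set \<Rightarrow> 'r so set" where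
  "rank_formulas m L \<tau> q V =
     {\<phi>. so_wf L \<tau> \<phi> \<and> so_fv \<phi> \<subseteq> V \<and> so_qr \<phi> \<le> q \<and> (\<forall>X\<in>so_bv \<phi>. sv_arity X \<le> m)}"

text \<open>Equivalence of formulas is equality of meanings, so finiteness up to equivalence becomes
  finiteness of an image.\<close>

definition meaning :: "'r vocab \<Rightarrow> 'r so \<Rightarrow> ('r, 'a) struct \<times> 'a assignment \<Rightarrow> bool" where
  "meaning \<tau> \<phi> = (\<lambda>(S, a). so_sat \<tau> S a \<phi>)"

definition atoms :: "'r vocab \<Rightarrow> sovar set \<Rightarrow> 'r so set" where
  "atoms \<tau> V = (let P = Sym ` syms \<tau> \<union> Var ` V in
     SEmpty ` P \<union> (\<Union>Z\<in>P. (\<lambda>Ys. SElem Ys Z) ` {Ys. set Ys \<subseteq> P \<and> length Ys = pred_arity \<tau> Z}))"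

lemma finite_atoms: "finite (syms \<tau>) \<Longrightarrow> finite V \<Longrightarrow> finite (atoms \<tau> V)"
  unfolding atoms_def Let_def by (auto intro!: finite_imageI finite_lists_length_eq)

lemma fresh_sovar: "finite V \<Longrightarrow> \<exists>X. X \<notin> V \<and> sv_arity X = r"
proof -
  assume "finite V"
  then have "finite (sv_name ` V)" by simp
  then obtain n where "n \<notin> sv_name ` V" using ex_new_if_finite infinite_UNIV_nat by metis
  then have "SOVar n r \<notin> V" by force
  then show ?thesis by (intro exI[of _ "SOVar n r"]) simp
qed

text \<open>Swapping \<open>X\<close> and \<open>Y\<close> fixes all free variables, since both lie
  outside \<open>V\<close>. The swap normalises the names of bound variables, of which there are
  infinitely many.\<close>

lemma meaning_SEx_fresh:
  assumes "so_wf L \<tau> (SEx X \<phi>)" "so_fv (SEx X \<phi>) \<subseteq> V" "X \<notin> V" "Y \<notin> V" "sv_arity Y = sv_arity X"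
  shows "(meaning \<tau> (SEx X \<phi>) :: ('r, 'a) struct \<times> 'a assignment \<Rightarrow> bool) =
    meaning \<tau> (SEx Y (rename (id(X := Y, Y := X)) \<phi>))"
proof -
  let ?\<pi> = "id(X := Y, Y := X)"
  have \<pi>: "inj ?\<pi>" "\<And>Z. sv_arity (?\<pi> Z) = sv_arity Z"
    using assms(5) by (auto simp: inj_def)
  have "so_sat \<tau> S a (SEx X \<phi>) = so_sat \<tau> S a (rename ?\<pi> (SEx X \<phi>))"
    for S :: "('r, 'a) struct" and a
    unfolding so_sat_rename[OF \<pi>]
    by (rule so_sat_cong[OF refl refl assms(1)]) (use assms in auto)
  moreover have "rename ?\<pi> (SEx X \<phi>) = SEx Y (rename ?\<pi> \<phi>)"
    by simp
  ultimately show ?thesis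
    by (simp add: meaning_def fun_eq_iff split_paired_All del: so_sat.simps rename.simps)
qed

text \<open>Each formula of rank at most \<open>q\<close> is a Boolean combination of atoms and of
  existential formulas whose bodies have smaller rank; by induction on \<open>q\<close>, the bodies
  have finitely many meanings. \<open>V\<close> varies in the induction because the quantified
  variable becomes free.\<close>

lemma finite_meanings:
  assumes "finite (syms \<tau>)" "finite V"
  shows "finite ((meaning \<tau> :: _ \<Rightarrow> ('r, 'a) struct \<times> 'a assignment \<Rightarrow> bool) ` rank_formulas m L \<tau> q V)"
  using assms(2)
proof (induction q arbitrary: V rule: less_induct)
  case (less q)
  let ?m = "meaning \<tau> :: _ \<Rightarrow> ('r, 'a) struct \<times> 'a assignment \<Rightarrow> bool"
  define ex where "ex X p = (\<lambda>(S :: ('r, 'a) struct, a).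
      \<exists>P \<subseteq> tuples (univ S) (sv_arity X). guarded \<tau> S P \<and> p (S, a(X := P)))" for X p
  have ex: "?m (SEx X \<phi>) = ex X (?m \<phi>)" for X \<phi>
    by (auto simp: meaning_def ex_def)
  obtain fresh where fresh: "\<And>r. fresh r \<notin> V" "\<And>r. sv_arity (fresh r) = r"
    using fresh_sovar[OF less.prems] by metis
  \<comment> \<open>A quantified variable either belongs to \<open>V\<close>, or it can be exchanged
    for the fresh one of its arity. It is the bound \<open>m\<close> that leaves finitely many of
    the latter.\<close>
  define W where "W = V \<union> fresh ` {..m}"
  define G where "G = ?m ` atoms \<tau> V \<union>
    (\<Union>q'\<in>{..<q}. \<Union>X\<in>W. ex X ` ?m ` rank_formulas m L \<tau> q' (insert X V))"
  have "finite W"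
    using less.prems by (simp add: W_def)
  have "finite G"
    unfolding G_def using \<open>finite W\<close> finite_atoms[OF assms(1) less.prems] less.IH less.prems by auto
  have "?m \<phi> \<in> boolean_combinations G" if "\<phi> \<in> rank_formulas m L \<tau> q V" for \<phi>
    using that
  proof (induction \<phi>)
    case (SEmpty Y)
    then have "SEmpty Y \<in> atoms \<tau> V"
      by (cases Y) (auto simp: atoms_def rank_formulas_def)
    then show ?case
      by (auto simp: G_def intro: boolean_combinations_base)
  next
    case (SElem Ys Z)
    have in_P: "Y \<in> Sym ` syms \<tau> \<union> Var ` V" if "pred_wf L \<tau> Y" "pred_fv Y \<subseteq> V" for Y
      using that by (cases Y) auto
    have "Z \<in> Sym ` syms \<tau> \<union> Var ` V"
      by (rule in_P) (use SElem.prems in \<open>auto simp: rank_formulas_def\<close>)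
    moreover have "set Ys \<subseteq> Sym ` syms \<tau> \<union> Var ` V"
      by (intro subsetI in_P) (use SElem.prems in \<open>auto simp: rank_formulas_def\<close>)
    moreover have "length Ys = pred_arity \<tau> Z"
      using SElem by (simp add: rank_formulas_def)
    ultimately have "SElem Ys Z \<in> atoms \<tau> V"
      unfolding atoms_def Let_def by blast
    then show ?case
      by (auto simp: G_def intro: boolean_combinations_base)
  next
    case (SNeg \<phi>)
    moreover have "?m (SNeg \<phi>) = (\<lambda>x. \<not> ?m \<phi> x)"
      by (auto simp: meaning_def)
    ultimately show ?case
      by (auto simp: rank_formulas_def intro: boolean_combinations_Not)
  next
    case (SConj \<phi> \<psi>)
    moreover have "?m (SConj \<phi> \<psi>) = (\<lambda>x. ?m \<phi> x \<and> ?m \<psi> x)"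
      by (auto simp: meaning_def)
    ultimately show ?case
      by (auto simp: rank_formulas_def intro!: boolean_combinations_conj)
  next
    case (SEx X \<phi>)
    have "?m (SEx X \<phi>) \<in> (\<Union>q'\<in>{..<q}. \<Union>X\<in>W. ex X ` ?m ` rank_formulas m L \<tau> q' (insert X V))"
    proof (cases "X \<in> V")
      case True
      then show ?thesis
        using SEx.prems unfolding ex
        by (intro UN_I[of "so_qr \<phi>"] UN_I[of X] imageI) (auto simp: W_def rank_formulas_def)
    next
      case False
      let ?Y = "fresh (sv_arity X)"
      let ?\<psi> = "rename (id(X := ?Y, ?Y := X)) \<phi>"
      have \<pi>: "inj (id(X := ?Y, ?Y := X))" "\<And>Z. sv_arity ((id(X := ?Y, ?Y := X)) Z) = sv_arity Z"
        using fresh by (auto simp: inj_def)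
      have "?m (SEx X \<phi>) = ex ?Y (?m ?\<psi>)"
        unfolding ex[symmetric]
        by (rule meaning_SEx_fresh) (use SEx.prems False fresh in \<open>auto simp: rank_formulas_def\<close>)
      moreover have "?\<psi> \<in> rank_formulas m L \<tau> (so_qr \<phi>) (insert ?Y V)"
        using SEx.prems fresh False
        by (auto simp: rank_formulas_def so_wf_rename[OF \<pi>] so_fv_rename[OF \<pi>] so_qr_rename[OF \<pi>]
            so_bv_rename[OF \<pi>] split: if_splits)
      moreover have "so_qr \<phi> < q" "?Y \<in> W"
        using SEx.prems by (auto simp: rank_formulas_def W_def)
      ultimately show ?thesis by blast
    qed
    then show ?case
      by (intro boolean_combinations_base) (simp only: G_def Un_iff simp_thms)
  qed
  then have "?m ` rank_formulas m L \<tau> q V \<subseteq> boolean_combinations G" by blast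
  then show ?case
    using finite_boolean_combinations[OF \<open>finite G\<close>] finite_subset by blast
qed

text \<open>A type is determined by the set of meanings of its formulas, and there are finitely many
  sets of meanings.\<close>

lemma finite_all_types:
  assumes "vocabulary \<tau>"
  shows "finite (all_types TYPE('a) m L \<tau> \<rho> k q :: 'r so set set)"
proof -
  let ?m = "meaning \<tau> :: _ \<Rightarrow> ('r, 'a) struct \<times> 'a assignment \<Rightarrow> bool"
  let ?F = "formulas_bd m L \<tau> \<rho> k q"
  have F: "?F = rank_formulas m L \<tau> q (xvar \<rho> ` {1..k})"
    by (auto simp: formulas_bd_def formulas_def rank_formulas_def)
  have fin: "finite (?m ` ?F)"
    unfolding F by (rule finite_meanings) (use assms in \<open>auto simp: vocabulary_def\<close>)
  have "so_type m L \<tau> \<rho> k q S a = {\<phi>\<in>?F. ?m \<phi> \<in> {p\<in>?m ` ?F. p (S, a)}}"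
    for S :: "('r, 'a) struct" and a
    by (auto simp: so_type_def meaning_def)
  then have "so_type m L \<tau> \<rho> k q S a \<in> (\<lambda>U. {\<phi>\<in>?F. ?m \<phi> \<in> U}) ` Pow (?m ` ?F)"
    for S :: "('r, 'a) struct" and a
    by (rule image_eqI) auto
  then have "all_types TYPE('a) m L \<tau> \<rho> k q \<subseteq> (\<lambda>U. {\<phi>\<in>?F. ?m \<phi> \<in> U}) ` Pow (?m ` ?F)"
    unfolding all_types_def by (intro subsetI) (elim CollectE exE conjE, simp only:)
  then show ?thesis
    using fin by (meson finite_Pow_iff finite_imageI finite_subset)
qed

lemma restrict_assignment_upd:
  "restrict_assignment (a(X := P)) A = (restrict_assignment a A)(X := P \<inter> tuples A (sv_arity X))"
  by (rule ext) (simp add: restrict_assignment_def)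

lemma gaifman_sym: "(x, y) \<in> gaifman \<tau> S \<Longrightarrow> (y, x) \<in> gaifman \<tau> S"
  by (auto simp: gaifman_def gaifman_rel_def)

section \<open>Definable properties of rooted structures\<close>

locale rooted_vocabulary =
  fixes L :: logic and \<tau> :: "'r vocab" and w :: nat and B :: "nat \<Rightarrow> 'r"
  assumes vocab: "vocabulary \<tau>" and roots: "root_symbols \<tau> w B"
begin

definition root :: "('r, 'a) struct \<Rightarrow> nat \<Rightarrow> 'a" where
  "root S l = (THE b. rel S (B l) = {[b]})"

abbreviation roots_of :: "('r, 'a) struct \<Rightarrow> 'a set" where
  "roots_of S \<equiv> root S ` {1..w}"

lemma root_symbol: "l \<in> {1..w} \<Longrightarrow> B l \<in> syms \<tau> \<and> ar \<tau> (B l) = 1"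
  using roots by (auto simp: root_symbols_def)

lemma rel_root:
  assumes "rooted_structure \<tau> w B S" "l \<in> {1..w}"
  shows "rel S (B l) = {[root S l]}"
proof -
  obtain b where b: "rel S (B l) = {[b]}"
    using assms unfolding rooted_structure_def by blast
  then have "root S l = b"
    by (auto simp: root_def)
  with b show ?thesis by simp
qed

lemma root_in_univ:
  assumes "rooted_structure \<tau> w B S" "l \<in> {1..w}"
  shows "root S l \<in> univ S"
proof -
  have "rel S (B l) \<subseteq> tuples (univ S) (ar \<tau> (B l))"
    using assms(1) root_symbol[OF assms(2)] unfolding rooted_structure_def structure_over_def by blast
  then show ?thesis
    by (simp add: rel_root[OF assms] tuples_def)
qed

lemma bag_eq: "rooted_structure \<tau> w B S \<Longrightarrow> bag w B S = roots_of S"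
  unfolding bag_def using rel_root[of S] by (auto simp del: One_nat_def atLeastAtMost_iff)

text \<open>Guardedness of the values is left out on purpose: definability is applied within the
  parts, where the restriction of a guarded assignment may fail to be guarded.\<close>

definition good :: "sovar set \<Rightarrow> ('r, 'a) struct \<Rightarrow> 'a assignment \<Rightarrow> bool" where
  "good V S a \<longleftrightarrow> rooted_structure \<tau> w B S \<and> (\<forall>X\<in>V. a X \<subseteq> tuples (univ S) (sv_arity X))"

lemma good_mono: "good V S a \<Longrightarrow> U \<subseteq> V \<Longrightarrow> good U S a"
  by (auto simp: good_def)

lemma good_upd: "good V S a \<Longrightarrow> P \<subseteq> tuples (univ S) (sv_arity X) \<Longrightarrow> good (insert X V) S (a(X := P))"
  by (auto simp: good_def)

lemma pred_val_tuples:
  assumes "good V S a" "pred_wf L \<tau> Y" "pred_fv Y \<subseteq> V"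
  shows "pred_val S a Y \<subseteq> tuples (univ S) (pred_arity \<tau> Y)"
  using assms by (cases Y) (auto simp: good_def rooted_structure_def structure_over_def)

text \<open>Once all arguments are singletons, their product consists of one tuple \<open>t\<close>.
  Atoms are handled through this tuple from here on.\<close>

lemma so_sat_SElem:
  assumes "\<forall>Y\<in>set Ys. pred_val S a Y \<subseteq> tuples (univ S) 1"
  shows "so_sat \<tau> S a (SElem Ys Z) \<longleftrightarrow>
    (\<exists>t. length t = length Ys \<and> (\<forall>j<length Ys. pred_val S a (Ys ! j) = {[t ! j]}) \<and> t \<in> pred_val S a Z)"
    (is "_ \<longleftrightarrow> (\<exists>t. ?P t)")
proof
  assume sat: "so_sat \<tau> S a (SElem Ys Z)"
  have "\<exists>x. pred_val S a (Ys ! j) = {[x]}" if "j < length Ys" for j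
  proof -
    have "card (pred_val S a (Ys ! j)) = 1" "pred_val S a (Ys ! j) \<subseteq> tuples (univ S) 1"
      using sat assms that by auto
    then show ?thesis
      by (auto simp: card_1_singleton_iff tuples_def length_Suc_conv)
  qed
  then obtain f where f: "\<And>j. j < length Ys \<Longrightarrow> pred_val S a (Ys ! j) = {[f j]}" by metis
  then have "?P (map f [0..<length Ys])"
    using sat by auto
  then show "\<exists>t. ?P t" by blast
next
  assume "\<exists>t. ?P t"
  then obtain t where t: "?P t" by blast
  then have "s = t" if "length s = length Ys" "\<forall>j<length Ys. [s ! j] \<in> pred_val S a (Ys ! j)" for s
    using that by (intro nth_equalityI) auto
  with t show "so_sat \<tau> S a (SElem Ys Z)"
    by (auto simp: in_set_conv_nth)
qed

text \<open>Predicates on structures and assignments stand for formulas up to equivalence. This makes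
  substitutions and finite Boolean combinations of formulas available without syntax.\<close>

definition definable :: "nat \<Rightarrow> sovar set \<Rightarrow> (('r, 'a) struct \<Rightarrow> 'a assignment \<Rightarrow> bool) \<Rightarrow> bool" where
  "definable q V p \<longleftrightarrow> (\<exists>\<psi>. so_wf L \<tau> \<psi> \<and> so_fv \<psi> \<subseteq> V \<and> so_qr \<psi> \<le> q \<and>
     (\<forall>S a. good V S a \<longrightarrow> so_sat \<tau> S a \<psi> = p S a))"

lemma definable_cong:
  "definable q V p \<Longrightarrow> (\<And>S a. good V S a \<Longrightarrow> p S a = p' S a) \<Longrightarrow> definable q V p'"
  unfolding definable_def by metis

lemma definable_mono:
  assumes "definable q V p" "q \<le> q'" "V \<subseteq> V'"
  shows "definable q' V' p"
proof -
  obtain \<psi> where "so_wf L \<tau> \<psi>" "so_fv \<psi> \<subseteq> V" "so_qr \<psi> \<le> q"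
      "\<And>S a. good V S a \<Longrightarrow> so_sat \<tau> S a \<psi> = p S a"
    using assms(1) unfolding definable_def by blast
  then show ?thesis
    unfolding definable_def using assms(2,3) by (intro exI[of _ \<psi>]) (auto dest: good_mono)
qed

lemma definable_so_sat: "so_wf L \<tau> \<psi> \<Longrightarrow> so_qr \<psi> \<le> q \<Longrightarrow> so_fv \<psi> \<subseteq> V \<Longrightarrow>
    definable q V (\<lambda>S a. so_sat \<tau> S a \<psi>)"
  unfolding definable_def by blast

lemma definable_Not:
  assumes "definable q V p"
  shows "definable q V (\<lambda>S a. \<not> p S a)"
proof -
  obtain \<psi> where "so_wf L \<tau> \<psi>" "so_fv \<psi> \<subseteq> V" "so_qr \<psi> \<le> q"
      "\<And>S a. good V S a \<Longrightarrow> so_sat \<tau> S a \<psi> = p S a"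
    using assms unfolding definable_def by blast
  then show ?thesis
    unfolding definable_def by (intro exI[of _ "SNeg \<psi>"]) auto
qed

lemma definable_conj:
  assumes "definable q V p" "definable q V p'"
  shows "definable q V (\<lambda>S a. p S a \<and> p' S a)"
proof -
  obtain \<psi> where "so_wf L \<tau> \<psi>" "so_fv \<psi> \<subseteq> V" "so_qr \<psi> \<le> q"
      "\<And>S a. good V S a \<Longrightarrow> so_sat \<tau> S a \<psi> = p S a"
    using assms unfolding definable_def by blast
  moreover obtain \<psi>' where "so_wf L \<tau> \<psi>'" "so_fv \<psi>' \<subseteq> V" "so_qr \<psi>' \<le> q"
      "\<And>S a. good V S a \<Longrightarrow> so_sat \<tau> S a \<psi>' = p' S a"
    using assms unfolding definable_def by blast
  ultimately show ?thesis
    unfolding definable_def by (intro exI[of _ "SConj \<psi> \<psi>'"]) auto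
qed

lemma definable_disj:
  assumes "definable q V p" "definable q V p'"
  shows "definable q V (\<lambda>S a. p S a \<or> p' S a)"
  by (rule definable_cong[OF definable_Not[OF definable_conj[OF assms[THEN definable_Not]]]]) auto

lemma definable_iff:
  assumes "definable q V p" "definable q V p'"
  shows "definable q V (\<lambda>S a. p S a \<longleftrightarrow> p' S a)"
  by (rule definable_cong[OF definable_disj[OF definable_conj[OF assms]
        definable_conj[OF assms[THEN definable_Not]]]]) auto

text \<open>A constant can only be written down if there is some formula of rank \<open>q\<close> over \<open>V\<close> at all.\<close>

lemma definable_const:
  fixes p :: "('r, 'a) struct \<Rightarrow> 'a assignment \<Rightarrow> bool"
  assumes "definable q V p"
  shows "definable q V ((\<lambda>S a. b) :: ('r, 'a) struct \<Rightarrow> 'a assignment \<Rightarrow> bool)"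
proof (cases b)
  case True
  show ?thesis
    by (rule definable_cong[OF definable_disj[OF assms definable_Not[OF assms]]]) (use True in auto)
next
  case False
  show ?thesis
    by (rule definable_cong[OF definable_conj[OF assms definable_Not[OF assms]]]) (use False in auto)
qed

lemma definable_ball:
  fixes p :: "'x \<Rightarrow> ('r, 'a) struct \<Rightarrow> 'a assignment \<Rightarrow> bool"
    and p\<^sub>0 :: "('r, 'a) struct \<Rightarrow> 'a assignment \<Rightarrow> bool"
  assumes "finite A" "definable q V p\<^sub>0" "\<And>x. x \<in> A \<Longrightarrow> definable q V (p x)"
  shows "definable q V (\<lambda>S a. \<forall>x\<in>A. p x S a)"
  using assms(1,3)
proof (induction A rule: finite_induct)
  case empty
  show ?case by (rule definable_cong[OF definable_const[OF assms(2), of True]]) simp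
next
  case (insert x A)
  then have "definable q V (\<lambda>S a. p x S a \<and> (\<forall>y\<in>A. p y S a))"
    by (intro definable_conj) auto
  then show ?case by (rule definable_cong) simp
qed

lemma definable_bex:
  fixes p :: "'x \<Rightarrow> ('r, 'a) struct \<Rightarrow> 'a assignment \<Rightarrow> bool"
    and p\<^sub>0 :: "('r, 'a) struct \<Rightarrow> 'a assignment \<Rightarrow> bool"
  assumes "finite A" "definable q V p\<^sub>0" "\<And>x. x \<in> A \<Longrightarrow> definable q V (p x)"
  shows "definable q V (\<lambda>S a. \<exists>x\<in>A. p x S a)"
proof -
  have "definable q V (\<lambda>S a. \<not> (\<forall>x\<in>A. \<not> p x S a))"
    by (intro definable_Not definable_ball[OF assms(1,2)] assms(3))
  then show ?thesis by (rule definable_cong) simp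
qed

lemma definable_colour:
  fixes \<Lambda> :: "(('r, 'a) struct \<Rightarrow> 'a assignment \<Rightarrow> bool) set"
    and p\<^sub>0 :: "('r, 'a) struct \<Rightarrow> 'a assignment \<Rightarrow> bool"
  assumes "finite \<Lambda>" "definable q V p\<^sub>0" "\<And>p. p \<in> \<Lambda> \<Longrightarrow> definable q V p" "v \<subseteq> \<Lambda>"
  shows "definable q V (\<lambda>S a. {p\<in>\<Lambda>. p S a} = v)"
proof -
  have "definable q V (\<lambda>S a. \<forall>p\<in>\<Lambda>. p S a \<longleftrightarrow> p \<in> v)"
    by (rule definable_ball[OF assms(1,2)], rule definable_iff, erule assms(3))
      (rule definable_const[OF assms(2)])
  then show ?thesis
    by (rule definable_cong) (use assms(4) in auto)
qed

section \<open>Quantifier-free properties of singletons and roots\<close>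

lemma definable_SEmpty:
  "pred_wf L \<tau> Y \<Longrightarrow> pred_arity \<tau> Y = 1 \<Longrightarrow> pred_fv Y \<subseteq> V \<Longrightarrow>
    definable q V (\<lambda>S a. pred_val S a Y = {})"
  unfolding definable_def by (intro exI[of _ "SEmpty Y"]) auto

lemma definable_SElem:
  assumes "\<forall>Y\<in>set Ys. pred_wf L \<tau> Y \<and> pred_arity \<tau> Y = 1 \<and> pred_fv Y \<subseteq> V"
    and "pred_wf L \<tau> Z" "pred_arity \<tau> Z = length Ys" "pred_fv Z \<subseteq> V"
  shows "definable q V (\<lambda>S a. \<exists>t. length t = length Ys \<and>
    (\<forall>j<length Ys. pred_val S a (Ys ! j) = {[t ! j]}) \<and> t \<in> pred_val S a Z)"
proof (rule definable_cong)
  show "definable q V (\<lambda>S a. so_sat \<tau> S a (SElem Ys Z))"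
    unfolding definable_def by (intro exI[of _ "SElem Ys Z"]) (use assms in auto)
  show "so_sat \<tau> S a (SElem Ys Z) \<longleftrightarrow> (\<exists>t. length t = length Ys \<and>
    (\<forall>j<length Ys. pred_val S a (Ys ! j) = {[t ! j]}) \<and> t \<in> pred_val S a Z)" if "good V S a" for S a
    by (rule so_sat_SElem) (use assms(1) pred_val_tuples[OF that] in fastforce)
qed

lemma definable_ex:
  assumes "logic_var L X" "definable q (insert X V) p"
  shows "definable (Suc q) V (\<lambda>S a. \<exists>P\<subseteq>tuples (univ S) (sv_arity X). guarded \<tau> S P \<and> p S (a(X := P)))"
proof -
  obtain \<psi> where "so_wf L \<tau> \<psi>" "so_fv \<psi> \<subseteq> insert X V" "so_qr \<psi> \<le> q"
      "\<And>S a. good (insert X V) S a \<Longrightarrow> so_sat \<tau> S a \<psi> = p S a"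
    using assms unfolding definable_def by blast
  then show ?thesis
    unfolding definable_def using assms(1)
    by (intro exI[of _ "SEx X \<psi>"]) (auto simp: good_upd)
qed

text \<open>Each \<open>B l\<close> is a singleton, so its symbol acts as a constant for the root:
  it may stand as the relation of an elem atom, as here, or as its argument, as in
  \<open>definable_root_in\<close>. Neither costs a quantifier.\<close>

lemma definable_root_elem:
  assumes "pred_wf L \<tau> Y" "pred_arity \<tau> Y = 1" "pred_fv Y \<subseteq> V" "l \<in> {1..w}"
  shows "definable q V (\<lambda>S a. pred_val S a Y = {[root S l]})"
proof -
  have "definable q V (\<lambda>S a. \<exists>t. length t = length [Y] \<and>
    (\<forall>j<length [Y]. pred_val S a ([Y] ! j) = {[t ! j]}) \<and> t \<in> pred_val S a (Sym (B l)))"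
    by (rule definable_SElem) (use assms root_symbol in auto)
  then show ?thesis
    by (rule definable_cong) (use assms(4) in \<open>auto simp: good_def rel_root length_Suc_conv\<close>)
qed

lemma definable_root_in:
  assumes "pred_wf L \<tau> Z" "pred_arity \<tau> Z = 1" "pred_fv Z \<subseteq> V" "l \<in> {1..w}"
  shows "definable q V (\<lambda>S a. [root S l] \<in> pred_val S a Z)"
proof -
  have "definable q V (\<lambda>S a. \<exists>t. length t = length [Sym (B l)] \<and>
    (\<forall>j<length [Sym (B l)]. pred_val S a ([Sym (B l)] ! j) = {[t ! j]}) \<and> t \<in> pred_val S a Z)"
    by (rule definable_SElem) (use assms root_symbol in auto)
  then show ?thesis
    by (rule definable_cong) (use assms(4) in \<open>auto simp: good_def rel_root length_Suc_conv\<close>)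
qed

lemma definable_root_eq:
  assumes "l \<in> {1..w}" "l' \<in> {1..w}"
  shows "definable q V (\<lambda>S a. root S l = root S l')"
proof -
  have "definable q V (\<lambda>S a. [root S l] \<in> pred_val S a (Sym (B l')))"
    by (rule definable_root_in) (use assms root_symbol in auto)
  then show ?thesis
    by (rule definable_cong) (use assms in \<open>auto simp: good_def rel_root\<close>)
qed

text \<open>A variable \<open>X\<close> that is not monadic occurs free only as the relation of elem
  atoms. Replacing these atoms by definitions of the decoded relation substitutes
  \<open>dec S (a X')\<close> for \<open>X\<close> throughout. The rank stays the same because
  \<open>atom\<close> is available for every \<open>q\<close>, in particular for 0.\<close>

lemma definable_decoded:
  assumes atom: "\<And>q V Ys. \<lbrakk>\<forall>Y\<in>set Ys. pred_wf L \<tau> Y \<and> pred_arity \<tau> Y = 1 \<and> pred_fv Y \<subseteq> V; X' \<in> V;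
      length Ys = sv_arity X\<rbrakk> \<Longrightarrow> definable q V (\<lambda>S a. \<exists>t. length t = length Ys \<and>
        (\<forall>j<length Ys. pred_val S a (Ys ! j) = {[t ! j]}) \<and> t \<in> dec S (a X'))"
    and "sv_arity X \<noteq> 1" "X' \<noteq> X"
    and "so_wf L \<tau> \<psi>" "X' \<notin> so_fv \<psi> \<union> so_bv \<psi>"
  shows "definable (so_qr \<psi>) (insert X' (so_fv \<psi> - {X}))
    (\<lambda>S a. so_sat \<tau> S (a(X := dec S (a X'))) \<psi>)"
  using assms(4,5)
proof (induction \<psi>)
  have mon: "Y \<noteq> Var X" if "pred_arity \<tau> Y = 1" for Y
    using that assms(2) by auto
  have val: "pred_val S (a(X := P)) Y = pred_val S a Y" if "Y \<noteq> Var X" for S a P Y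
    using that by (cases Y) auto
  have fv: "X \<notin> pred_fv Y" if "Y \<noteq> Var X" for Y
    using that by (cases Y) auto
  {
    case (SEmpty Y)
    have "definable 0 (insert X' (so_fv (SEmpty Y) - {X})) (\<lambda>S a. pred_val S a Y = {})"
      by (rule definable_SEmpty) (use SEmpty mon fv in auto)
    then show ?case
      using SEmpty mon by (simp add: val del: fun_upd_apply)
  next
    case (SElem Ys Z)
    let ?V = "insert X' (so_fv (SElem Ys Z) - {X})"
    have Ys: "Y \<noteq> Var X" if "Y \<in> set Ys" for Y
      using SElem.prems mon that by simp
    have Ys': "\<forall>Y\<in>set Ys. pred_wf L \<tau> Y \<and> pred_arity \<tau> Y = 1 \<and> pred_fv Y \<subseteq> ?V"
      using SElem.prems fv[OF Ys] by auto
    have sat: "so_sat \<tau> S (a(X := dec S (a X'))) (SElem Ys Z) \<longleftrightarrow> (\<exists>t. length t = length Ys \<and>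
        (\<forall>j<length Ys. pred_val S a (Ys ! j) = {[t ! j]}) \<and> t \<in> pred_val S (a(X := dec S (a X'))) Z)"
      if "good ?V S a" for S a
    proof -
      have "\<forall>Y\<in>set Ys. pred_val S a Y \<subseteq> tuples (univ S) 1"
        using Ys' pred_val_tuples[OF that] by fastforce
      then show ?thesis
        using so_sat_SElem[of Ys S "a(X := dec S (a X'))" Z] Ys by (simp add: val del: so_sat.simps)
    qed
    have "definable 0 ?V (\<lambda>S a. \<exists>t. length t = length Ys \<and>
        (\<forall>j<length Ys. pred_val S a (Ys ! j) = {[t ! j]}) \<and> t \<in> pred_val S (a(X := dec S (a X'))) Z)"
    proof (cases "Z = Var X")
      case True
      then show ?thesis
        using atom[OF Ys'] SElem.prems by simp
    next
      case False
      then show ?thesis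
        unfolding val[OF False] by (intro definable_SElem Ys') (use SElem.prems fv[OF False] in auto)
    qed
    then have "definable 0 ?V (\<lambda>S a. so_sat \<tau> S (a(X := dec S (a X'))) (SElem Ys Z))"
      by (rule definable_cong) (use sat in blast)
    then show ?case by (simp only: so_qr.simps)
  next
    case (SNeg \<psi>)
    then show ?case
      using definable_Not[OF SNeg.IH] by (simp del: fun_upd_apply)
  next
    case (SConj \<psi>1 \<psi>2)
    let ?V = "insert X' (so_fv (SConj \<psi>1 \<psi>2) - {X})"
    have "definable (so_qr (SConj \<psi>1 \<psi>2)) ?V (\<lambda>S a. so_sat \<tau> S (a(X := dec S (a X'))) \<psi>1 \<and>
        so_sat \<tau> S (a(X := dec S (a X'))) \<psi>2)"
      by (intro definable_conj; rule definable_mono, rule SConj.IH) (use SConj.prems in auto)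
    then show ?case by (simp only: so_sat.simps)
  next
    case (SEx Z \<psi>)
    let ?V = "insert X' (so_fv (SEx Z \<psi>) - {X})"
    show ?case
    proof (cases "Z = X")
      \<comment> \<open>A quantifier that rebinds \<open>X\<close> hides the decoded value, so the
        formula may stay as it is.\<close>
      case True
      then show ?thesis
        using SEx.prems
        by (intro definable_cong[OF definable_so_sat[of "SEx Z \<psi>"]]) (auto simp del: fun_upd_apply)
    next
      case False
      have "definable (Suc (so_qr \<psi>)) ?V (\<lambda>S a. \<exists>P\<subseteq>tuples (univ S) (sv_arity Z).
          guarded \<tau> S P \<and> so_sat \<tau> S ((a(Z := P))(X := dec S ((a(Z := P)) X'))) \<psi>)"
        by (rule definable_ex, use SEx.prems in simp, rule definable_mono, rule SEx.IH)
          (use SEx.prems in auto)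
      moreover have "(a(Z := P))(X := dec S ((a(Z := P)) X')) = (a(X := dec S (a X')))(Z := P)"
        for S and a :: "'a assignment" and P
        using False SEx.prems by (auto simp: fun_eq_iff)
      ultimately show ?thesis by (simp del: fun_upd_apply)
    qed
  }
qed

section \<open>Relations of the whole structure within a part\<close>

text \<open>\<open>G\<close> is a guess of the pairs of root names whose roots coincide or are
  adjacent in the whole structure. A part cannot check the guess, since it does not see tuples of
  other parts; it merely keeps its own tuples consistent with it.\<close>

definition names_guarded :: "(nat \<times> nat) set \<Rightarrow> ('r, 'a) struct \<Rightarrow> 'a list \<Rightarrow> bool" where
  "names_guarded G S t \<longleftrightarrow>
     (\<forall>l\<in>{1..w}. \<forall>l'\<in>{1..w}. root S l \<in> set t \<longrightarrow> root S l' \<in> set t \<longrightarrow> (l, l') \<in> G)"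

text \<open>This describes the traces that a guarded relation of the whole structure can leave in a
  part. Root-only tuples are shared by all parts, so their choice \<open>D\<close> is prescribed
  from outside; a pair with a non-root entry can only be adjacent within the part itself; a pair of
  roots is left to \<open>G\<close>.\<close>

definition admissible ::
    "nat list set \<Rightarrow> (nat \<times> nat) set \<Rightarrow> ('r, 'a) struct \<Rightarrow> nat \<Rightarrow> 'a list set \<Rightarrow> bool" where
  "admissible D G S n P \<longleftrightarrow>
     (\<forall>t\<in>tuples (univ S) n. set t \<subseteq> roots_of S \<longrightarrow> (t \<in> P \<longleftrightarrow> t \<in> map (root S) ` D)) \<and>
     (\<forall>t\<in>P. \<not> set t \<subseteq> roots_of S \<longrightarrow>
        (\<forall>x\<in>set t. \<forall>y\<in>set t. x \<noteq> y \<longrightarrow> \<not> (x \<in> roots_of S \<and> y \<in> roots_of S) \<longrightarrow> (x, y) \<in> gaifman \<tau> S) \<and>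
        names_guarded G S t)"

text \<open>Patterns of tuples with at least one entry that is not a root: 0 marks such an entry,
  and \<open>l\<close> in \<open>{1..w}\<close> the root of that name. As names may share a root, a
  tuple can match several patterns.\<close>

definition mixed :: "nat \<Rightarrow> nat list set" where
  "mixed n = {\<sigma>. length \<sigma> = n \<and> set \<sigma> \<subseteq> {0..w} \<and> 0 \<in> set \<sigma>}"

lemma finite_mixed: "finite (mixed n)"
  by (rule finite_subset[OF _ finite_lists_length_eq[of "{0..w}" n]]) (auto simp: mixed_def)

definition matches :: "('r, 'a) struct \<Rightarrow> nat list \<Rightarrow> 'a list \<Rightarrow> bool" where
  "matches S \<sigma> t \<longleftrightarrow>
     (\<forall>j<length t. if \<sigma> ! j = 0 then t ! j \<notin> roots_of S else t ! j = root S (\<sigma> ! j))"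

lemma matchesD:
  assumes "matches S \<sigma> t" "j < length t"
  shows "\<sigma> ! j = 0 \<Longrightarrow> t ! j \<notin> roots_of S" "\<sigma> ! j \<noteq> 0 \<Longrightarrow> t ! j = root S (\<sigma> ! j)"
  using assms unfolding matches_def by presburger+

lemma mixed_nth: "\<sigma> \<in> mixed n \<Longrightarrow> j < n \<Longrightarrow> \<sigma> ! j \<noteq> 0 \<Longrightarrow> \<sigma> ! j \<in> {1..w}"
  using nth_mem[of j \<sigma>] by (fastforce simp: mixed_def simp del: nth_mem)

definition free_pos :: "nat list \<Rightarrow> nat" where
  "free_pos \<sigma> = (SOME i. i < length \<sigma> \<and> \<sigma> ! i = 0)"

lemma free_pos: "\<sigma> \<in> mixed n \<Longrightarrow> free_pos \<sigma> < n \<and> \<sigma> ! free_pos \<sigma> = 0"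
proof -
  assume "\<sigma> \<in> mixed n"
  then have "\<exists>i. i < length \<sigma> \<and> \<sigma> ! i = 0" and n: "length \<sigma> = n"
    by (auto simp: mixed_def in_set_conv_nth)
  from someI_ex[OF this(1)] show ?thesis
    by (simp add: free_pos_def n)
qed

text \<open>One code per root position. A tuple without roots has no such position; its free
  position then serves as a dummy source, so that the tuple still gets a code.\<close>

definition code_sources :: "nat list \<Rightarrow> nat set" where
  "code_sources \<sigma> = (if \<forall>j<length \<sigma>. \<sigma> ! j = 0 then {free_pos \<sigma>} else {j. j < length \<sigma> \<and> \<sigma> ! j \<noteq> 0})"

lemma code_sources: "\<sigma> \<in> mixed n \<Longrightarrow> code_sources \<sigma> \<noteq> {} \<and> code_sources \<sigma> \<subseteq> {..<n}"
  using free_pos[of \<sigma> n] by (auto simp: code_sources_def mixed_def)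

lemma finite_code_sources: "\<sigma> \<in> mixed n \<Longrightarrow> finite (code_sources \<sigma>)"
  using code_sources finite_subset by blast

lemma set_map_root:
  assumes "D \<subseteq> {\<sigma>. set \<sigma> \<subseteq> {1..w}}" "s \<in> map (root S) ` D"
  shows "set s \<subseteq> roots_of S"
proof -
  obtain \<sigma> where "\<sigma> \<in> D" "s = map (root S) \<sigma>"
    using assms(2) by blast
  moreover from this have "set \<sigma> \<subseteq> {1..w}"
    using assms(1) by blast
  ultimately show ?thesis
    by (simp only: set_map image_mono)
qed

lemma ex_matches:
  assumes "\<not> set t \<subseteq> roots_of S" "length t = n"
  shows "\<exists>\<sigma>\<in>mixed n. matches S \<sigma> t"
proof -
  define f where "f x = (if x \<in> roots_of S then SOME l. l \<in> {1..w} \<and> x = root S l else 0)" for x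
  have f: "f x \<in> {1..w} \<and> x = root S (f x)" if "x \<in> roots_of S" for x
  proof -
    have "\<exists>l. l \<in> {1..w} \<and> x = root S l" using that by blast
    from someI_ex[OF this] show ?thesis
      using that by (simp only: f_def if_True)
  qed
  have f0: "f x = 0 \<longleftrightarrow> x \<notin> roots_of S" for x
    using f[of x] by (auto simp: f_def)
  have "f x \<le> w" for x
    using f[of x] f0[of x] by (cases "x \<in> roots_of S") auto
  moreover obtain x where "x \<in> set t" "f x = 0"
    using assms(1) f0 by blast
  ultimately have "map f t \<in> mixed n"
    using assms(2) by (force simp: mixed_def)
  moreover have "matches S (map f t) t"
    using f f0 by (auto simp: matches_def)
  ultimately show ?thesis by blast
qed

text \<open>A tuple \<open>t\<close> of a relation that is guarded in the whole structure may contain several roots that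
  are not adjacent within a part, so it cannot be stored in a guarded relation of the part. Quantifying
  one relation per pattern of roots would raise the quantifier rank. Instead, \<open>t\<close> is stored as one
  longer tuple for each root \<open>r\<close> in \<open>t\<close>, in which \<open>r\<close> is the only root: the other
  roots are overwritten by some entry \<open>x\<close> which is not a root, and the pattern \<open>\<sigma>\<close> of roots in
  \<open>t\<close> is recorded by the position of \<open>r\<close> in a prefix \<open>x, \<dots>, x, r, x, \<dots>, x\<close> of length \<open>N\<close>.\<close>

context
  fixes n N :: nat and idx :: "nat list \<Rightarrow> nat"
  assumes idx_inj: "inj_on idx (mixed n)" and idx_range: "idx ` mixed n \<subseteq> {..<N}"
begin

lemma idx_less: "\<sigma> \<in> mixed n \<Longrightarrow> idx \<sigma> < N"
  using idx_range by blast

definition code :: "nat list \<Rightarrow> nat \<Rightarrow> 'x list \<Rightarrow> 'x list" where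
  "code \<sigma> j t = map (\<lambda>i. if i = idx \<sigma> then t ! j else t ! free_pos \<sigma>) [0..<N] @
     map (\<lambda>i. if \<sigma> ! i = 0 then t ! i else t ! free_pos \<sigma>) [0..<n]"

lemma length_code: "length (code \<sigma> j t) = N + n"
  by (simp add: code_def)

lemma code_nth1: "i < N \<Longrightarrow> code \<sigma> j t ! i = (if i = idx \<sigma> then t ! j else t ! free_pos \<sigma>)"
  by (simp add: code_def nth_append)

lemma code_nth2: "i < n \<Longrightarrow> code \<sigma> j t ! (N + i) = (if \<sigma> ! i = 0 then t ! i else t ! free_pos \<sigma>)"
  by (simp add: code_def nth_append)

lemma set_code:
  assumes "\<sigma> \<in> mixed n"
  shows "set (code \<sigma> j t) = insert (t ! j) {t ! i | i. i < n \<and> \<sigma> ! i = 0}" (is "_ = ?R")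
proof
  show "set (code \<sigma> j t) \<subseteq> ?R"
    using free_pos[OF assms] by (auto simp: code_def)
  show "?R \<subseteq> set (code \<sigma> j t)"
    using idx_less[OF assms] by (fastforce simp: code_def)
qed

text \<open>All sources have to be present in \<open>P\<close>: a root of \<open>t\<close> meets the
  non-root entries only in the codes whose source it is, so each source is responsible for its own
  edges. Root-only tuples are not stored in \<open>P\<close> but come from \<open>D\<close>.\<close>

definition decode ::
    "nat list set \<Rightarrow> (nat \<times> nat) set \<Rightarrow> ('r, 'a) struct \<Rightarrow> 'a list set \<Rightarrow> 'a list set" where
  "decode D G S P = {t\<in>tuples (univ S) n. t \<in> map (root S) ` D \<or> (names_guarded G S t \<and>
     (\<exists>\<sigma>\<in>mixed n. matches S \<sigma> t \<and> (\<forall>j\<in>code_sources \<sigma>. code \<sigma> j t \<in> P)))}"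

lemma decode_subset: "decode D G S P \<subseteq> tuples (univ S) n"
  by (auto simp: decode_def)

lemma matches_mixed_not_roots:
  assumes "\<sigma> \<in> mixed n" "matches S \<sigma> t" "length t = n"
  shows "\<not> set t \<subseteq> roots_of S"
proof -
  have "t ! free_pos \<sigma> \<in> set t" "t ! free_pos \<sigma> \<notin> roots_of S"
    using free_pos[OF assms(1)] assms(2,3) by (auto simp: matches_def)
  then show ?thesis by blast
qed

text \<open>A non-root entry \<open>x\<close> of a decoded tuple occurs in all of its codes. Any
  other entry \<open>y\<close> shares a code with \<open>x\<close>: every code if \<open>y\<close>
  is not a root, else the one whose source is a position of \<open>y\<close>. Guardedness of the
  codes thus yields the required edges.\<close>

lemma admissible_decode:
  assumes D: "D \<subseteq> {\<sigma>. set \<sigma> \<subseteq> {1..w}}" and P: "guarded \<tau> S P"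
  shows "admissible D G S n (decode D G S P)"
  unfolding admissible_def
proof (intro conjI ballI impI)
  fix t assume t: "t \<in> tuples (univ S) n" "set t \<subseteq> roots_of S"
  then show "t \<in> decode D G S P \<longleftrightarrow> t \<in> map (root S) ` D"
    using matches_mixed_not_roots[of _ S t] by (auto simp: decode_def tuples_def)
next
  fix t assume t: "t \<in> decode D G S P" "\<not> set t \<subseteq> roots_of S"
  have "t \<notin> map (root S) ` D"
    using t(2) by (rule contrapos_nn) (rule set_map_root[OF D])
  with t obtain \<sigma> where \<sigma>: "\<sigma> \<in> mixed n" "matches S \<sigma> t" "\<forall>j\<in>code_sources \<sigma>. code \<sigma> j t \<in> P"
    and len: "length t = n" and "names_guarded G S t"
    by (auto simp: decode_def tuples_def)
  then show "names_guarded G S t" by simp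
  have adj: "(x, y) \<in> gaifman \<tau> S" if "x \<in> set t" "y \<in> set t" "x \<noteq> y" "x \<notin> roots_of S" for x y
  proof -
    obtain i where i: "i < n" "t ! i = x"
      using \<open>x \<in> set t\<close> len by (auto simp: in_set_conv_nth)
    then have i0: "\<sigma> ! i = 0"
      using matchesD(2)[OF \<sigma>(2)] mixed_nth[OF \<sigma>(1)] len \<open>x \<notin> roots_of S\<close> by blast
    obtain j where j: "j < n" "t ! j = y"
      using \<open>y \<in> set t\<close> len by (auto simp: in_set_conv_nth)
    obtain c where c: "c \<in> P" "x \<in> set c" "y \<in> set c"
    proof (cases "\<sigma> ! j = 0")
      case True
      obtain k where "k \<in> code_sources \<sigma>"
        using code_sources[OF \<sigma>(1)] by blast
      then show ?thesis
        using that[of "code \<sigma> k t"] \<sigma>(3) set_code[OF \<sigma>(1), of k t] True i i0 j by blast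
    next
      case False
      then have "j \<in> code_sources \<sigma>"
        using j \<sigma>(1) by (auto simp: code_sources_def mixed_def)
      then show ?thesis
        using that[of "code \<sigma> j t"] \<sigma>(3) set_code[OF \<sigma>(1), of j t] i i0 j by blast
    qed
    then show ?thesis
      using P \<open>x \<noteq> y\<close> by (auto simp: guarded_def gaifman_rel_def)
  qed
  have sym: "(x, y) \<in> gaifman \<tau> S \<Longrightarrow> (y, x) \<in> gaifman \<tau> S" for x y
    by (auto simp: gaifman_def gaifman_rel_def)
  show "(x, y) \<in> gaifman \<tau> S" if "x \<in> set t" "y \<in> set t" "x \<noteq> y"
      "\<not> (x \<in> roots_of S \<and> y \<in> roots_of S)" for x y
    using that adj[of x y] adj[of y x] sym by blast
qed

text \<open>Among the first \<open>N\<close> entries a root can only occur at position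
  \<open>idx \<sigma>\<close>, and it does so unless \<open>\<sigma>\<close> consists of zeros. So
  the code reveals \<open>\<sigma>\<close>; the last \<open>n\<close> entries then give the non-root
  entries of \<open>t\<close>, and \<open>\<sigma>\<close> names its roots.\<close>

lemma code_inject:
  assumes \<sigma>: "\<sigma> \<in> mixed n" "matches S \<sigma> t" "length t = n" "j \<in> code_sources \<sigma>"
    and \<sigma>': "\<sigma>' \<in> mixed n" "matches S \<sigma>' t'" "length t' = n" "j' \<in> code_sources \<sigma>'"
    and eq: "code \<sigma> j t = code \<sigma>' j' t'"
  shows "t = t'"
proof -
  have root_at: "code \<sigma> j t ! i \<in> roots_of S \<longleftrightarrow> i = idx \<sigma> \<and> \<not> (\<forall>j<n. \<sigma> ! j = 0)"
    if \<sigma>: "\<sigma> \<in> mixed n" "matches S \<sigma> t" "length t = n" "j \<in> code_sources \<sigma>" and i: "i < N"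
    for \<sigma> t j i
  proof -
    have "t ! k \<in> roots_of S \<longleftrightarrow> \<sigma> ! k \<noteq> 0" if "k < n" for k
      using matchesD[OF \<sigma>(2), of k] mixed_nth[OF \<sigma>(1) that] \<sigma>(3) that by blast
    moreover have "j < n" "\<sigma> ! j \<noteq> 0 \<longleftrightarrow> \<not> (\<forall>j<n. \<sigma> ! j = 0)"
      using \<sigma>(1,4) free_pos[OF \<sigma>(1)] by (auto simp: code_sources_def mixed_def split: if_splits)
    ultimately show ?thesis
      using free_pos[OF \<sigma>(1)] i by (simp add: code_nth1)
  qed
  have "\<sigma> = \<sigma>'"
  proof (cases "\<forall>j<n. \<sigma> ! j = 0")
    case True
    then have "\<forall>j<n. \<sigma>' ! j = 0"
      using root_at[OF \<sigma> idx_less[OF \<sigma>'(1)]] root_at[OF \<sigma>' idx_less[OF \<sigma>'(1)]] eq by auto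
    then show ?thesis
      using True \<sigma>(1) \<sigma>'(1) by (intro nth_equalityI) (auto simp: mixed_def)
  next
    case False
    then have "idx \<sigma> = idx \<sigma>'"
      using root_at[OF \<sigma> idx_less[OF \<sigma>(1)]] root_at[OF \<sigma>' idx_less[OF \<sigma>(1)]] eq by auto
    then show ?thesis
      using idx_inj \<sigma>(1) \<sigma>'(1) by (auto dest: inj_onD)
  qed
  show ?thesis
  proof (rule nth_equalityI)
    fix i assume i: "i < length t"
    have "code \<sigma> j t ! (N + i) = code \<sigma>' j' t' ! (N + i)"
      using eq by simp
    then show "t ! i = t' ! i"
      using i \<sigma> \<sigma>' \<open>\<sigma> = \<sigma>'\<close> by (auto simp: code_nth2 matches_def split: if_splits)
  qed (use \<sigma> \<sigma>' in auto)
qed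

text \<open>The witness is the set of all codes of those tuples in \<open>P\<close> that have a
  non-root entry. A code contains at most one root, namely its source entry, so each pair of
  distinct entries in it is among those that \<open>admissible\<close> makes adjacent in the part;
  \<open>code_inject\<close> keeps decoding from adding tuples.\<close>

lemma decode_surj:
  assumes P: "P \<subseteq> tuples (univ S) n" "admissible D G S n P"
    and D: "D \<subseteq> {\<sigma>. set \<sigma> \<subseteq> {1..w}}"
  shows "\<exists>Q\<subseteq>tuples (univ S) (N + n). guarded \<tau> S Q \<and> decode D G S Q = P"
proof -
  define Q where "Q = {code \<sigma> j t | \<sigma> j t. t \<in> P \<and> \<sigma> \<in> mixed n \<and> matches S \<sigma> t \<and> j \<in> code_sources \<sigma>}"
  have set_code_subset: "set (code \<sigma> j t) \<subseteq> set t"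
    if "t \<in> P" "\<sigma> \<in> mixed n" "j \<in> code_sources \<sigma>" for \<sigma> j t
    using that P(1) code_sources[OF that(2)] by (auto simp: set_code tuples_def intro!: nth_mem)
  have "Q \<subseteq> tuples (univ S) (N + n)"
    unfolding Q_def tuples_def using set_code_subset P(1) by (fastforce simp: length_code tuples_def)
  moreover have "guarded \<tau> S Q"
    unfolding guarded_def gaifman_rel_def
  proof clarify
    fix x y c assume xy: "x \<noteq> y" "c \<in> Q" "x \<in> set c" "y \<in> set c"
    then obtain \<sigma> j t where t: "c = code \<sigma> j t" "t \<in> P" "\<sigma> \<in> mixed n" "matches S \<sigma> t" "j \<in> code_sources \<sigma>"
      unfolding Q_def by blast
    then have len: "length t = n"
      using P(1) by (auto simp: tuples_def)
    have root: "z = t ! j" if z: "z \<in> set c" "z \<in> roots_of S" for z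
    proof (rule ccontr)
      assume "z \<noteq> t ! j"
      then obtain i where i: "z = t ! i" "i < n" "\<sigma> ! i = 0"
        using z(1) unfolding t(1) set_code[OF t(3)] by auto
      then have "z \<notin> roots_of S"
        using matchesD(1)[OF t(4)] len by simp
      with z(2) show False by contradiction
    qed
    have "\<not> (x \<in> roots_of S \<and> y \<in> roots_of S)"
      using root[of x] root[of y] xy(1,3,4) by auto
    moreover have "x \<in> set t" "y \<in> set t"
      using set_code_subset[OF t(2,3,5)] xy t(1) by auto
    ultimately show "(x, y) \<in> gaifman \<tau> S"
      using P(2) t(2) matches_mixed_not_roots[OF t(3,4) len] xy(1) unfolding admissible_def by blast
  qed
  moreover have "decode D G S Q = P"
  proof (intro equalityI subsetI)
    fix t assume t: "t \<in> decode D G S Q"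
    then have len: "t \<in> tuples (univ S) n" "length t = n"
      by (auto simp: decode_def tuples_def)
    show "t \<in> P"
    proof (cases "t \<in> map (root S) ` D")
      case True
      moreover have "set t \<subseteq> roots_of S"
        using set_map_root[OF D True] .
      ultimately show ?thesis
        using P(2) len(1) by (auto simp: admissible_def)
    next
      case False
      then obtain \<sigma> where \<sigma>: "\<sigma> \<in> mixed n" "matches S \<sigma> t" "\<forall>j\<in>code_sources \<sigma>. code \<sigma> j t \<in> Q"
        using t by (auto simp: decode_def)
      obtain j where j: "j \<in> code_sources \<sigma>"
        using code_sources[OF \<sigma>(1)] by blast
      then have "code \<sigma> j t \<in> Q" using \<sigma>(3) by blast
      then obtain \<sigma>' j' t' where t': "code \<sigma> j t = code \<sigma>' j' t'" "t' \<in> P" "\<sigma>' \<in> mixed n"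
          "matches S \<sigma>' t'" "j' \<in> code_sources \<sigma>'"
        unfolding Q_def by blast
      moreover have "length t' = n"
        using t'(2) P(1) by (auto simp: tuples_def)
      ultimately have "t = t'"
        using code_inject[OF \<sigma>(1,2) len(2) j] by blast
      then show ?thesis using t'(2) by simp
    qed
  next
    fix t assume t: "t \<in> P"
    then have len: "t \<in> tuples (univ S) n" "length t = n"
      using P(1) by (auto simp: tuples_def)
    show "t \<in> decode D G S Q"
    proof (cases "set t \<subseteq> roots_of S")
      case True
      then show ?thesis
        using P(2) t len by (auto simp: admissible_def decode_def)
    next
      case False
      then obtain \<sigma> where \<sigma>: "\<sigma> \<in> mixed n" "matches S \<sigma> t"
        using ex_matches[OF False len(2)] by metis
      have "names_guarded G S t"
        using P(2) t False unfolding admissible_def by metis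
      moreover have "\<forall>j\<in>code_sources \<sigma>. code \<sigma> j t \<in> Q"
        unfolding Q_def using t \<sigma> by blast
      ultimately show ?thesis
        unfolding decode_def using len(1) \<sigma> by blast
    qed
  qed
  ultimately show ?thesis by blast
qed

text \<open>The tuple \<open>t\<close> is only given through the monadic predicates
  \<open>Ys\<close> whose values are its entries. As \<open>code\<close> is polymorphic, it also
  rearranges the list \<open>Ys\<close>, and the elem atom with arguments
  \<open>code \<sigma> j Ys\<close> says that \<open>code \<sigma> j t\<close> lies in
  \<open>X'\<close>. The remaining conditions are Boolean combinations of atoms about roots, so no
  quantifier arises.\<close>

lemma definable_decode_atom:
  assumes D: "D \<subseteq> {\<sigma>. set \<sigma> \<subseteq> {1..w} \<and> length \<sigma> = n}"
    and Ys: "\<forall>Y\<in>set Ys. pred_wf L \<tau> Y \<and> pred_arity \<tau> Y = 1 \<and> pred_fv Y \<subseteq> V" "length Ys = n"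
    and X': "X' \<in> V" "logic_var L X'" "sv_arity X' = N + n" and N: "n = 0 \<Longrightarrow> N = 0"
  shows "definable q V (\<lambda>S a. \<exists>t. length t = length Ys \<and>
    (\<forall>j<length Ys. pred_val S a (Ys ! j) = {[t ! j]}) \<and> t \<in> decode D G S (a X'))"
proof -
  have Ysn: "pred_wf L \<tau> (Ys ! j)" "pred_arity \<tau> (Ys ! j) = 1" "pred_fv (Ys ! j) \<subseteq> V" if "j < n" for j
    using Ys that by auto
  \<comment> \<open>Constants have to be built from some formula. With \<open>n = 0\<close> the list
    \<open>Ys\<close> is empty, but then \<open>N\<close> is 0 as well, and the nullary
    \<open>X'\<close> forms an atom by itself.\<close>
  have "\<exists>p. definable q V (p :: ('r, 'a) struct \<Rightarrow> 'a assignment \<Rightarrow> bool)"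
  proof (cases "n = 0")
    case True
    then show ?thesis
      using definable_SElem[of "[]" V "Var X'" q] X' N by auto
  next
    case False
    then show ?thesis
      using definable_SEmpty[OF Ysn] by blast
  qed
  then obtain p\<^sub>0 where p\<^sub>0: "definable q V (p\<^sub>0 :: ('r, 'a) struct \<Rightarrow> 'a assignment \<Rightarrow> bool)" by blast
  note ball = definable_ball[OF _ p\<^sub>0] and bex = definable_bex[OF _ p\<^sub>0]
  let ?is = "\<lambda>j l (S :: ('r, 'a) struct) a. pred_val S a (Ys ! j) = {[root S l]}"
  have root: "definable q V (?is j l)" if "j < n" "l \<in> {1..w}" for j l
    by (rule definable_root_elem) (use Ysn[OF that(1)] that in auto)
  \<comment> \<open>The atom with \<open>Ys ! j\<close> both as argument and as relation holds
    exactly if its value is a singleton.\<close>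
  define sing where "sing = (\<lambda>(S :: ('r, 'a) struct) a. \<forall>j\<in>{..<n}. \<exists>t. length t = length [Ys ! j] \<and>
    (\<forall>i<length [Ys ! j]. pred_val S a ([Ys ! j] ! i) = {[t ! i]}) \<and> t \<in> pred_val S a (Ys ! j))"
  define bags where "bags = (\<lambda>(S :: ('r, 'a) struct) a. \<exists>\<sigma>\<in>D. \<forall>j\<in>{..<n}. ?is j (\<sigma> ! j) S a)"
  define names where "names = (\<lambda>(S :: ('r, 'a) struct) a. \<forall>l\<in>{1..w}. \<forall>l'\<in>{1..w}.
    ((\<exists>j\<in>{..<n}. ?is j l S a) \<and> (\<exists>j\<in>{..<n}. ?is j l' S a)) \<and> (l, l') \<notin> G \<longrightarrow> False)"
  define match where "match = (\<lambda>\<sigma> (S :: ('r, 'a) struct) a. \<forall>j\<in>{..<n}.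
    if \<sigma> ! j = 0 then \<not> (\<exists>l\<in>{1..w}. ?is j l S a) else ?is j (\<sigma> ! j) S a)"
  define codes where "codes = (\<lambda>\<sigma> (S :: ('r, 'a) struct) a. \<forall>j\<in>code_sources \<sigma>.
    \<exists>t. length t = length (code \<sigma> j Ys) \<and>
    (\<forall>i<length (code \<sigma> j Ys). pred_val S a (code \<sigma> j Ys ! i) = {[t ! i]}) \<and> t \<in> pred_val S a (Var X'))"
  have "definable q V sing"
    unfolding sing_def by (rule ball, simp, rule definable_SElem) (use Ysn in auto)
  moreover have "definable q V bags"
    unfolding bags_def
  proof (rule bex)
    show "finite D"
      by (rule finite_subset[OF D finite_lists_length_eq]) simp
    fix \<sigma> assume "\<sigma> \<in> D"
    then have "\<sigma> ! j \<in> {1..w}" if "j < n" for j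
      using D that nth_mem[of j \<sigma>] by blast
    then show "definable q V (\<lambda>S a. \<forall>j\<in>{..<n}. ?is j (\<sigma> ! j) S a)"
      by (intro ball root) auto
  qed
  moreover have "definable q V names"
  proof -
    have "definable q V (\<lambda>S a. \<not> (((\<exists>j\<in>{..<n}. ?is j l S a) \<and> (\<exists>j\<in>{..<n}. ?is j l' S a)) \<and> (l, l') \<notin> G))"
      if "l \<in> {1..w}" "l' \<in> {1..w}" for l l'
    proof (rule definable_Not, rule definable_conj, rule definable_conj)
      show "definable q V (\<lambda>S a. \<exists>j\<in>{..<n}. ?is j l S a)" "definable q V (\<lambda>S a. \<exists>j\<in>{..<n}. ?is j l' S a)"
        by (rule bex, simp, rule root, simp, rule that)+
    qed (rule definable_const[OF p\<^sub>0])
    then show ?thesis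
      unfolding names_def by (intro ball) simp_all
  qed
  moreover have "definable q V (match \<sigma>)" if "\<sigma> \<in> mixed n" for \<sigma>
    unfolding match_def
  proof (rule ball)
    fix j assume j: "j \<in> {..<n}"
    show "definable q V (\<lambda>S a. if \<sigma> ! j = 0 then \<not> (\<exists>l\<in>{1..w}. ?is j l S a) else ?is j (\<sigma> ! j) S a)"
    proof (cases "\<sigma> ! j = 0")
      case True
      have "definable q V (\<lambda>S a. \<not> (\<exists>l\<in>{1..w}. ?is j l S a))"
        by (intro definable_Not bex root) (use j in auto)
      then show ?thesis using True by simp
    next
      case False
      then have "\<sigma> ! j \<in> {1..w}"
        using that j mixed_nth by blast
      then show ?thesis
        using root[of j "\<sigma> ! j"] j False by simp
    qed
  qed simp
  moreover have "definable q V (codes \<sigma>)" if "\<sigma> \<in> mixed n" for \<sigma>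
    unfolding codes_def
  proof (rule ball, use finite_code_sources[OF that] in simp, rule definable_SElem)
    fix j assume "j \<in> code_sources \<sigma>"
    then have "j < n" using code_sources[OF that] by auto
    then show "\<forall>Y\<in>set (code \<sigma> j Ys). pred_wf L \<tau> Y \<and> pred_arity \<tau> Y = 1 \<and> pred_fv Y \<subseteq> V"
      using Ysn by (auto simp: set_code[OF that])
  qed (use X' in \<open>auto simp: length_code\<close>)
  ultimately have "definable q V (\<lambda>S a. sing S a \<and>
      (bags S a \<or> (names S a \<and> (\<exists>\<sigma>\<in>mixed n. match \<sigma> S a \<and> codes \<sigma> S a))))"
    by (intro definable_conj definable_disj bex finite_mixed) auto
  then show ?thesis
  proof (rule definable_cong)
    fix S :: "('r, 'a) struct" and a
    assume good: "good V S a"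
    have sing: "sing S a \<longleftrightarrow> (\<exists>t. length t = n \<and> (\<forall>j<n. pred_val S a (Ys ! j) = {[t ! j]}))"
      (is "_ \<longleftrightarrow> (\<exists>t. ?t t)")
    proof
      assume "sing S a"
      then have "\<exists>x. pred_val S a (Ys ! j) = {[x]}" if "j < n" for j
        using that by (auto simp: sing_def)
      then obtain f where "\<And>j. j < n \<Longrightarrow> pred_val S a (Ys ! j) = {[f j]}" by metis
      then have "?t (map f [0..<n])" by auto
      then show "\<exists>t. ?t t" by blast
    next
      assume "\<exists>t. ?t t"
      then show "sing S a"
        by (auto simp: sing_def length_Suc_conv)
    qed
    have "bags S a \<or> (names S a \<and> (\<exists>\<sigma>\<in>mixed n. match \<sigma> S a \<and> codes \<sigma> S a)) \<longleftrightarrow> t \<in> decode D G S (a X')"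
      if t: "?t t" for t
    proof -
      have t_tuple: "t \<in> tuples (univ S) n"
      proof -
        have "t ! j \<in> univ S" if "j < n" for j
          using pred_val_tuples[OF good, of "Ys ! j"] Ysn[OF that] t that by (auto simp: tuples_def)
        then show ?thesis
          using t by (auto simp: tuples_def in_set_conv_nth)
      qed
      have is_iff: "?is j l S a \<longleftrightarrow> t ! j = root S l" if "j < n" for j l
        using t that by simp
      have "bags S a \<longleftrightarrow> t \<in> map (root S) ` D"
      proof -
        have "(\<forall>j\<in>{..<n}. ?is j (\<sigma> ! j) S a) \<longleftrightarrow> t = map (root S) \<sigma>" if "\<sigma> \<in> D" for \<sigma>
          using is_iff D that t by (auto simp: list_eq_iff_nth_eq)
        then show ?thesis by (auto simp: bags_def)
      qed
      moreover have "names S a \<longleftrightarrow> names_guarded G S t"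
      proof -
        have "(\<exists>j\<in>{..<n}. ?is j l S a) \<longleftrightarrow> root S l \<in> set t" for l
          using is_iff t by (auto simp: in_set_conv_nth)
        then show ?thesis
          unfolding names_def names_guarded_def by (simp only:) blast
      qed
      moreover have "match \<sigma> S a \<longleftrightarrow> matches S \<sigma> t" for \<sigma>
        using is_iff t by (auto simp: match_def matches_def)
      moreover have "codes \<sigma> S a \<longleftrightarrow> (\<forall>j\<in>code_sources \<sigma>. code \<sigma> j t \<in> a X')" if \<sigma>: "\<sigma> \<in> mixed n" for \<sigma>
      proof -
        have "(\<exists>s. length s = length (code \<sigma> j Ys) \<and>
            (\<forall>i<length (code \<sigma> j Ys). pred_val S a (code \<sigma> j Ys ! i) = {[s ! i]}) \<and>
            s \<in> pred_val S a (Var X')) \<longleftrightarrow> code \<sigma> j t \<in> a X'" (is "(\<exists>s. ?s s) \<longleftrightarrow> _")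
          if j: "j \<in> code_sources \<sigma>" for j
        proof -
          have "j < n" using code_sources[OF \<sigma>] j by auto
          then have vals: "pred_val S a (code \<sigma> j Ys ! i) = {[code \<sigma> j t ! i]}" if "i < N + n" for i
            using t free_pos[OF \<sigma>] that by (auto simp: code_def nth_append)
          have "s = code \<sigma> j t" if "?s s" for s
            using that vals by (intro nth_equalityI) (auto simp: length_code)
          moreover have "?s (code \<sigma> j t)" if "code \<sigma> j t \<in> a X'"
            using that vals by (auto simp: length_code)
          ultimately show ?thesis by auto
        qed
        then show ?thesis by (simp add: codes_def)
      qed
      ultimately show ?thesis
        using t_tuple by (auto simp: decode_def)
    qed
    with sing show "sing S a \<and> (bags S a \<or> (names S a \<and> (\<exists>\<sigma>\<in>mixed n. match \<sigma> S a \<and> codes \<sigma> S a))) \<longleftrightarrow>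
      (\<exists>t. length t = length Ys \<and> (\<forall>j<length Ys. pred_val S a (Ys ! j) = {[t ! j]}) \<and>
        t \<in> decode D G S (a X'))"
      unfolding Ys(2) by blast
  qed
qed

end

text \<open>A monadic relation has no tuples with two distinct entries, so it is guarded, and
  admissibility only prescribes which roots it contains. Any other arity presupposes GSO, where
  codes can be quantified instead: by \<open>admissible_decode\<close> and
  \<open>decode_surj\<close>, the decodings of guarded relations are exactly the admissible
  ones.\<close>

lemma definable_ex_admissible:
  fixes p :: "('r, 'a) struct \<Rightarrow> 'a assignment \<Rightarrow> bool"
  assumes X: "logic_var L X" and p: "definable q (insert X V) p"
    and D: "D \<subseteq> {\<sigma>. set \<sigma> \<subseteq> {1..w} \<and> length \<sigma> = sv_arity X}"
  shows "definable (Suc q) V (\<lambda>S a. \<exists>P\<subseteq>tuples (univ S) (sv_arity X).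
    admissible D G S (sv_arity X) P \<and> p S (a(X := P)))"
proof (cases "sv_arity X = 1")
  case True
  have fin: "finite D"
    by (rule finite_subset[OF D finite_lists_length_eq]) simp
  let ?q = "\<lambda>l (S :: ('r, 'a) struct) a. ([root S l] \<in> pred_val S a (Var X)) = (\<exists>\<sigma>\<in>D. root S l = root S (hd \<sigma>))"
  have hd: "hd \<sigma> \<in> {1..w}" "\<sigma> = [hd \<sigma>]" if "\<sigma> \<in> D" for \<sigma>
    using D that True by (auto simp: length_Suc_conv)
  have "definable q (insert X V) (?q l)" if "l \<in> {1..w}" for l
  proof (rule definable_iff)
    show "definable q (insert X V) (\<lambda>(S :: ('r, 'a) struct) a. [root S l] \<in> pred_val S a (Var X))"
      by (rule definable_root_in) (use X True that in auto)
    show "definable q (insert X V) (\<lambda>(S :: ('r, 'a) struct) a. \<exists>\<sigma>\<in>D. root S l = root S (hd \<sigma>))"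
      by (rule definable_bex[OF fin p], rule definable_root_eq[OF that hd(1)])
  qed
  then have "definable q (insert X V) (\<lambda>S a. \<forall>l\<in>{1..w}. ?q l S a)"
    by (intro definable_ball[OF finite_atLeastAtMost p])
  then have "definable (Suc q) V (\<lambda>S a. \<exists>P\<subseteq>tuples (univ S) (sv_arity X). guarded \<tau> S P \<and>
      ((\<forall>l\<in>{1..w}. ?q l S (a(X := P))) \<and> p S (a(X := P))))"
    using definable_ex[OF X definable_conj[OF _ p]] by blast
  then show ?thesis
  proof (rule definable_cong)
    fix S :: "('r, 'a) struct" and a :: "'a assignment"
    assume "good V S a"
    then have rooted: "rooted_structure \<tau> w B S" by (simp add: good_def)
    have "admissible D G S 1 P \<longleftrightarrow> (\<forall>l\<in>{1..w}. ?q l S (a(X := P)))" if P: "P \<subseteq> tuples (univ S) 1" for P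
    proof -
      have map_iff: "[x] \<in> map (root S) ` D \<longleftrightarrow> (\<exists>\<sigma>\<in>D. x = root S (hd \<sigma>))" for x
      proof -
        have "[x] = map (root S) \<sigma> \<longleftrightarrow> x = root S (hd \<sigma>)" if "\<sigma> \<in> D" for \<sigma>
          by (subst hd(2)[OF that]) simp
        then show ?thesis
          unfolding image_iff by simp
      qed
      have "(\<forall>t\<in>tuples (univ S) 1. set t \<subseteq> roots_of S \<longrightarrow> (t \<in> P \<longleftrightarrow> t \<in> map (root S) ` D)) \<longleftrightarrow>
          (\<forall>l\<in>{1..w}. [root S l] \<in> P \<longleftrightarrow> [root S l] \<in> map (root S) ` D)"
        (is "?A \<longleftrightarrow> ?B")
      proof
        assume all: ?A
        show ?B
        proof
          fix l assume l: "l \<in> {1..w}"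
          have "[root S l] \<in> tuples (univ S) 1" "set [root S l] \<subseteq> roots_of S"
            using root_in_univ[OF rooted l] l by (simp_all add: tuples_def)
          then show "[root S l] \<in> P \<longleftrightarrow> [root S l] \<in> map (root S) ` D"
            using all by metis
        qed
      next
        assume all: ?B
        show ?A
        proof (intro ballI impI)
          fix t assume t: "t \<in> tuples (univ S) 1" "set t \<subseteq> roots_of S"
          then obtain x where x: "t = [x]"
            by (auto simp: tuples_def length_Suc_conv)
          then have "x \<in> roots_of S" using t(2) by simp
          then obtain l where "l \<in> {1..w}" "x = root S l" by (rule imageE)
          then show "t \<in> P \<longleftrightarrow> t \<in> map (root S) ` D"
            using all x by metis
        qed
      qed
      moreover have "(\<forall>x\<in>set t. \<forall>y\<in>set t. x \<noteq> y \<longrightarrow> \<not> (x \<in> roots_of S \<and> y \<in> roots_of S) \<longrightarrow>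
          (x, y) \<in> gaifman \<tau> S) \<and> names_guarded G S t" if "t \<in> P" "\<not> set t \<subseteq> roots_of S" for t
      proof -
        have "t \<in> tuples (univ S) 1"
          using P that(1) by blast
        then obtain x where "t = [x]"
          by (auto simp: tuples_def length_Suc_conv)
        with that(2) show ?thesis by (auto simp: names_guarded_def)
      qed
      ultimately show ?thesis
        unfolding admissible_def map_iff by (auto simp del: One_nat_def)
    qed
    then show "(\<exists>P\<subseteq>tuples (univ S) (sv_arity X). guarded \<tau> S P \<and>
        ((\<forall>l\<in>{1..w}. ?q l S (a(X := P))) \<and> p S (a(X := P)))) \<longleftrightarrow>
      (\<exists>P\<subseteq>tuples (univ S) (sv_arity X). admissible D G S (sv_arity X) P \<and> p S (a(X := P)))"
      using True monadic_guarded[of _ "univ S" \<tau> S] by metis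
  qed
next
  case False
  let ?n = "sv_arity X"
  obtain \<psi> where \<psi>: "so_wf L \<tau> \<psi>" "so_fv \<psi> \<subseteq> insert X V" "so_qr \<psi> \<le> q"
      "\<And>S a. good (insert X V) S a \<Longrightarrow> so_sat \<tau> S a \<psi> = p S a"
    using p unfolding definable_def by blast
  have L: "L = GSO"
    using X False by (cases L) (auto simp: logic_var_def)
  \<comment> \<open>One prefix position for each pattern. The quantified variable thus gets arity
    \<open>card (mixed ?n) + ?n\<close> in place of \<open>?n\<close>.\<close>
  define N where "N = card (mixed ?n)"
  obtain idx where idx: "inj_on idx (mixed ?n)" "idx ` mixed ?n \<subseteq> {..<N}"
    using ex_bij_betw_finite_nat[OF finite_mixed[of ?n]] by (auto simp: N_def bij_betw_def atLeast0LessThan)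
  have "finite (so_fv \<psi>)"
  proof (induction \<psi>)
    have "finite (pred_fv Y)" for Y :: "'r pred" by (cases Y) auto
    {
      case (SElem Ys Z)
      then show ?case using \<open>\<And>Y. finite (pred_fv Y)\<close> by simp
    next
      case (SEmpty Y)
      then show ?case using \<open>\<And>Y. finite (pred_fv Y)\<close> by simp
    }
  qed auto
  moreover have "finite (so_bv \<psi>)"
    by (induction \<psi>) auto
  \<comment> \<open>Avoiding the bound variables as well excludes capture when the decoded relation
    replaces \<open>X\<close>.\<close>
  ultimately obtain X' where X': "X' \<notin> insert X (so_fv \<psi> \<union> so_bv \<psi>)" "sv_arity X' = N + ?n"
    using fresh_sovar[of "insert X (so_fv \<psi> \<union> so_bv \<psi>)" "N + ?n"] by auto
  have X'_var: "logic_var L X'"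
    by (simp add: logic_var_def L)
  let ?dec = "decode ?n N idx D G"
  have D': "D \<subseteq> {\<sigma>. set \<sigma> \<subseteq> {1..w}}"
    using D by blast
  have N0: "N = 0" if "?n = 0"
    using that by (auto simp: N_def mixed_def)
  have "definable (so_qr \<psi>) (insert X' (so_fv \<psi> - {X})) (\<lambda>S a. so_sat \<tau> S (a(X := ?dec S (a X'))) \<psi>)"
    by (rule definable_decoded, rule definable_decode_atom[OF idx D])
      (use X' X'_var False N0 \<psi>(1) in auto)
  then have "definable q (insert X' V) (\<lambda>S a. so_sat \<tau> S (a(X := ?dec S (a X'))) \<psi>)"
    by (rule definable_mono) (use \<psi> in auto)
  from definable_ex[OF X'_var this] show ?thesis
  proof (rule definable_cong)
    fix S :: "('r, 'a) struct" and a :: "'a assignment"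
    assume good: "good V S a"
    have sat: "so_sat \<tau> S ((a(X' := Q))(X := P)) \<psi> \<longleftrightarrow> p S (a(X := P))"
      if "P \<subseteq> tuples (univ S) ?n" for P Q
    proof -
      have "so_sat \<tau> S ((a(X' := Q))(X := P)) \<psi> \<longleftrightarrow> so_sat \<tau> S (a(X := P)) \<psi>"
        by (rule so_sat_cong[OF refl refl \<psi>(1)]) (use X' in auto)
      then show ?thesis
        using \<psi>(4)[OF good_upd[OF good that]] by simp
    qed
    have dec: "?dec S Q \<subseteq> tuples (univ S) ?n" for Q
      by (rule decode_subset[OF idx])
    show "(\<exists>Q\<subseteq>tuples (univ S) (sv_arity X'). guarded \<tau> S Q \<and>
        so_sat \<tau> S ((a(X' := Q))(X := ?dec S ((a(X' := Q)) X'))) \<psi>) \<longleftrightarrow>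
      (\<exists>P\<subseteq>tuples (univ S) ?n. admissible D G S ?n P \<and> p S (a(X := P)))"
    proof
      assume "\<exists>Q\<subseteq>tuples (univ S) (sv_arity X'). guarded \<tau> S Q \<and>
        so_sat \<tau> S ((a(X' := Q))(X := ?dec S ((a(X' := Q)) X'))) \<psi>"
      then obtain Q where Q: "guarded \<tau> S Q" "so_sat \<tau> S ((a(X' := Q))(X := ?dec S Q)) \<psi>"
        by auto
      then show "\<exists>P\<subseteq>tuples (univ S) ?n. admissible D G S ?n P \<and> p S (a(X := P))"
        using admissible_decode[OF idx D' Q(1)] sat[OF dec, of Q] dec
        by (intro exI[of _ "?dec S Q"]) simp
    next
      assume "\<exists>P\<subseteq>tuples (univ S) ?n. admissible D G S ?n P \<and> p S (a(X := P))"
      then obtain P where P: "P \<subseteq> tuples (univ S) ?n" "admissible D G S ?n P" "p S (a(X := P))" by blast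
      obtain Q where Q: "Q \<subseteq> tuples (univ S) (N + ?n)" "guarded \<tau> S Q" "?dec S Q = P"
        using decode_surj[OF idx P(1,2) D'] by metis
      then have "so_sat \<tau> S ((a(X' := Q))(X := ?dec S ((a(X' := Q)) X'))) \<psi>"
        using sat[OF P(1)] P(3) by simp
      then show "\<exists>Q\<subseteq>tuples (univ S) (sv_arity X'). guarded \<tau> S Q \<and>
        so_sat \<tau> S ((a(X' := Q))(X := ?dec S ((a(X' := Q)) X'))) \<psi>"
        using Q X'(2) by (intro exI[of _ Q]) simp
    qed
  qed
qed

section \<open>Composition\<close>

context
  fixes S :: "('r, 'a) struct" and I :: "'i set" and F :: "'i \<Rightarrow> ('r, 'a) struct"
  assumes rooted: "rooted_structure \<tau> w B S" and partition: "rooted_partition \<tau> w B S I F"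
    and nonempty: "I \<noteq> {}"
begin

lemma univ_eq_Union: "univ S = (\<Union>i\<in>I. univ (F i))"
  using partition by (auto simp: rooted_partition_def struct_eq_def struct_Union_def)

lemma rel_eq_Union: "R \<in> syms \<tau> \<Longrightarrow> rel S R = (\<Union>i\<in>I. rel (F i) R)"
  using partition by (auto simp: rooted_partition_def struct_eq_def struct_Union_def)

lemma rel_part: "i \<in> I \<Longrightarrow> R \<in> syms \<tau> \<Longrightarrow> rel (F i) R = rel S R \<inter> tuples (univ (F i)) (ar \<tau> R)"
  using partition by (auto simp: rooted_partition_def induced_substructure_def)

lemma part_Int: "i \<in> I \<Longrightarrow> j \<in> I \<Longrightarrow> i \<noteq> j \<Longrightarrow> univ (F i) \<inter> univ (F j) = roots_of S"
  using partition bag_eq[OF rooted] unfolding rooted_partition_def by metis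

lemma roots_subset_part:
  assumes "i \<in> I"
  shows "roots_of S \<subseteq> univ (F i)"
proof (cases "I = {i}")
  \<comment> \<open>With a single part the condition on intersections is void, but this part has the
    whole universe.\<close>
  case True
  then have "univ (F i) = univ S"
    using univ_eq_Union by simp
  then show ?thesis
    using root_in_univ[OF rooted] by (simp add: image_subset_iff)
next
  case False
  then obtain j where "j \<in> I" "j \<noteq> i"
    using assms by blast
  then show ?thesis
    using part_Int[OF assms, of j] by (metis Int_lower1)
qed

lemma rel_root_part:
  assumes "i \<in> I" "l \<in> {1..w}"
  shows "rel (F i) (B l) = {[root S l]}"
proof -
  have "root S l \<in> univ (F i)"
    using roots_subset_part[OF assms(1)] assms(2) by (metis image_subset_iff)
  then show ?thesis
    using rel_part[OF assms(1)] root_symbol[OF assms(2)] rel_root[OF rooted assms(2)]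
    by (auto simp: tuples_def)
qed

lemma rooted_part: "i \<in> I \<Longrightarrow> rooted_structure \<tau> w B (F i)"
  using partition rel_root_part unfolding rooted_structure_def rooted_partition_def by metis

lemma root_part: "i \<in> I \<Longrightarrow> l \<in> {1..w} \<Longrightarrow> root (F i) l = root S l"
  using rel_root_part[of i l] rel_root[OF rooted_part, of i l] by (metis list.inject singleton_inject)

lemma roots_part: "i \<in> I \<Longrightarrow> roots_of (F i) = roots_of S"
  using root_part by (intro image_cong) auto

lemma gaifman_eq_Union: "gaifman \<tau> S = (\<Union>i\<in>I. gaifman \<tau> (F i))"
  using rel_eq_Union by (auto simp: gaifman_def gaifman_rel_def)

lemma gaifman_part_subset: "gaifman \<tau> (F i) \<subseteq> univ (F i) \<times> univ (F i)" if "i \<in> I"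
  using that partition
  by (fastforce simp: gaifman_def gaifman_rel_def rooted_partition_def structure_over_def tuples_def)

text \<open>An edge comes from a tuple of some part, and an element that is not a root lies in no
  second part.\<close>

lemma adjacent_in_part:
  assumes "(x, y) \<in> gaifman \<tau> S" "i \<in> I" "x \<in> univ (F i)" "x \<notin> roots_of S"
  shows "(x, y) \<in> gaifman \<tau> (F i)" "y \<in> univ (F i)"
proof -
  obtain j where j: "j \<in> I" "(x, y) \<in> gaifman \<tau> (F j)"
    using assms(1) gaifman_eq_Union by blast
  then have "x \<in> univ (F j)" "y \<in> univ (F j)"
    using gaifman_part_subset[OF j(1)] by auto
  moreover from this have "i = j"
    using part_Int[OF assms(2) j(1)] assms(3,4) by (metis IntI)
  ultimately show "(x, y) \<in> gaifman \<tau> (F i)" "y \<in> univ (F i)"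
    using j by auto
qed

text \<open>Guardedness makes the entries of a tuple a clique, and the clique stays within the part
  of any of its non-root entries. Root-only tuples, including the empty one, lie in every part, and
  \<open>nonempty\<close> provides one.\<close>

lemma guarded_in_parts:
  assumes "P \<subseteq> tuples (univ S) n" "guarded \<tau> S P"
  shows "P \<subseteq> (\<Union>i\<in>I. tuples (univ (F i)) n)"
proof
  fix t assume t: "t \<in> P"
  then have t': "set t \<subseteq> univ S" "length t = n"
    using assms(1) by (auto simp: tuples_def)
  show "t \<in> (\<Union>i\<in>I. tuples (univ (F i)) n)"
  proof (cases "set t \<subseteq> roots_of S")
    case True
    then show ?thesis
      using nonempty roots_subset_part t'(2) by (fastforce simp: tuples_def)
  next
    case False
    then obtain x where x: "x \<in> set t" "x \<notin> roots_of S" by blast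
    then obtain i where i: "i \<in> I" "x \<in> univ (F i)"
      using t'(1) univ_eq_Union by blast
    have "y \<in> univ (F i)" if "y \<in> set t" for y
    proof (cases "y = x")
      case False
      then have "(x, y) \<in> gaifman \<tau> S"
        using assms(2) t x(1) that by (auto simp: guarded_def gaifman_rel_def)
      then show ?thesis
        using adjacent_in_part(2) i x(2) by metis
    qed (use i in simp)
    then show ?thesis
      using i(1) t'(2) by (auto simp: tuples_def)
  qed
qed

lemma good_part: "i \<in> I \<Longrightarrow> good V (F i) (restrict_assignment a (univ (F i)))"
  using rooted_part by (simp add: good_def restrict_assignment_def)

lemma pred_val_part:
  "i \<in> I \<Longrightarrow> pred_wf L \<tau> Y \<Longrightarrow> pred_val (F i) (restrict_assignment a (univ (F i))) Y =
     pred_val S a Y \<inter> tuples (univ (F i)) (pred_arity \<tau> Y)"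
  using rel_part by (cases Y) (auto simp: restrict_assignment_def)

end

section \<open>Evaluation of predicates in the parts\<close>

definition config :: "sovar set \<Rightarrow> ('r, 'a) struct \<Rightarrow> 'i set \<Rightarrow> ('i \<Rightarrow> ('r, 'a) struct) \<Rightarrow> 'a assignment \<Rightarrow> bool" where
  "config V S I F a \<longleftrightarrow> I \<noteq> {} \<and> rooted_structure \<tau> w B S \<and> rooted_partition \<tau> w B S I F \<and>
     (\<forall>X\<in>V. a X \<subseteq> (\<Union>i\<in>I. tuples (univ (F i)) (sv_arity X)))"

definition colour :: "(('r, 'a) struct \<Rightarrow> 'a assignment \<Rightarrow> bool) set \<Rightarrow>
    ('i \<Rightarrow> ('r, 'a) struct) \<Rightarrow> 'a assignment \<Rightarrow> 'i \<Rightarrow> (('r, 'a) struct \<Rightarrow> 'a assignment \<Rightarrow> bool) set" where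
  "colour \<Lambda> F a i = {p\<in>\<Lambda>. p (F i) (restrict_assignment a (univ (F i)))}"

lemma finite_colours: "finite \<Lambda> \<Longrightarrow> finite (colour \<Lambda> F a ` I)"
  by (rule finite_subset[of _ "Pow \<Lambda>"]) (auto simp: colour_def)

lemma config_mono: "config V S I F a \<Longrightarrow> U \<subseteq> V \<Longrightarrow> config U S I F a"
  by (auto simp: config_def)

lemma configD:
  assumes "config V S I F a"
  shows "rooted_structure \<tau> w B S" "rooted_partition \<tau> w B S I F" "I \<noteq> {}"
  using assms by (simp_all add: config_def)

text \<open>From guardedness, \<open>config\<close> keeps just the consequence that each tuple of a
  value lies within some part. This suffices to reassemble values from the parts, as in
  \<open>pred_val_config\<close>, and every relation that a quantifier may choose has it.\<close>

lemma config_upd: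
  assumes "config (V - {X}) S I F a" "P \<subseteq> tuples (univ S) (sv_arity X)" "guarded \<tau> S P"
  shows "config V S I F (a(X := P))"
  using assms(1) guarded_in_parts[OF configD[OF assms(1)] assms(2,3)] by (auto simp: config_def)

lemma pred_val_config:
  assumes "config V S I F a" "pred_wf L \<tau> Y" "pred_fv Y \<subseteq> V"
  shows "pred_val S a Y = (\<Union>i\<in>I. pred_val (F i) (restrict_assignment a (univ (F i))) Y)"
proof -
  have "pred_val S a Y \<subseteq> (\<Union>i\<in>I. tuples (univ (F i)) (pred_arity \<tau> Y))"
  proof (cases Y)
    case (Sym R)
    then have R: "R \<in> syms \<tau>" using assms(2) by simp
    then have "rel S R \<subseteq> (\<Union>i\<in>I. tuples (univ (F i)) (ar \<tau> R))"
      using rel_eq_Union[OF configD[OF assms(1)] R] rel_part[OF configD[OF assms(1)] _ R] by auto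
    then show ?thesis using Sym by simp
  next
    case (Var X)
    then show ?thesis using assms by (auto simp: config_def)
  qed
  then show ?thesis
    using pred_val_part[OF configD[OF assms(1)] _ assms(2)] by auto
qed

text \<open>A monadic predicate has the value \<open>{[x]}\<close> iff either \<open>x\<close> is a root, which shows in every part,
  or only one part has a nonempty value.\<close>

lemma so_sat_SElem_parts:
  assumes conf: "config (so_fv (SElem Ys Z)) S I F a" and wf: "so_wf L \<tau> (SElem Ys Z)"
  shows "so_sat \<tau> S a (SElem Ys Z) \<longleftrightarrow>
    (\<exists>i\<in>I. so_sat \<tau> (F i) (restrict_assignment a (univ (F i))) (SElem Ys Z) \<and>
      (\<forall>Y\<in>set Ys.
        (\<exists>l\<in>{1..w}. \<forall>j\<in>I. pred_val (F j) (restrict_assignment a (univ (F j))) Y = {[root (F j) l]}) \<or>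
        (\<forall>j\<in>I. j \<noteq> i \<longrightarrow> pred_val (F j) (restrict_assignment a (univ (F j))) Y = {})))"
proof -
  note c = configD[OF conf]
  let ?v = "\<lambda>i. pred_val (F i) (restrict_assignment a (univ (F i)))"
  have Ys: "pred_wf L \<tau> Y" "pred_arity \<tau> Y = 1" "pred_fv Y \<subseteq> so_fv (SElem Ys Z)" if "Y \<in> set Ys" for Y
    using that wf by auto
  have Z: "pred_wf L \<tau> Z" "pred_arity \<tau> Z = length Ys" "pred_fv Z \<subseteq> so_fv (SElem Ys Z)"
    using wf by auto
  have val: "pred_val S a Y = (\<Union>i\<in>I. ?v i Y)" "\<And>i. i \<in> I \<Longrightarrow> ?v i Y = pred_val S a Y \<inter> tuples (univ (F i)) 1"
    if "Y \<in> set Ys" for Y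
    using pred_val_config[OF conf Ys(1,3)] pred_val_part[OF c _ Ys(1)] Ys(2) that by auto
  have Z_val: "pred_val S a Z = (\<Union>i\<in>I. ?v i Z)" "\<And>i. i \<in> I \<Longrightarrow> ?v i Z = pred_val S a Z \<inter> tuples (univ (F i)) (length Ys)"
    using pred_val_config[OF conf Z(1,3)] pred_val_part[OF c _ Z(1)] Z(2) by auto
  have part: "so_sat \<tau> (F i) (restrict_assignment a (univ (F i))) (SElem Ys Z) \<longleftrightarrow>
      (\<exists>t. length t = length Ys \<and> (\<forall>j<length Ys. ?v i (Ys ! j) = {[t ! j]}) \<and> t \<in> ?v i Z)" if "i \<in> I" for i
    by (rule so_sat_SElem) (use val that in auto)
  have "pred_val S a Y \<subseteq> tuples (univ S) 1" if "Y \<in> set Ys" for Y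
    unfolding val(1)[OF that] using val(2)[OF that] univ_eq_Union[OF c] by (auto simp: tuples_def)
  then have whole: "so_sat \<tau> S a (SElem Ys Z) \<longleftrightarrow>
      (\<exists>t. length t = length Ys \<and> (\<forall>j<length Ys. pred_val S a (Ys ! j) = {[t ! j]}) \<and> t \<in> pred_val S a Z)"
    by (intro so_sat_SElem) auto
  show ?thesis
  proof
    assume "so_sat \<tau> S a (SElem Ys Z)"
    then obtain t where t: "length t = length Ys" "\<And>j. j < length Ys \<Longrightarrow> pred_val S a (Ys ! j) = {[t ! j]}"
        "t \<in> pred_val S a Z"
      using whole by blast
    then obtain i where i: "i \<in> I" "t \<in> ?v i Z"
      using Z_val(1) by blast
    then have t_univ: "set t \<subseteq> univ (F i)"
      using Z_val(2) by (auto simp: tuples_def)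
    have "?v i (Ys ! j) = {[t ! j]}" if j: "j < length Ys" for j
    proof -
      have "t ! j \<in> univ (F i)"
        using t_univ j t(1) nth_mem[of j t] by auto
      then show ?thesis
        using val(2)[OF nth_mem[OF j] i(1)] t(2)[OF j] by (simp add: tuples_def)
    qed
    then have "so_sat \<tau> (F i) (restrict_assignment a (univ (F i))) (SElem Ys Z)"
      using part i t(1) by blast
    moreover have "(\<exists>l\<in>{1..w}. \<forall>j\<in>I. ?v j Y = {[root (F j) l]}) \<or> (\<forall>j\<in>I. j \<noteq> i \<longrightarrow> ?v j Y = {})"
      if Y: "Y \<in> set Ys" for Y
    proof -
      obtain k where k: "k < length Ys" "Y = Ys ! k"
        using Y by (auto simp: in_set_conv_nth)
      have Yval: "pred_val S a Y = {[t ! k]}"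
        using t(2) k by simp
      have tk: "t ! k \<in> univ (F i)"
        using t_univ k(1) t(1) nth_mem[of k t] by auto
      show ?thesis
      proof (cases "t ! k \<in> roots_of S")
        case True
        then obtain l where l: "l \<in> {1..w}" "t ! k = root S l" by (rule imageE)
        have "?v j Y = {[root (F j) l]}" if j: "j \<in> I" for j
        proof -
          have "root S l \<in> univ (F j)"
            using roots_subset_part[OF c j] l(1) by (metis image_subset_iff)
          then show ?thesis
            using val(2)[OF Y j] Yval l root_part[OF c j l(1)] by (auto simp: tuples_def)
        qed
        then show ?thesis using l(1) by blast
      next
        case False
        have "?v j Y = {}" if j: "j \<in> I" "j \<noteq> i" for j
        proof -
          have "t ! k \<notin> univ (F j)"
            using part_Int[OF c j(1) i(1) j(2)] tk False by (metis IntI)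
          then show ?thesis
            using val(2)[OF Y j(1)] Yval by (auto simp: tuples_def)
        qed
        then show ?thesis by blast
      qed
    qed
    ultimately show "\<exists>i\<in>I. so_sat \<tau> (F i) (restrict_assignment a (univ (F i))) (SElem Ys Z) \<and>
      (\<forall>Y\<in>set Ys. (\<exists>l\<in>{1..w}. \<forall>j\<in>I. ?v j Y = {[root (F j) l]}) \<or> (\<forall>j\<in>I. j \<noteq> i \<longrightarrow> ?v j Y = {}))"
      using i(1) by metis
  next
    assume "\<exists>i\<in>I. so_sat \<tau> (F i) (restrict_assignment a (univ (F i))) (SElem Ys Z) \<and>
      (\<forall>Y\<in>set Ys. (\<exists>l\<in>{1..w}. \<forall>j\<in>I. ?v j Y = {[root (F j) l]}) \<or> (\<forall>j\<in>I. j \<noteq> i \<longrightarrow> ?v j Y = {}))"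
    then obtain i where i: "i \<in> I" "so_sat \<tau> (F i) (restrict_assignment a (univ (F i))) (SElem Ys Z)"
      and alt: "\<And>Y. Y \<in> set Ys \<Longrightarrow>
        (\<exists>l\<in>{1..w}. \<forall>j\<in>I. ?v j Y = {[root (F j) l]}) \<or> (\<forall>j\<in>I. j \<noteq> i \<longrightarrow> ?v j Y = {})"
      by metis
    obtain t where t: "length t = length Ys" "\<And>j. j < length Ys \<Longrightarrow> ?v i (Ys ! j) = {[t ! j]}" "t \<in> ?v i Z"
      using part[OF i(1)] i(2) by metis
    have "pred_val S a (Ys ! k) = {[t ! k]}" if k: "k < length Ys" for k
    proof -
      have Y: "Ys ! k \<in> set Ys" using k by simp
      have "?v j (Ys ! k) \<subseteq> ?v i (Ys ! k)" if j: "j \<in> I" for j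
        using alt[OF Y]
      proof
        assume "\<exists>l\<in>{1..w}. \<forall>j\<in>I. ?v j (Ys ! k) = {[root (F j) l]}"
        then obtain l where l: "l \<in> {1..w}" "\<forall>j\<in>I. ?v j (Ys ! k) = {[root (F j) l]}"
          by (elim bexE)
        then show ?thesis
          using root_part[OF c j l(1)] root_part[OF c i(1) l(1)] i(1) j by simp
      next
        assume "\<forall>j\<in>I. j \<noteq> i \<longrightarrow> ?v j (Ys ! k) = {}"
        then show ?thesis using j by (cases "j = i") auto
      qed
      then have "pred_val S a (Ys ! k) = ?v i (Ys ! k)"
        using val(1)[OF Y] i(1) by blast
      then show ?thesis using t(2)[OF k] by simp
    qed
    moreover have "t \<in> pred_val S a Z"
      using t(3) Z_val(1) i(1) by blast
    ultimately show "so_sat \<tau> S a (SElem Ys Z)"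
      using whole t(1) by blast
  qed
qed

text \<open>Comparing two arbitrary partitions avoids saying how truth depends on the counts. One
  implication is enough because the situation is symmetric. The \<open>itself\<close> argument fixes
  the type of index sets, which \<open>\<Lambda>\<close> does not mention.\<close>

definition determines ::
    "'i itself \<Rightarrow> (('r, 'a) struct \<Rightarrow> 'a assignment \<Rightarrow> bool) set \<Rightarrow> nat \<Rightarrow> 'r so \<Rightarrow> bool" where
  "determines (_ :: 'i itself) \<Lambda> N \<Phi> \<longleftrightarrow> (\<forall>S (I :: 'i set) F a S' (I' :: 'i set) F' a'.
     config (so_fv \<Phi>) S I F a \<longrightarrow> config (so_fv \<Phi>) S' I' F' a' \<longrightarrow>
     same_counts N I (colour \<Lambda> F a) I' (colour \<Lambda> F' a') \<longrightarrow> so_sat \<tau> S a \<Phi> \<longrightarrow> so_sat \<tau> S' a' \<Phi>)"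

lemma determinesD:
  fixes I I' :: "'i set"
  assumes "determines TYPE('i) \<Lambda> N \<Phi>" "config (so_fv \<Phi>) S I F a" "config (so_fv \<Phi>) S' I' F' a'"
    and "same_counts N I (colour \<Lambda> F a) I' (colour \<Lambda> F' a')"
  shows "so_sat \<tau> S a \<Phi> \<longleftrightarrow> so_sat \<tau> S' a' \<Phi>"
  using assms same_counts_sym[OF assms(4)] unfolding determines_def by meson

lemma determines_mono:
  assumes "determines TYPE('i) \<Lambda> N \<Phi>" "\<Lambda> \<subseteq> \<Lambda>'" "N \<le> N'" "finite \<Lambda>'"
  shows "determines TYPE('i) \<Lambda>' N' \<Phi>"
  unfolding determines_def
proof (intro allI impI)
  fix S S' :: "('r, 'a) struct" and I I' :: "'i set" and F F' a a'
  assume c: "config (so_fv \<Phi>) S I F a" "config (so_fv \<Phi>) S' I' F' a'"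
    and same: "same_counts N' I (colour \<Lambda>' F a) I' (colour \<Lambda>' F' a')"
    and sat: "so_sat \<tau> S a \<Phi>"
  have "same_counts N' I (colour \<Lambda> F a) I' (colour \<Lambda> F' a')"
    by (rule same_counts_coarsen[OF same, where g = "\<lambda>v. v \<inter> \<Lambda>"])
      (use assms(2) finite_colours[OF assms(4)] in \<open>auto simp: colour_def\<close>)
  then have "same_counts N I (colour \<Lambda> F a) I' (colour \<Lambda> F' a')"
    using same_counts_mono assms(3) by blast
  from determinesD[OF assms(1) c this] sat show "so_sat \<tau> S' a' \<Phi>" by simp
qed

text \<open>Adjacency of roots needs no quantified elements: a pair is guarded if it lies in some guarded
  binary relation.\<close>

definition edge :: "nat \<Rightarrow> nat \<Rightarrow> ('r, 'a) struct \<Rightarrow> 'a assignment \<Rightarrow> bool" where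
  "edge l l' S a \<longleftrightarrow> root S l = root S l' \<or> (root S l, root S l') \<in> gaifman \<tau> S"

lemma guarded_edge:
  assumes "guarded \<tau> S P" "t \<in> P" "root S l \<in> set t" "root S l' \<in> set t"
  shows "edge l l' S a"
proof (cases "root S l = root S l'")
  case False
  then have "(root S l, root S l') \<in> gaifman_rel P"
    using assms(2-4) unfolding gaifman_rel_def by blast
  then show ?thesis
    using assms(1) by (auto simp: edge_def guarded_def)
qed (simp add: edge_def)

lemma definable_edge:
  assumes "L = GSO" "l \<in> {1..w}" "l' \<in> {1..w}"
  shows "definable (Suc q) V (edge l l' :: ('r, 'a) struct \<Rightarrow> 'a assignment \<Rightarrow> bool)"
proof -
  let ?X = "SOVar 0 2" and ?Ys = "[Sym (B l), Sym (B l')] :: 'r pred list"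
  have "definable q (insert ?X V) (\<lambda>(S :: ('r, 'a) struct) a. \<exists>t. length t = length ?Ys \<and>
      (\<forall>j<length ?Ys. pred_val S a (?Ys ! j) = {[t ! j]}) \<and> t \<in> pred_val S a (Var ?X))"
    by (rule definable_SElem) (use assms root_symbol in \<open>auto simp: logic_var_def\<close>)
  then have "definable (Suc q) V (\<lambda>(S :: ('r, 'a) struct) a. \<exists>P\<subseteq>tuples (univ S) (sv_arity ?X).
      guarded \<tau> S P \<and> (\<exists>t. length t = length ?Ys \<and>
      (\<forall>j<length ?Ys. pred_val S (a(?X := P)) (?Ys ! j) = {[t ! j]}) \<and> t \<in> pred_val S (a(?X := P)) (Var ?X)))"
    by (rule definable_ex[rotated]) (simp add: assms(1) logic_var_def)
  then show ?thesis
  proof (rule definable_cong)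
    fix S :: "('r, 'a) struct" and a :: "'a assignment"
    assume "good V S a"
    then have rooted: "rooted_structure \<tau> w B S" by (simp add: good_def)
    have t: "length t = length ?Ys \<and> (\<forall>j<length ?Ys. pred_val S (a(?X := P)) (?Ys ! j) = {[t ! j]}) \<and>
        t \<in> pred_val S (a(?X := P)) (Var ?X) \<longleftrightarrow> t = [root S l, root S l'] \<and> t \<in> P" for t P
    proof (cases "length t = 2")
      case True
      then obtain x y where "t = [x, y]"
        by (auto simp: numeral_2_eq_2 length_Suc_conv)
      then show ?thesis
        by (auto simp: rel_root[OF rooted assms(2)] rel_root[OF rooted assms(3)] All_less_Suc2)
    qed auto
    have "(\<exists>P\<subseteq>tuples (univ S) 2. guarded \<tau> S P \<and> [root S l, root S l'] \<in> P) \<longleftrightarrow> edge l l' S a"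
    proof
      assume "\<exists>P\<subseteq>tuples (univ S) 2. guarded \<tau> S P \<and> [root S l, root S l'] \<in> P"
      then show "edge l l' S a"
        using guarded_edge[of S _ "[root S l, root S l']"] by auto
    next
      assume "edge l l' S a"
      then have "guarded \<tau> S {[root S l, root S l']}"
        using gaifman_sym by (auto simp: edge_def guarded_def gaifman_rel_def)
      moreover have "{[root S l, root S l']} \<subseteq> tuples (univ S) 2"
        using root_in_univ[OF rooted] assms by (simp add: tuples_def)
      ultimately show "\<exists>P\<subseteq>tuples (univ S) 2. guarded \<tau> S P \<and> [root S l, root S l'] \<in> P"
        by blast
    qed
    then show "(\<exists>P\<subseteq>tuples (univ S) (sv_arity ?X).
      guarded \<tau> S P \<and> (\<exists>t. length t = length ?Ys \<and>
      (\<forall>j<length ?Ys. pred_val S (a(?X := P)) (?Ys ! j) = {[t ! j]}) \<and> t \<in> pred_val S (a(?X := P)) (Var ?X)))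
      \<longleftrightarrow> edge l l' S a"
      unfolding t by simp
  qed
qed

lemma edge_parts:
  assumes "config V S I F a" "l \<in> {1..w}" "l' \<in> {1..w}"
  shows "edge l l' S a \<longleftrightarrow> (\<exists>i\<in>I. edge l l' (F i) (restrict_assignment a (univ (F i))))"
proof -
  note c = configD[OF assms(1)]
  have "edge l l' (F i) b \<longleftrightarrow> root S l = root S l' \<or> (root S l, root S l') \<in> gaifman \<tau> (F i)"
    if "i \<in> I" for i b
    using root_part[OF c that] assms(2,3) by (simp add: edge_def)
  then show ?thesis
    using gaifman_eq_Union[OF c] c(3) by (auto simp: edge_def)
qed

section \<open>Answering a quantifier part by part\<close>

definition simulate ::
    "nat list set \<Rightarrow> (nat \<times> nat) set \<Rightarrow> sovar \<Rightarrow> (('r, 'a) struct \<Rightarrow> 'a assignment \<Rightarrow> bool) set \<Rightarrow>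
      (('r, 'a) struct \<Rightarrow> 'a assignment \<Rightarrow> bool) set \<Rightarrow> ('r, 'a) struct \<Rightarrow> 'a assignment \<Rightarrow> bool" where
  "simulate D G X \<Lambda> v S a \<longleftrightarrow> (\<exists>P\<subseteq>tuples (univ S) (sv_arity X).
     admissible D G S (sv_arity X) P \<and> {p\<in>\<Lambda>. p S (a(X := P))} = v)"

abbreviation root_patterns :: "nat \<Rightarrow> nat list set" where
  "root_patterns n \<equiv> {\<sigma>. set \<sigma> \<subseteq> {1..w} \<and> length \<sigma> = n}"

text \<open>A \<open>simulate\<close> colour says that a part can produce the new colour
  \<open>v\<close> under the guesses \<open>D\<close> and \<open>G\<close>. The guesses depend on
  the relation chosen for \<open>X\<close>, so all of them are offered. The edge colours reveal
  which pairs in \<open>G\<close> are real; expressing them takes a binary variable, hence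
  GSO.\<close>

definition ex_colours :: "sovar \<Rightarrow> (('r, 'a) struct \<Rightarrow> 'a assignment \<Rightarrow> bool) set \<Rightarrow>
    (('r, 'a) struct \<Rightarrow> 'a assignment \<Rightarrow> bool) set" where
  "ex_colours X \<Lambda> = (\<lambda>(D, G, v). simulate D G X \<Lambda> v) `
      (Pow (root_patterns (sv_arity X)) \<times> Pow ({1..w} \<times> {1..w}) \<times> Pow \<Lambda>) \<union>
    (if L = GSO then (\<lambda>(l, l'). edge l l') ` ({1..w} \<times> {1..w}) else {})"

lemma finite_ex_colours: "finite \<Lambda> \<Longrightarrow> finite (ex_colours X \<Lambda>)"
  using finite_lists_length_eq[of "{1..w}" "sv_arity X"] by (simp add: ex_colours_def)

lemma definable_ex_colours:
  fixes \<Lambda> :: "(('r, 'a) struct \<Rightarrow> 'a assignment \<Rightarrow> bool) set"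
  assumes X: "logic_var L X" and "finite \<Lambda>" "\<And>p. p \<in> \<Lambda> \<Longrightarrow> definable q (insert X V) p"
    and p\<^sub>0: "definable q (insert X V) (p\<^sub>0 :: ('r, 'a) struct \<Rightarrow> 'a assignment \<Rightarrow> bool)"
    and "p \<in> ex_colours X \<Lambda>"
  shows "definable (Suc q) V p"
proof -
  have "definable (Suc q) V (simulate D G X \<Lambda> v)" if "D \<subseteq> root_patterns (sv_arity X)" "v \<subseteq> \<Lambda>" for D G v
    unfolding simulate_def[abs_def]
    by (rule definable_ex_admissible[OF X definable_colour[OF assms(2) p\<^sub>0 assms(3) that(2)] that(1)])
  then show ?thesis
    using assms(5) definable_edge by (auto simp: ex_colours_def split: if_splits simp del: One_nat_def atLeastAtMost_iff)
qed

text \<open>The trace of \<open>P\<close> on the part is the witness. An edge of the whole structure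
  at a non-root entry already belongs to the part, while pairs of roots in a tuple of
  \<open>P\<close> are edges of the whole structure and so lie in \<open>G\<close>.\<close>

lemma simulate_part:
  assumes conf: "config V S I F a" and X: "logic_var L X"
    and P: "P \<subseteq> tuples (univ S) (sv_arity X)" "guarded \<tau> S P"
    and G: "\<And>l l'. L = GSO \<Longrightarrow> l \<in> {1..w} \<Longrightarrow> l' \<in> {1..w} \<Longrightarrow> edge l l' S a \<Longrightarrow> (l, l') \<in> G"
    and i: "i \<in> I"
  shows "simulate {\<sigma>\<in>root_patterns (sv_arity X). map (root S) \<sigma> \<in> P} G X \<Lambda> (colour \<Lambda> F (a(X := P)) i)
    (F i) (restrict_assignment a (univ (F i)))"
proof -
  note c = configD[OF conf]
  let ?n = "sv_arity X" and ?Q = "P \<inter> tuples (univ (F i)) (sv_arity X)"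
  let ?D = "{\<sigma>\<in>root_patterns ?n. map (root S) \<sigma> \<in> P}"
  have map_root: "map (root (F i)) \<sigma> = map (root S) \<sigma>" if "set \<sigma> \<subseteq> {1..w}" for \<sigma>
    using that root_part[OF c i] by (intro map_cong) auto
  have D_iff: "t \<in> map (root (F i)) ` ?D \<longleftrightarrow> t \<in> P" if "set t \<subseteq> roots_of S" "length t = ?n" for t
  proof
    assume "t \<in> map (root (F i)) ` ?D"
    then obtain \<sigma> where "\<sigma> \<in> ?D" "t = map (root (F i)) \<sigma>" by blast
    then show "t \<in> P" using map_root[of \<sigma>] by simp
  next
    assume t: "t \<in> P"
    have "\<forall>x\<in>set t. \<exists>l. l \<in> {1..w} \<and> x = root S l"
      using that(1) by blast
    then obtain f where f: "\<And>x. x \<in> set t \<Longrightarrow> f x \<in> {1..w} \<and> x = root S (f x)" by metis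
    then have f': "set (map f t) \<subseteq> {1..w}" by auto
    moreover have "map (root S) (map f t) = t"
      using f by (simp add: map_idI)
    ultimately show "t \<in> map (root (F i)) ` ?D"
      using t that(2) map_root[OF f'] by (intro image_eqI[of _ _ "map f t"]) simp_all
  qed
  have adm: "admissible ?D G (F i) ?n ?Q"
    unfolding admissible_def roots_part[OF c i]
  proof (intro conjI ballI impI)
    fix t assume "t \<in> tuples (univ (F i)) ?n" "set t \<subseteq> roots_of S"
    then show "t \<in> ?Q \<longleftrightarrow> t \<in> map (root (F i)) ` ?D"
      using D_iff[of t] by (simp add: tuples_def)
  next
    fix t assume t: "t \<in> ?Q" "\<not> set t \<subseteq> roots_of S"
    then have t': "t \<in> P" "set t \<subseteq> univ (F i)" "length t = ?n" by (auto simp: tuples_def)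
    show "(x, y) \<in> gaifman \<tau> (F i)" if xy: "x \<in> set t" "y \<in> set t" "x \<noteq> y"
        "\<not> (x \<in> roots_of S \<and> y \<in> roots_of S)" for x y
    proof -
      have "(x, y) \<in> gaifman \<tau> S"
        using P(2) t'(1) xy(1-3) by (auto simp: guarded_def gaifman_rel_def)
      then show ?thesis
        using xy t'(2) adjacent_in_part(1)[OF c _ i, of x y] adjacent_in_part(1)[OF c _ i, of y x]
          gaifman_sym by (metis subsetD)
    qed
    show "names_guarded G (F i) t"
      unfolding names_guarded_def
    proof (intro ballI impI)
      fix l l' assume l: "l \<in> {1..w}" "l' \<in> {1..w}" "root (F i) l \<in> set t" "root (F i) l' \<in> set t"
      have "root S l \<in> set t" "root S l' \<in> set t"
        using l root_part[OF c i] by simp_all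
      \<comment> \<open>A tuple with both a root and a non-root entry cannot be monadic.\<close>
      moreover have "L = GSO"
      proof (rule ccontr)
        assume "L \<noteq> GSO"
        then have "?n = 1" using X by (cases L) (auto simp: logic_var_def)
        then obtain x where "t = [x]"
          using t'(3) by (auto simp: length_Suc_conv)
        then have "set t \<subseteq> roots_of S"
          using \<open>root S l \<in> set t\<close> imageI[OF l(1), of "root S"] by simp
        with t(2) show False by contradiction
      qed
      ultimately show "(l, l') \<in> G"
        using G l(1,2) guarded_edge[OF P(2) t'(1)] by metis
    qed
  qed
  show ?thesis
    unfolding simulate_def
    by (rule exI[of _ ?Q]) (use adm in \<open>simp add: colour_def restrict_assignment_upd\<close>)
qed

text \<open>The union of the local relations restricts to each of them: two parts share only
  root-only tuples, and on these all parts follow the same \<open>D\<close>. It is guarded because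
  pairs with a non-root entry are adjacent within a part and pairs of roots are granted by
  \<open>G\<close>; for the tuples of \<open>D\<close> this is ensured by
  \<open>D_G\<close>.\<close>

lemma simulate_glue:
  assumes conf: "config V S I F a" and X: "logic_var L X"
    and D: "D \<subseteq> root_patterns (sv_arity X)"
    and D_G: "\<And>\<sigma> l l'. L = GSO \<Longrightarrow> \<sigma> \<in> D \<Longrightarrow> l \<in> set \<sigma> \<Longrightarrow> l' \<in> set \<sigma> \<Longrightarrow> (l, l') \<in> G"
    and G: "\<And>l l'. L = GSO \<Longrightarrow> l \<in> {1..w} \<Longrightarrow> l' \<in> {1..w} \<Longrightarrow> (l, l') \<in> G \<Longrightarrow> edge l l' S a"
    and sim: "\<And>i. i \<in> I \<Longrightarrow> simulate D G X \<Lambda> (c i) (F i) (restrict_assignment a (univ (F i)))"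
  shows "\<exists>P\<subseteq>tuples (univ S) (sv_arity X). guarded \<tau> S P \<and> (\<forall>i\<in>I. colour \<Lambda> F (a(X := P)) i = c i)"
proof -
  note c = configD[OF conf]
  let ?n = "sv_arity X"
  have "\<forall>i\<in>I. \<exists>Q\<subseteq>tuples (univ (F i)) ?n. admissible D G (F i) ?n Q \<and>
      {p\<in>\<Lambda>. p (F i) ((restrict_assignment a (univ (F i)))(X := Q))} = c i"
    using sim by (simp add: simulate_def)
  from bchoice[OF this] obtain Q where "\<forall>i\<in>I. Q i \<subseteq> tuples (univ (F i)) ?n \<and> admissible D G (F i) ?n (Q i) \<and>
      {p\<in>\<Lambda>. p (F i) ((restrict_assignment a (univ (F i)))(X := Q i))} = c i" ..
  then have Q: "\<And>i. i \<in> I \<Longrightarrow> Q i \<subseteq> tuples (univ (F i)) ?n"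
      "\<And>i. i \<in> I \<Longrightarrow> admissible D G (F i) ?n (Q i)"
      "\<And>i. i \<in> I \<Longrightarrow> {p\<in>\<Lambda>. p (F i) ((restrict_assignment a (univ (F i)))(X := Q i))} = c i"
    by simp_all
  define P where "P = (\<Union>i\<in>I. Q i)"
  have map_root: "map (root (F i)) ` D = map (root S) ` D" if "i \<in> I" for i
  proof (rule image_cong[OF refl])
    fix \<sigma> assume "\<sigma> \<in> D"
    then have "set \<sigma> \<subseteq> {1..w}" using D by blast
    then show "map (root (F i)) \<sigma> = map (root S) \<sigma>"
      using root_part[OF c that] by (intro map_cong) auto
  qed
  have all_roots: "t \<in> Q i \<longleftrightarrow> t \<in> map (root S) ` D"
    if "i \<in> I" "t \<in> tuples (univ (F i)) ?n" "set t \<subseteq> roots_of S" for i t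
    using Q(2)[OF that(1)] that(2,3) unfolding admissible_def roots_part[OF c that(1)] map_root[OF that(1)]
    by metis
  have P_part: "P \<inter> tuples (univ (F i)) ?n = Q i" if i: "i \<in> I" for i
  proof
    show "Q i \<subseteq> P \<inter> tuples (univ (F i)) ?n"
      using Q(1)[OF i] i by (auto simp: P_def)
    show "P \<inter> tuples (univ (F i)) ?n \<subseteq> Q i"
    proof
      fix t assume t: "t \<in> P \<inter> tuples (univ (F i)) ?n"
      then obtain j where j: "j \<in> I" "t \<in> Q j" by (auto simp: P_def)
      show "t \<in> Q i"
      proof (cases "j = i")
        case False
        have tj: "t \<in> tuples (univ (F j)) ?n" using Q(1)[OF j(1)] j(2) by blast
        then have "set t \<subseteq> roots_of S"
          using part_Int[OF c j(1) i False] t by (metis Int_iff Int_subset_iff mem_Collect_eq tuples_def)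
        then show ?thesis
          using all_roots[OF j(1) tj] all_roots[OF i] t j(2) by simp
      qed (use j in simp)
    qed
  qed
  have "P \<subseteq> tuples (univ S) ?n"
    using Q(1) univ_eq_Union[OF c] by (fastforce simp: P_def tuples_def)
  moreover have "guarded \<tau> S P"
  proof (cases "L = GSO")
    case False
    then have "?n = 1" using X by (cases L) (auto simp: logic_var_def)
    then show ?thesis
      using monadic_guarded calculation by metis
  next
    case GSO: True
    show ?thesis
      unfolding guarded_def
    proof (rule subrelI)
      fix x y assume "(x, y) \<in> gaifman_rel P"
      then obtain t where xy: "x \<noteq> y" "x \<in> set t" "y \<in> set t" and "t \<in> P"
        by (auto simp: gaifman_rel_def)
      then obtain i where i: "i \<in> I" "t \<in> Q i" by (auto simp: P_def)
      have t: "t \<in> tuples (univ (F i)) ?n" using Q(1)[OF i(1)] i(2) by blast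
      have names: "(root S l, root S l') \<in> gaifman \<tau> S"
        if "l \<in> {1..w}" "l' \<in> {1..w}" "x = root S l" "y = root S l'" "(l, l') \<in> G" for l l'
        using G[OF GSO that(1,2,5)] xy(1) that(3,4) by (simp add: edge_def)
      show "(x, y) \<in> gaifman \<tau> S"
      proof (cases "set t \<subseteq> roots_of S")
        case True
        then obtain \<sigma> where \<sigma>: "\<sigma> \<in> D" "t = map (root S) \<sigma>"
          using all_roots[OF i(1) t] i(2) by (metis imageE)
        then obtain l l' where l: "l \<in> set \<sigma>" "l' \<in> set \<sigma>" "x = root S l" "y = root S l'"
          using xy(2,3) by auto
        then have "l \<in> {1..w}" "l' \<in> {1..w}"
          using D \<sigma>(1) by blast+
        then show ?thesis
          using names[OF _ _ l(3,4) D_G[OF GSO \<sigma>(1) l(1,2)]] l(3,4) by simp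
      next
        case False
        then have adm: "x \<noteq> y \<longrightarrow> \<not> (x \<in> roots_of S \<and> y \<in> roots_of S) \<longrightarrow> (x, y) \<in> gaifman \<tau> (F i)"
          "names_guarded G (F i) t"
          using Q(2)[OF i(1)] i(2) xy(2,3) unfolding admissible_def roots_part[OF c i(1)] by metis+
        show ?thesis
        proof (cases "x \<in> roots_of S \<and> y \<in> roots_of S")
          case True
          then obtain l l' where l: "l \<in> {1..w}" "l' \<in> {1..w}" "x = root S l" "y = root S l'"
            by (elim conjE imageE)
          then have "(l, l') \<in> G"
            using adm(2) xy(2,3) root_part[OF c i(1)] unfolding names_guarded_def by metis
          then show ?thesis using names[OF l] l(3,4) by simp
        next
          case False
          then show ?thesis
            using adm(1) xy(1) gaifman_eq_Union[OF c] i(1) by blast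
        qed
      qed
    qed
  qed
  moreover have "colour \<Lambda> F (a(X := P)) i = c i" if "i \<in> I" for i
    using Q(3)[OF that] by (simp add: colour_def restrict_assignment_upd P_part[OF that])
  ultimately show ?thesis by blast
qed

text \<open>One round of an Ehrenfeucht-Fraisse game. The relation \<open>P\<close> yields the
  guesses \<open>D\<close> and \<open>G\<close> and a new colour in \<open>Pow \<Lambda>\<close> for
  each part; \<open>same_counts_extend\<close> copies the new colours to the other partition,
  matched with the old ones. Because an old colour records which new ones can be simulated under
  \<open>D\<close> and \<open>G\<close>, \<open>simulate_glue\<close> realises the copy by a guarded
  relation.\<close>

lemma determines_SEx:
  fixes \<Lambda> :: "(('r, 'a) struct \<Rightarrow> 'a assignment \<Rightarrow> bool) set"
  assumes det: "determines TYPE('i) \<Lambda> N \<phi>" and fin: "finite \<Lambda>" and N: "1 \<le> N" and X: "logic_var L X"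
  shows "determines TYPE('i) (ex_colours X \<Lambda>) (N * card (Pow \<Lambda>)) (SEx X \<phi>)"
  unfolding determines_def
proof (intro allI impI)
  fix S S' :: "('r, 'a) struct" and I I' :: "'i set" and F F' and a a' :: "'a assignment"
  let ?\<Lambda> = "ex_colours X \<Lambda>" and ?N = "N * card (Pow \<Lambda>)" and ?n = "sv_arity X"
  assume conf: "config (so_fv (SEx X \<phi>)) S I F a" "config (so_fv (SEx X \<phi>)) S' I' F' a'"
    and same: "same_counts ?N I (colour ?\<Lambda> F a) I' (colour ?\<Lambda> F' a')"
    and "so_sat \<tau> S a (SEx X \<phi>)"
  then obtain P where P: "P \<subseteq> tuples (univ S) ?n" "guarded \<tau> S P" "so_sat \<tau> S (a(X := P)) \<phi>"
    by auto
  have N': "1 \<le> ?N"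
    using N fin by (simp add: card_Pow)
  define D where "D = {\<sigma>\<in>root_patterns ?n. map (root S) \<sigma> \<in> P}"
  define G where "G = {(l, l') \<in> {1..w} \<times> {1..w}. edge l l' S a}"
  \<comment> \<open>A pair of roots is an edge iff some part has the corresponding colour, and a
    threshold of at least 1 preserves the occurrence of colours.\<close>
  have G': "edge l l' S' a'" if l: "L = GSO" "l \<in> {1..w}" "l' \<in> {1..w}" "(l, l') \<in> G" for l l'
  proof -
    have "edge l l' \<in> ?\<Lambda>"
    proof -
      have "edge l l' \<in> (\<lambda>(l, l'). edge l l') ` ({1..w} \<times> {1..w})"
        by (rule image_eqI[of _ _ "(l, l')"]) (use l in simp_all)
      then show ?thesis
        unfolding ex_colours_def if_P[OF l(1)] by (rule UnI2)
    qed
    then have iff: "edge l l' (H i) (restrict_assignment b (univ (H i))) \<longleftrightarrow> edge l l' \<in> colour ?\<Lambda> H b i"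
      for H :: "'i \<Rightarrow> ('r, 'a) struct" and b i
      by (simp add: colour_def)
    have "edge l l' S a"
      using l(4) by (simp add: G_def)
    then obtain i where "i \<in> I" "edge l l' \<in> colour ?\<Lambda> F a i"
      using edge_parts[OF conf(1) l(2,3)] iff by blast
    then show ?thesis
      using edge_parts[OF conf(2) l(2,3)] iff same_counts_ex[OF same N'] by metis
  qed
  let ?c = "colour \<Lambda> F (a(X := P))"
  have sim_in: "simulate D G X \<Lambda> v \<in> ?\<Lambda>" if "v \<subseteq> \<Lambda>" for v
  proof -
    have "(D, G, v) \<in> Pow (root_patterns ?n) \<times> Pow ({1..w} \<times> {1..w}) \<times> Pow \<Lambda>"
      using that by (auto simp: D_def G_def)
    from imageI[OF this, of "\<lambda>(D, G, v). simulate D G X \<Lambda> v"] show ?thesis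
      unfolding ex_colours_def by simp
  qed
  have sim: "simulate D G X \<Lambda> (?c i) \<in> colour ?\<Lambda> F a i" if "i \<in> I" for i
  proof -
    have "simulate D G X \<Lambda> (?c i) (F i) (restrict_assignment a (univ (F i)))"
      unfolding D_def by (rule simulate_part[OF conf(1) X P(1,2) _ that]) (simp add: G_def)
    then show ?thesis
      using sim_in[of "?c i"] by (simp add: colour_def)
  qed
  obtain c' where c': "c' ` I' \<subseteq> Pow \<Lambda>"
      "same_counts N I (\<lambda>i. (colour ?\<Lambda> F a i, ?c i)) I' (\<lambda>i. (colour ?\<Lambda> F' a' i, c' i))"
    using same_counts_extend[OF same, of ?c] fin by (auto simp: colour_def)
  have "\<exists>Q\<subseteq>tuples (univ S') ?n. guarded \<tau> S' Q \<and> (\<forall>i\<in>I'. colour \<Lambda> F' (a'(X := Q)) i = c' i)"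
  proof (rule simulate_glue[OF conf(2) X _ _ G'])
    show "D \<subseteq> root_patterns ?n" by (auto simp: D_def)
    show "(l, l') \<in> G" if "\<sigma> \<in> D" "l \<in> set \<sigma>" "l' \<in> set \<sigma>" for \<sigma> l l'
    proof -
      have "map (root S) \<sigma> \<in> P" "set \<sigma> \<subseteq> {1..w}"
        using that(1) by (simp_all add: D_def)
      then have "edge l l' S a" "l \<in> {1..w}" "l' \<in> {1..w}"
        using guarded_edge[OF P(2), of "map (root S) \<sigma>"] that(2,3) by auto
      then show ?thesis by (simp add: G_def)
    qed
    fix i' assume i': "i' \<in> I'"
    obtain i where "i \<in> I" "colour ?\<Lambda> F a i = colour ?\<Lambda> F' a' i'" "?c i = c' i'"
      using same_counts_ex[OF same_counts_sym[OF c'(2)] N i'] by auto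
    then have "simulate D G X \<Lambda> (c' i') \<in> colour ?\<Lambda> F' a' i'"
      using sim by metis
    then show "simulate D G X \<Lambda> (c' i') (F' i') (restrict_assignment a' (univ (F' i')))"
      by (simp add: colour_def)
  qed
  then obtain Q where Q: "Q \<subseteq> tuples (univ S') ?n" "guarded \<tau> S' Q"
      "\<And>i. i \<in> I' \<Longrightarrow> colour \<Lambda> F' (a'(X := Q)) i = c' i" by blast
  have fins: "finite ((\<lambda>i. (colour ?\<Lambda> F a i, ?c i)) ` I)" "finite ((\<lambda>i. (colour ?\<Lambda> F' a' i, c' i)) ` I')"
    by (rule finite_subset[of _ "Pow ?\<Lambda> \<times> Pow \<Lambda>"]; use c'(1) fin finite_ex_colours in \<open>auto simp: colour_def\<close>)+
  have "same_counts N I ?c I' (colour \<Lambda> F' (a'(X := Q)))"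
    by (rule same_counts_coarsen[OF c'(2) fins, where g = snd]) (use Q(3) in simp_all)
  moreover have "config (so_fv \<phi>) S I F (a(X := P))" "config (so_fv \<phi>) S' I' F' (a'(X := Q))"
    using config_upd conf P(1,2) Q(1,2) by (metis so_fv.simps(5))+
  ultimately have "so_sat \<tau> S' (a'(X := Q)) \<phi>"
    using determinesD[OF det] P(3) by blast
  then show "so_sat \<tau> S' a' (SEx X \<phi>)"
    using Q(1,2) by auto
qed

section \<open>Atoms and the induction on formulas\<close>

lemma determines_SEmpty:
  assumes "so_wf L \<tau> (SEmpty Y)"
  shows "determines TYPE('i) {\<lambda>(S :: ('r, 'a) struct) a. pred_val S a Y = {}} 1 (SEmpty Y)"
  unfolding determines_def
proof (intro allI impI)
  let ?p = "\<lambda>(S :: ('r, 'a) struct) a. pred_val S a Y = {}"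
  fix S S' :: "('r, 'a) struct" and I I' :: "'i set" and F F' and a a' :: "'a assignment"
  assume conf: "config (so_fv (SEmpty Y)) S I F a" "config (so_fv (SEmpty Y)) S' I' F' a'"
    and same: "same_counts 1 I (colour {?p} F a) I' (colour {?p} F' a')"
    and sat: "so_sat \<tau> S a (SEmpty Y)"
  have iff: "so_sat \<tau> S a (SEmpty Y) \<longleftrightarrow> (\<forall>i\<in>I. ?p \<in> colour {?p} F a i)"
    if "config (so_fv (SEmpty Y)) S I F a" for S :: "('r, 'a) struct" and I :: "'i set" and F a
    using pred_val_config[OF that, of Y] assms by (simp add: colour_def)
  show "so_sat \<tau> S' a' (SEmpty Y)"
    using sat iff conf same_counts_all[OF same, of "\<lambda>v. ?p \<in> v"] by simp
qed

text \<open>By \<open>so_sat_SElem_parts\<close> the atom is a matter of a colour that occurs, of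
  properties shared by all parts, and of values that are empty in all parts but one. The first two
  are preserved with threshold 1, the last one needs 2.\<close>

lemma determines_SElem:
  fixes is_root :: "'r pred \<Rightarrow> nat \<Rightarrow> ('r, 'a) struct \<Rightarrow> 'a assignment \<Rightarrow> bool"
    and Ys :: "'r pred list" and Z :: "'r pred"
  defines "sat \<equiv> \<lambda>(S :: ('r, 'a) struct) a. so_sat \<tau> S a (SElem Ys Z)"
    and "is_root \<equiv> \<lambda>Y l S a. pred_val S a Y = {[root S l]}"
    and "is_empty \<equiv> \<lambda>Y (S :: ('r, 'a) struct) a. pred_val S a Y = {}"
  assumes wf: "so_wf L \<tau> (SElem Ys Z)"
  shows "determines TYPE('i) ({sat} \<union> is_empty ` set Ys \<union> (\<lambda>(Y, l). is_root Y l) ` (set Ys \<times> {1..w}))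
    2 (SElem Ys Z)" (is "determines _ ?\<Lambda> _ _")
  unfolding determines_def
proof (intro allI impI)
  fix S S' :: "('r, 'a) struct" and I I' :: "'i set" and F F' and a a' :: "'a assignment"
  assume conf: "config (so_fv (SElem Ys Z)) S I F a" "config (so_fv (SElem Ys Z)) S' I' F' a'"
    and same: "same_counts 2 I (colour ?\<Lambda> F a) I' (colour ?\<Lambda> F' a')"
    and S: "so_sat \<tau> S a (SElem Ys Z)"
  have root_in: "is_root Y l \<in> ?\<Lambda>" if "Y \<in> set Ys" "l \<in> {1..w}" for Y l
    by (rule UnI2, rule image_eqI[of _ _ "(Y, l)"]) (use that in simp_all)
  have iff: "so_sat \<tau> S a (SElem Ys Z) \<longleftrightarrow> (\<exists>i\<in>I. sat \<in> colour ?\<Lambda> F a i \<and>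
      (\<forall>Y\<in>set Ys. (\<exists>l\<in>{1..w}. \<forall>j\<in>I. is_root Y l \<in> colour ?\<Lambda> F a j) \<or>
        (\<forall>j\<in>I. j \<noteq> i \<longrightarrow> is_empty Y \<in> colour ?\<Lambda> F a j)))"
    if conf: "config (so_fv (SElem Ys Z)) S I F a" for S :: "('r, 'a) struct" and I :: "'i set" and F a
  proof -
    have 1: "sat \<in> colour ?\<Lambda> F a i \<longleftrightarrow> so_sat \<tau> (F i) (restrict_assignment a (univ (F i))) (SElem Ys Z)" for i
      by (simp add: colour_def sat_def)
    have 2: "is_root Y l \<in> colour ?\<Lambda> F a j \<longleftrightarrow>
        pred_val (F j) (restrict_assignment a (univ (F j))) Y = {[root (F j) l]}"
      if "Y \<in> set Ys" "l \<in> {1..w}" for Y l j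
      unfolding colour_def using root_in[OF that] by (simp add: is_root_def)
    have 3: "is_empty Y \<in> colour ?\<Lambda> F a j \<longleftrightarrow> pred_val (F j) (restrict_assignment a (univ (F j))) Y = {}"
      if "Y \<in> set Ys" for Y j
      using that by (simp add: colour_def is_empty_def)
    show ?thesis
      unfolding so_sat_SElem_parts[OF conf wf]
      by (intro bex_cong conj_cong ball_cong disj_cong imp_cong refl 1[symmetric] 2[symmetric] 3[symmetric]; assumption)
  qed
  obtain i where i: "i \<in> I" "sat \<in> colour ?\<Lambda> F a i"
    and alt: "\<And>Y. Y \<in> set Ys \<Longrightarrow> (\<exists>l\<in>{1..w}. \<forall>j\<in>I. is_root Y l \<in> colour ?\<Lambda> F a j) \<or>
        (\<forall>j\<in>I. j \<noteq> i \<longrightarrow> is_empty Y \<in> colour ?\<Lambda> F a j)"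
    using iff[OF conf(1)] S by metis
  obtain i' where i': "i' \<in> I'" "colour ?\<Lambda> F' a' i' = colour ?\<Lambda> F a i"
    using same_counts_ex[OF same _ i(1)] by auto
  have fin: "finite (colour ?\<Lambda> H b ` J)" for H b and J :: "'i set"
    by (rule finite_colours) simp
  have "(\<exists>l\<in>{1..w}. \<forall>j\<in>I'. is_root Y l \<in> colour ?\<Lambda> F' a' j) \<or>
      (\<forall>j\<in>I'. j \<noteq> i' \<longrightarrow> is_empty Y \<in> colour ?\<Lambda> F' a' j)" if Y: "Y \<in> set Ys" for Y
    using alt[OF Y]
  proof
    assume "\<exists>l\<in>{1..w}. \<forall>j\<in>I. is_root Y l \<in> colour ?\<Lambda> F a j"
    then obtain l where l: "l \<in> {1..w}" "\<forall>j\<in>I. is_root Y l \<in> colour ?\<Lambda> F a j" by (elim bexE)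
    have "\<forall>j\<in>I'. is_root Y l \<in> colour ?\<Lambda> F' a' j"
      by (rule same_counts_all[OF same _ l(2)]) simp
    then show ?thesis using l(1) by metis
  next
    assume empty: "\<forall>j\<in>I. j \<noteq> i \<longrightarrow> is_empty Y \<in> colour ?\<Lambda> F a j"
    have "card (pred_val (F i) (restrict_assignment a (univ (F i))) Y) = 1"
      using i(2) Y by (simp add: colour_def sat_def)
    then have "is_empty Y \<notin> colour ?\<Lambda> F a i"
      by (auto simp: colour_def is_empty_def)
    then have i_only: "{j\<in>I. is_empty Y \<notin> colour ?\<Lambda> F a j} = {i}" and i'_nonempty: "is_empty Y \<notin> colour ?\<Lambda> F' a' i'"
      using empty i(1) i'(2) by auto
    \<comment> \<open>Part \<open>i\<close> is the only one with a nonempty value for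
      \<open>Y\<close>. Threshold 2 tells one part from several, so the other partition also has
      exactly one such part, which must be \<open>i'\<close> because it shares the colour of
      \<open>i\<close>.\<close>
    have "cap 2 {j\<in>I'. is_empty Y \<notin> colour ?\<Lambda> F' a' j} = cap 2 {j\<in>I. is_empty Y \<notin> colour ?\<Lambda> F a j}"
      using same_counts_Collect[OF same fin fin, of "\<lambda>v. is_empty Y \<notin> v"] by simp
    also have "\<dots> = 1"
      unfolding i_only by (simp add: cap_def)
    finally obtain x where x: "{j\<in>I'. is_empty Y \<notin> colour ?\<Lambda> F' a' j} = {x}"
      by (subst (asm) cap_eq_1_iff) auto
    have "j = x" if "j \<in> I'" "is_empty Y \<notin> colour ?\<Lambda> F' a' j" for j
    proof -
      have "j \<in> {j\<in>I'. is_empty Y \<notin> colour ?\<Lambda> F' a' j}" using that by simp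
      then show ?thesis unfolding x by simp
    qed
    then show ?thesis
      using i'(1) i'_nonempty by (intro disjI2 ballI impI) (rule ccontr, metis)
  qed
  then show "so_sat \<tau> S' a' (SElem Ys Z)"
    unfolding iff[OF conf(2)] using i' i(2) by metis
qed

text \<open>The bound on rank and free variables is what lets the colours be read off from the types
  of the parts. Among the cases only the quantifier raises the rank, and by
  \<open>definable_ex_colours\<close> the colours then rise by one as well.\<close>

theorem composition:
  assumes "so_wf L \<tau> \<Phi>"
  shows "\<exists>\<Lambda> N. finite \<Lambda> \<and> 1 \<le> N \<and>
    (\<forall>p\<in>\<Lambda>. definable (so_qr \<Phi>) (so_fv \<Phi>) (p :: ('r, 'a) struct \<Rightarrow> 'a assignment \<Rightarrow> bool)) \<and>
    determines TYPE('i) \<Lambda> N \<Phi>"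
  using assms
proof (induction \<Phi>)
  case (SEmpty Y)
  then have "definable 0 (so_fv (SEmpty Y)) (\<lambda>(S :: ('r, 'a) struct) a. pred_val S a Y = {})"
    by (intro definable_SEmpty) auto
  then show ?case
    using determines_SEmpty[OF SEmpty] by (intro exI conjI) auto
next
  case (SElem Ys Z)
  have "definable 0 (so_fv (SElem Ys Z)) (\<lambda>(S :: ('r, 'a) struct) a. so_sat \<tau> S a (SElem Ys Z))"
    by (rule definable_so_sat) (use SElem in auto)
  moreover have "definable 0 (so_fv (SElem Ys Z)) (\<lambda>(S :: ('r, 'a) struct) a. pred_val S a Y = {})"
    if "Y \<in> set Ys" for Y
    by (rule definable_SEmpty) (use SElem that in auto)
  moreover have "definable 0 (so_fv (SElem Ys Z)) (\<lambda>(S :: ('r, 'a) struct) a. pred_val S a Y = {[root S l]})"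
    if "Y \<in> set Ys" "l \<in> {1..w}" for Y l
    by (rule definable_root_elem) (use SElem that in auto)
  ultimately show ?case
    by (intro exI conjI) (rule_tac [4] determines_SElem[OF SElem], auto)
next
  case (SNeg \<phi>)
  then obtain \<Lambda> :: "(('r, 'a) struct \<Rightarrow> 'a assignment \<Rightarrow> bool) set" and N where
    *: "finite \<Lambda>" "1 \<le> N" "\<forall>p\<in>\<Lambda>. definable (so_qr \<phi>) (so_fv \<phi>) p" "determines TYPE('i) \<Lambda> N \<phi>"
    by auto
  have "determines TYPE('i) \<Lambda> N (SNeg \<phi>)"
    using determinesD[OF *(4)] unfolding determines_def by auto
  with * show ?case by (intro exI[of _ \<Lambda>] exI[of _ N]) simp
next
  case (SConj \<phi> \<psi>)
  then obtain \<Lambda> :: "(('r, 'a) struct \<Rightarrow> 'a assignment \<Rightarrow> bool) set" and N where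
    1: "finite \<Lambda>" "1 \<le> N" "\<forall>p\<in>\<Lambda>. definable (so_qr \<phi>) (so_fv \<phi>) p" "determines TYPE('i) \<Lambda> N \<phi>"
    by auto
  obtain \<Lambda>' :: "(('r, 'a) struct \<Rightarrow> 'a assignment \<Rightarrow> bool) set" and N' where
    2: "finite \<Lambda>'" "1 \<le> N'" "\<forall>p\<in>\<Lambda>'. definable (so_qr \<psi>) (so_fv \<psi>) p" "determines TYPE('i) \<Lambda>' N' \<psi>"
    using SConj by auto
  let ?\<Lambda> = "\<Lambda> \<union> \<Lambda>'" and ?N = "max N N'"
  have "determines TYPE('i) ?\<Lambda> ?N \<phi>" "determines TYPE('i) ?\<Lambda> ?N \<psi>"
    using determines_mono[OF 1(4), of ?\<Lambda> ?N] determines_mono[OF 2(4), of ?\<Lambda> ?N] 1(1) 2(1) by auto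
  note both = this[THEN determinesD]
  have "determines TYPE('i) ?\<Lambda> ?N (SConj \<phi> \<psi>)"
    unfolding determines_def
  proof (intro allI impI)
    fix S S' :: "('r, 'a) struct" and I I' :: "'i set" and F F' and a a' :: "'a assignment"
    assume conf: "config (so_fv (SConj \<phi> \<psi>)) S I F a" "config (so_fv (SConj \<phi> \<psi>)) S' I' F' a'"
      and same: "same_counts ?N I (colour ?\<Lambda> F a) I' (colour ?\<Lambda> F' a')"
      and "so_sat \<tau> S a (SConj \<phi> \<psi>)"
    then show "so_sat \<tau> S' a' (SConj \<phi> \<psi>)"
      using both(1)[OF conf[THEN config_mono] same] both(2)[OF conf[THEN config_mono] same] by simp
  qed
  moreover have "definable (so_qr (SConj \<phi> \<psi>)) (so_fv (SConj \<phi> \<psi>)) p" if "p \<in> ?\<Lambda>" for p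
    using that 1(3) 2(3) by (auto intro: definable_mono)
  ultimately show ?case
    using 1(1,2) 2(1) by (intro exI[of _ ?\<Lambda>] exI[of _ ?N]) auto
next
  case (SEx X \<phi>)
  then obtain \<Lambda> :: "(('r, 'a) struct \<Rightarrow> 'a assignment \<Rightarrow> bool) set" and N where
    *: "finite \<Lambda>" "1 \<le> N" "\<forall>p\<in>\<Lambda>. definable (so_qr \<phi>) (so_fv \<phi>) p" "determines TYPE('i) \<Lambda> N \<phi>"
    by auto
  let ?V = "so_fv \<phi> - {X}"
  have X: "logic_var L X" using SEx by simp
  have p\<^sub>0: "definable (so_qr \<phi>) (insert X ?V) (\<lambda>(S :: ('r, 'a) struct) a. so_sat \<tau> S a \<phi>)"
    by (rule definable_so_sat) (use SEx in auto)
  have "definable (Suc (so_qr \<phi>)) ?V p" if "p \<in> ex_colours X \<Lambda>" for p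
    by (rule definable_ex_colours[OF X *(1) _ p\<^sub>0 that]) (use *(3) in \<open>auto intro: definable_mono\<close>)
  moreover have "1 \<le> N * card (Pow \<Lambda>)"
    using *(1,2) by (simp add: card_Pow)
  ultimately show ?case
    using determines_SEx[OF *(4,1,2) X] finite_ex_colours[OF *(1)] by (intro exI conjI) auto
qed

end

section \<open>First-order sentences about counts\<close>

definition fo_definable :: "'s vocab \<Rightarrow> (('s, 'i) struct \<Rightarrow> bool) \<Rightarrow> bool" where
  "fo_definable \<sigma> p \<longleftrightarrow> (\<exists>\<alpha>\<in>fo_sentences \<sigma>. \<forall>A e. fo_sat A e \<alpha> = p A)"

lemma fo_definable_Not:
  fixes p :: "('s, 'i) struct \<Rightarrow> bool"
  assumes "fo_definable \<sigma> p"
  shows "fo_definable \<sigma> (\<lambda>A. \<not> p A)"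
proof -
  obtain \<alpha> where "\<alpha> \<in> fo_sentences \<sigma>" "\<And>A (e :: nat \<Rightarrow> 'i). fo_sat A e \<alpha> = p A"
    using assms by (auto simp: fo_definable_def)
  then show ?thesis
    unfolding fo_definable_def by (intro bexI[of _ "FNeg \<alpha>"]) (auto simp: fo_sentences_def)
qed

lemma fo_definable_conj:
  fixes p p' :: "('s, 'i) struct \<Rightarrow> bool"
  assumes "fo_definable \<sigma> p" "fo_definable \<sigma> p'"
  shows "fo_definable \<sigma> (\<lambda>A. p A \<and> p' A)"
proof -
  obtain \<alpha> \<alpha>' where "\<alpha> \<in> fo_sentences \<sigma>" "\<And>A (e :: nat \<Rightarrow> 'i). fo_sat A e \<alpha> = p A"
      "\<alpha>' \<in> fo_sentences \<sigma>" "\<And>A (e :: nat \<Rightarrow> 'i). fo_sat A e \<alpha>' = p' A"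
    using assms by (auto simp: fo_definable_def)
  then show ?thesis
    unfolding fo_definable_def by (intro bexI[of _ "FConj \<alpha> \<alpha>'"]) (auto simp: fo_sentences_def)
qed

text \<open>The quantifier makes the formula closed; this form also holds in an empty
  universe.\<close>

lemma fo_definable_True: "fo_definable \<sigma> (\<lambda>A. True)"
  unfolding fo_definable_def
  by (rule bexI[of _ "FNeg (FEx 0 (FNeg (FEq 0 0)))"]) (auto simp: fo_sentences_def)

lemma fo_definable_ball:
  "finite X \<Longrightarrow> (\<And>x. x \<in> X \<Longrightarrow> fo_definable \<sigma> (p x)) \<Longrightarrow> fo_definable \<sigma> (\<lambda>A. \<forall>x\<in>X. p x A)"
  by (induction X rule: finite_induct) (simp_all add: fo_definable_True fo_definable_conj)

lemma fo_definable_bex: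
  assumes "finite X" "\<And>x. x \<in> X \<Longrightarrow> fo_definable \<sigma> (p x)"
  shows "fo_definable \<sigma> (\<lambda>A. \<exists>x\<in>X. p x A)"
proof -
  have "fo_definable \<sigma> (\<lambda>A. \<not> (\<forall>x\<in>X. \<not> p x A))"
    by (intro fo_definable_Not fo_definable_ball assms)
  then show ?thesis by simp
qed

text \<open>Finitely many properties have finitely many truth patterns, so an arbitrary set
  \<open>Q\<close> of patterns amounts to a finite disjunction, no matter how \<open>Q\<close> is
  given.\<close>

lemma fo_definable_profile:
  assumes "finite X" "\<And>x. x \<in> X \<Longrightarrow> fo_definable \<sigma> (p x)"
  shows "fo_definable \<sigma> (\<lambda>A. {x\<in>X. p x A} \<in> Q)"
proof -
  have lit: "fo_definable \<sigma> (\<lambda>A. p x A = (x \<in> Y))" if "x \<in> X" for x Y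
    using assms(2)[OF that] fo_definable_Not[OF assms(2)[OF that]] by (cases "x \<in> Y") simp_all
  have "fo_definable \<sigma> (\<lambda>A. \<exists>Y\<in>Pow X \<inter> Q. \<forall>x\<in>X. p x A = (x \<in> Y))"
    by (intro fo_definable_bex fo_definable_ball lit) (use assms(1) in auto)
  moreover have "(\<exists>Y\<in>Pow X \<inter> Q. \<forall>x\<in>X. p x A = (x \<in> Y)) \<longleftrightarrow> {x\<in>X. p x A} \<in> Q" for A
  proof
    assume "\<exists>Y\<in>Pow X \<inter> Q. \<forall>x\<in>X. p x A = (x \<in> Y)"
    then obtain Y where Y: "Y \<in> Q" "Y \<subseteq> X" "\<forall>x\<in>X. p x A = (x \<in> Y)" by blast
    then have "{x\<in>X. p x A} = Y" by blast
    then show "{x\<in>X. p x A} \<in> Q" using Y(1) by simp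
  next
    assume "{x\<in>X. p x A} \<in> Q"
    then show "\<exists>Y\<in>Pow X \<inter> Q. \<forall>x\<in>X. p x A = (x \<in> Y)"
      by (intro bexI[of _ "{x\<in>X. p x A}"]) auto
  qed
  ultimately show ?thesis by simp
qed

lemma ex_fo_fresh:
  "\<exists>\<alpha>. fo_wf \<sigma> \<alpha> \<and> fo_fv \<alpha> \<subseteq> insert k {..<j} \<and>
    (\<forall>(A :: ('s, 'i) struct) e. fo_sat A e \<alpha> \<longleftrightarrow> e k \<notin> e ` {..<j})"
proof (induction j)
  case 0
  show ?case by (rule exI[of _ "FEq k k"]) simp
next
  case (Suc j)
  then obtain \<alpha> where "fo_wf \<sigma> \<alpha>" "fo_fv \<alpha> \<subseteq> insert k {..<j}"
      "\<And>(A :: ('s, 'i) struct) e. fo_sat A e \<alpha> \<longleftrightarrow> e k \<notin> e ` {..<j}" by auto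
  then show ?case
    by (intro exI[of _ "FConj (FNeg (FEq k j)) \<alpha>"]) (auto simp: lessThan_Suc)
qed

text \<open>The variables below \<open>k\<close> hold the elements counted so far, and the recursion
  asks for \<open>n\<close> more elements apart from these. For \<open>k = 0\<close> the formula is
  a sentence.\<close>

lemma ex_fo_at_least:
  assumes "T \<in> syms \<sigma>" "ar \<sigma> T = 1"
  shows "\<exists>\<alpha>. fo_wf \<sigma> \<alpha> \<and> fo_fv \<alpha> \<subseteq> {..<k} \<and> (\<forall>(A :: ('s, 'i) struct) e. fo_sat A e \<alpha> \<longleftrightarrow>
    (\<exists>X\<subseteq>{i\<in>univ A. [i] \<in> rel A T} - e ` {..<k}. finite X \<and> card X = n))"
proof (induction n arbitrary: k)
  case 0
  show ?case
    by (rule exI[of _ "FNeg (FEx 0 (FNeg (FEq 0 0)))"]) (simp add: exI[of _ "{}"])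
next
  case (Suc n)
  obtain \<alpha> where \<alpha>: "fo_wf \<sigma> \<alpha>" "fo_fv \<alpha> \<subseteq> {..<Suc k}"
      "\<And>(A :: ('s, 'i) struct) e. fo_sat A e \<alpha> \<longleftrightarrow>
        (\<exists>X\<subseteq>{i\<in>univ A. [i] \<in> rel A T} - e ` {..<Suc k}. finite X \<and> card X = n)"
    using Suc[of "Suc k"] by auto
  obtain \<delta> where \<delta>: "fo_wf \<sigma> \<delta>" "fo_fv \<delta> \<subseteq> insert k {..<k}"
      "\<And>(A :: ('s, 'i) struct) e. fo_sat A e \<delta> \<longleftrightarrow> e k \<notin> e ` {..<k}"
    using ex_fo_fresh[of \<sigma> k k] by auto
  let ?\<beta> = "FEx k (FConj (FRel T [k]) (FConj \<delta> \<alpha>))"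
  have "fo_sat A e ?\<beta> \<longleftrightarrow> (\<exists>X\<subseteq>{i\<in>univ A. [i] \<in> rel A T} - e ` {..<k}. finite X \<and> card X = Suc n)"
    for A :: "('s, 'i) struct" and e
  proof -
    let ?T = "{i\<in>univ A. [i] \<in> rel A T}"
    have upd: "(e(k := i)) ` {..<k} = e ` {..<k}" "(e(k := i)) ` {..<Suc k} = insert i (e ` {..<k})" for i
      by (auto simp: lessThan_Suc)
    have "fo_sat A e ?\<beta> \<longleftrightarrow>
        (\<exists>i\<in>?T - e ` {..<k}. \<exists>X\<subseteq>?T - insert i (e ` {..<k}). finite X \<and> card X = n)"
      using \<alpha>(3) \<delta>(3) upd by (auto simp del: fun_upd_apply simp add: fun_upd_same)
    also have "\<dots> \<longleftrightarrow> (\<exists>X\<subseteq>?T - e ` {..<k}. finite X \<and> card X = Suc n)"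
    proof
      assume "\<exists>i\<in>?T - e ` {..<k}. \<exists>X\<subseteq>?T - insert i (e ` {..<k}). finite X \<and> card X = n"
      then obtain i X where iX: "i \<in> ?T - e ` {..<k}" "X \<subseteq> ?T - insert i (e ` {..<k})" "finite X" "card X = n"
        by blast
      then have "i \<notin> X" by auto
      with iX show "\<exists>X\<subseteq>?T - e ` {..<k}. finite X \<and> card X = Suc n"
        by (intro exI[of _ "insert i X"]) auto
    next
      assume "\<exists>X\<subseteq>?T - e ` {..<k}. finite X \<and> card X = Suc n"
      then obtain X where X: "X \<subseteq> ?T - e ` {..<k}" "finite X" "card X = Suc n" by blast
      then obtain i Y where "X = insert i Y" "i \<notin> Y" "card Y = n" "finite Y"
        by (metis card_Suc_eq finite_insert)
      then show "\<exists>i\<in>?T - e ` {..<k}. \<exists>X\<subseteq>?T - insert i (e ` {..<k}). finite X \<and> card X = n"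
        using X(1) by (intro bexI[of _ i] exI[of _ Y]) auto
    qed
    finally show ?thesis .
  qed
  moreover have "fo_wf \<sigma> ?\<beta>" "fo_fv ?\<beta> \<subseteq> {..<k}"
    using \<alpha>(1,2) \<delta>(1,2) assms by auto
  ultimately show ?case by (intro exI[of _ ?\<beta>]) blast
qed

lemma fo_definable_cap:
  assumes "T \<in> syms \<sigma>" "ar \<sigma> T = 1" "n \<le> N"
  shows "fo_definable \<sigma> (\<lambda>A :: ('s, 'i) struct. n \<le> cap N {i\<in>univ A. [i] \<in> rel A T})"
proof -
  obtain \<alpha> where "fo_wf \<sigma> \<alpha>" "fo_fv \<alpha> \<subseteq> {..<0}"
      "\<And>(A :: ('s, 'i) struct) e. fo_sat A e \<alpha> \<longleftrightarrow>
        (\<exists>X\<subseteq>{i\<in>univ A. [i] \<in> rel A T} - e ` {..<0}. finite X \<and> card X = n)"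
    using ex_fo_at_least[OF assms(1,2), of 0 n] by auto
  then show ?thesis
    unfolding fo_definable_def le_cap_iff[OF assms(3)]
    by (intro bexI[of _ \<alpha>]) (auto simp: fo_sentences_def)
qed

text \<open>Types refine the colours of \<open>composition\<close>: each colour predicate is
  expressed by a formula \<open>\<psi> p\<close>, whose truth the type records as soon as
  \<open>m\<close> admits the arities of its bound variables. So truncated counts of types decide
  \<open>\<Phi>\<close>. If \<open>I\<close> is empty, then so are the structure and the indicator,
  yet a nullary variable may or may not hold the empty tuple, which the indicator cannot show; this
  explains the condition on \<open>\<rho>\<close>.\<close>

theorem theorem14:
  fixes L :: logic and \<tau> :: "'r vocab" and \<rho> :: "nat \<Rightarrow> nat" and k q w :: nat
    and B :: "nat \<Rightarrow> 'r" and \<Phi> :: "'r so"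
  assumes "vocabulary \<tau>"
    and "root_symbols \<tau> w B"
    and "\<forall>j\<in>{1..k}. logic_var L (xvar \<rho> j)"
    and "\<Phi> \<in> formulas L \<tau> \<rho> k q"
  shows "\<exists>m\<^sub>0. \<forall>m\<ge>m\<^sub>0. \<exists>\<alpha> \<in> fo_sentences (type_vocab TYPE('a) m L \<tau> \<rho> k q).
    \<forall>(S :: ('r, 'a) struct) (I :: 'i set) F a.
      rooted_structure \<tau> w B S \<longrightarrow>
      rooted_partition \<tau> w B S I F \<longrightarrow>
      guarded_assignment \<tau> \<rho> k S a \<longrightarrow>
      (I = {} \<longrightarrow> (\<forall>j\<in>{1..k}. 0 < \<rho> j)) \<longrightarrow>
      (fo_models (type_indicator m L \<tau> \<rho> k q I F a) \<alpha> \<longleftrightarrow> so_sat \<tau> S a \<Phi>)"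
proof -
  interpret rooted_vocabulary L \<tau> w B
    by unfold_locales (fact assms)+
  have \<Phi>: "so_wf L \<tau> \<Phi>" "so_fv \<Phi> \<subseteq> xvar \<rho> ` {1..k}" "so_qr \<Phi> \<le> q"
    using assms(4) by (auto simp: formulas_def)
  obtain \<Lambda> :: "(('r, 'a) struct \<Rightarrow> 'a assignment \<Rightarrow> bool) set" and N where
    fin: "finite \<Lambda>" and N: "1 \<le> N" and def: "\<forall>p\<in>\<Lambda>. definable (so_qr \<Phi>) (so_fv \<Phi>) p"
    and det: "determines TYPE('i) \<Lambda> N \<Phi>"
    using composition[OF \<Phi>(1)] by metis
  from def obtain \<psi> where \<psi>: "\<And>p. p \<in> \<Lambda> \<Longrightarrow> so_wf L \<tau> (\<psi> p) \<and> so_fv (\<psi> p) \<subseteq> so_fv \<Phi> \<and>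
      so_qr (\<psi> p) \<le> so_qr \<Phi> \<and> (\<forall>S a. good (so_fv \<Phi>) S a \<longrightarrow> so_sat \<tau> S a (\<psi> p) = p S a)"
    unfolding definable_def by metis
  have "finite (so_bv \<phi>)" for \<phi> :: "'r so"
    by (induction \<phi>) auto
  \<comment> \<open>The arities are bounded over the finitely many representatives, before any
    structure is fixed.\<close>
  then have "finite (\<Union>p\<in>\<Lambda>. sv_arity ` so_bv (\<psi> p))"
    using fin by simp
  then obtain m\<^sub>0 where m\<^sub>0: "\<And>p X. p \<in> \<Lambda> \<Longrightarrow> X \<in> so_bv (\<psi> p) \<Longrightarrow> sv_arity X \<le> m\<^sub>0"
    unfolding finite_nat_set_iff_bounded_le by auto
  show ?thesis
  proof (intro exI[of _ m\<^sub>0] allI impI)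
    fix m assume m: "m\<^sub>0 \<le> m"
    let ?\<sigma> = "type_vocab TYPE('a) m L \<tau> \<rho> k q" and ?T = "all_types TYPE('a) m L \<tau> \<rho> k q"
    let ?type = "\<lambda>F a i. so_type m L \<tau> \<rho> k q (F i) (restrict_assignment a (univ (F i)))"
    let ?ind = "type_indicator m L \<tau> \<rho> k q"
    have \<psi>_in: "\<psi> p \<in> formulas_bd m L \<tau> \<rho> k q" if "p \<in> \<Lambda>" for p
      using \<psi>[OF that] \<Phi>(2,3) m\<^sub>0[OF that] m unfolding formulas_bd_def formulas_def
      by (auto intro: order_trans)
    have fin_T: "finite ?T" by (rule finite_all_types[OF assms(1)])
    define ok where "ok = (\<lambda>(S :: ('r, 'a) struct) (I :: 'i set) F a. rooted_structure \<tau> w B S \<and>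
      rooted_partition \<tau> w B S I F \<and> guarded_assignment \<tau> \<rho> k S a \<and> (I = {} \<longrightarrow> (\<forall>j\<in>{1..k}. 0 < \<rho> j)))"
    define profile where "profile = (\<lambda>A :: ('r so set, 'i) struct.
      {x\<in>?T \<times> {..N}. snd x \<le> cap N {i\<in>univ A. [i] \<in> rel A (fst x)}})"
    have profile_iff: "(T, n) \<in> profile (?ind I F a) \<longleftrightarrow> T \<in> ?T \<and> n \<le> N \<and> n \<le> cap N {i\<in>I. ?type F a i = T}"
      for T n and I :: "'i set" and F :: "'i \<Rightarrow> ('r, 'a) struct" and a
    proof -
      have "{i\<in>univ (?ind I F a). [i] \<in> rel (?ind I F a) T} = {i\<in>I. ?type F a i = T}"
        by (auto simp: type_indicator_def)
      then show ?thesis by (auto simp: profile_def)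
    qed
    \<comment> \<open>The accepted profiles are simply those of the configurations that satisfy
      \<open>\<Phi>\<close>. By \<open>transfer\<close> below, no configuration that falsifies
      \<open>\<Phi>\<close> has one of them.\<close>
    define Q where "Q = {profile (?ind I F a) | S I F a. ok S I F a \<and> so_sat \<tau> S a \<Phi>}"
    have "fo_definable ?\<sigma> (\<lambda>A. profile A \<in> Q)"
      unfolding profile_def
      by (intro fo_definable_profile fo_definable_cap) (use fin_T in \<open>auto simp: type_vocab_def\<close>)
    then obtain \<alpha> where \<alpha>: "\<alpha> \<in> fo_sentences ?\<sigma>" "\<And>A (e :: nat \<Rightarrow> 'i). fo_sat A e \<alpha> \<longleftrightarrow> profile A \<in> Q"
      unfolding fo_definable_def by metis
    have type_in: "?type F a i \<in> ?T" if "ok S I F a" "i \<in> I" for S I F a i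
      using so_type_part_in_all_types that unfolding ok_def by metis
    have transfer: "so_sat \<tau> S a \<Phi> \<longleftrightarrow> so_sat \<tau> S' a' \<Phi>"
      if ok: "ok S I F a" "ok S' I' F' a'" and eq: "profile (?ind I F a) = profile (?ind I' F' a')"
      for S S' I I' F F' a a'
    proof -
      have cap_eq: "cap N {i\<in>I. ?type F a i = T} = cap N {i\<in>I'. ?type F' a' i = T}" for T
      proof (cases "T \<in> ?T")
        case True
        then have le_iff: "n \<le> cap N {i\<in>I. ?type F a i = T} \<longleftrightarrow> n \<le> cap N {i\<in>I'. ?type F' a' i = T}"
          if "n \<le> N" for n
          using profile_iff[of T n I F a] profile_iff[of T n I' F' a'] eq that by simp
        show ?thesis
          using le_iff[OF cap_le, of "{i\<in>I. ?type F a i = T}"] le_iff[OF cap_le, of "{i\<in>I'. ?type F' a' i = T}"]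
          by simp
      next
        case False
        then have "{i\<in>I. ?type F a i = T} = {}" "{i\<in>I'. ?type F' a' i = T} = {}"
          using type_in ok by auto
        then show ?thesis by (simp only:)
      qed
      then have same: "same_counts N I (?type F a) I' (?type F' a')"
        by (simp add: same_counts_def)
      show ?thesis
      \<comment> \<open>\<open>config\<close> demands a nonempty index set, so that root-only tuples
        lie in some part. Without parts, both structures are empty and agree on everything that
        \<open>\<Phi>\<close> mentions.\<close>
      proof (cases "I = {}")
        case True
        then have "I' = {}"
          using same_counts_ex[OF same_counts_sym[OF same] N] by blast
        have empty: "univ S = {}" "\<And>R. R \<in> syms \<tau> \<Longrightarrow> rel S R = {}" "\<And>X. X \<in> so_fv \<Phi> \<Longrightarrow> a X = {}"
          if "ok S {} F a" for S F a
        proof -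
          show S: "univ S = {}" and "\<And>R. R \<in> syms \<tau> \<Longrightarrow> rel S R = {}"
            using that by (auto simp: ok_def rooted_partition_def struct_eq_def struct_Union_def)
          fix X assume "X \<in> so_fv \<Phi>"
          then obtain j where j: "j \<in> {1..k}" "X = xvar \<rho> j" using \<Phi>(2) by blast
          then have "a X \<subseteq> tuples {} (\<rho> j)" "0 < \<rho> j"
            using that S unfolding ok_def guarded_assignment_def assignment_on_def by metis+
          then show "a X = {}" by (auto simp: tuples_def)
        qed
        show ?thesis
          using empty[of S F a] empty[of S' F' a'] ok \<open>I' = {}\<close> True
          by (intro so_sat_cong[OF _ _ \<Phi>(1)]) simp_all
      next
        case False
        then have "I' \<noteq> {}"
          using same_counts_ex[OF same N] by blast
        have conf: "config (so_fv \<Phi>) S I F a" if ok: "ok S I F a" and ne: "I \<noteq> {}" for S I F a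
          unfolding config_def
        proof (intro conjI ballI ne)
          show S: "rooted_structure \<tau> w B S" "rooted_partition \<tau> w B S I F"
            using ok by (simp_all add: ok_def)
          fix X assume "X \<in> so_fv \<Phi>"
          then obtain j where j: "j \<in> {1..k}" "X = xvar \<rho> j" using \<Phi>(2) by blast
          then have "a X \<subseteq> tuples (univ S) (sv_arity X)" "guarded \<tau> S (a X)"
            using ok by (auto simp: ok_def guarded_assignment_def assignment_on_def xvar_def)
          then show "a X \<subseteq> (\<Union>i\<in>I. tuples (univ (F i)) (sv_arity X))"
            by (rule guarded_in_parts[OF S ne])
        qed
        have colour: "colour \<Lambda> F a i = {p\<in>\<Lambda>. \<psi> p \<in> ?type F a i}" if ok: "ok S I F a" and i: "i \<in> I" for S I F a i
        proof -
          have "I \<noteq> {}" using i by blast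
          then have "good (so_fv \<Phi>) (F i) (restrict_assignment a (univ (F i)))"
            using good_part[of S I F i] ok i by (simp add: ok_def)
          then show ?thesis
            using \<psi> \<psi>_in by (auto simp: colour_def so_type_def)
        qed
        \<comment> \<open>The map from types to colours is the same for both partitions, so equal
          counts of types give equal counts of colours.\<close>
        have "same_counts N I (colour \<Lambda> F a) I' (colour \<Lambda> F' a')"
          by (rule same_counts_coarsen[OF same, where g = "\<lambda>T. {p\<in>\<Lambda>. \<psi> p \<in> T}"])
            (use type_in ok colour fin_T in \<open>auto intro: finite_subset[of _ ?T]\<close>)
        then show ?thesis
          using determinesD[OF det conf[OF ok(1) False] conf[OF ok(2) \<open>I' \<noteq> {}\<close>]] by blast
      qed
    qed
    have models: "fo_models (?ind I F a) \<alpha> \<longleftrightarrow> so_sat \<tau> S a \<Phi>" if ok: "ok S I F a" for S I F a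
    proof -
      have "fo_models (?ind I F a) \<alpha> \<longleftrightarrow> profile (?ind I F a) \<in> Q"
        by (simp add: fo_models_def \<alpha>(2))
      also have "\<dots> \<longleftrightarrow> so_sat \<tau> S a \<Phi>"
      proof
        assume "profile (?ind I F a) \<in> Q"
        then obtain S' I' F' a' where "profile (?ind I F a) = profile (?ind I' F' a')" "ok S' I' F' a'"
            "so_sat \<tau> S' a' \<Phi>"
          unfolding Q_def by blast
        then show "so_sat \<tau> S a \<Phi>" using transfer[OF ok] by blast
      next
        assume "so_sat \<tau> S a \<Phi>"
        then show "profile (?ind I F a) \<in> Q" unfolding Q_def using ok by blast
      qed
      finally show ?thesis .
    qed
    show "\<exists>\<alpha>\<in>fo_sentences ?\<sigma>. \<forall>(S :: ('r, 'a) struct) (I :: 'i set) F a.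
      rooted_structure \<tau> w B S \<longrightarrow> rooted_partition \<tau> w B S I F \<longrightarrow> guarded_assignment \<tau> \<rho> k S a \<longrightarrow>
      (I = {} \<longrightarrow> (\<forall>j\<in>{1..k}. 0 < \<rho> j)) \<longrightarrow> (fo_models (?ind I F a) \<alpha> \<longleftrightarrow> so_sat \<tau> S a \<Phi>)"
      using models by (intro bexI[OF _ \<alpha>(1)] allI impI) (simp add: ok_def)
  qed
qed

end
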